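(* Let $M$ be a simply connected Riemann surface and $\psi_0:M\to\mathbb{C}P^n$ a full holomorphic map, with $n>1$, and let $\psi_0,\ldots,\psi_n$ be its harmonic sequence. Suppose that the lift $\Psi=(\psi_0,\ldots,\psi_n):M\to F_{1,\ldots,1}$ is a primitive immersion of constant curvature (that is, the induced metric has constant Gaussian curvature) with respect to at least one $\mathrm{U}(n+1)$-invariant metric $ds^2_F$ on $F_{1,\ldots,1}$ satisfying $$\Psi^*ds^2_F=\sum_{j=0}^{n-1}k_j\gamma_j\,dz\,d\bar z,\qquad\text{where each } k_j \text{ is a positive integer}.$$ Then $\psi_0$ is locally congruent with the Veronese map.
   Context: $\mathbb{C}^{n+1}$ carries its standard Hermitian inner product. A map $\psi:M\to\mathbb{C}P^n$ is identified with the line subbundle of $M\times\mathbb{C}^{n+1}$ with fibre $\psi(z)$ at $z$; it is full if it is not contained in a constant proper complex subspace of $\mathbb{C}^{n+1}$. Harmonic sequence: for a local complex coordinate $z$ on $M$ put $A'_\psi(s)=\pi_{\psi^\perp}\big(\frac{\partial s}{\partial z}\big)$ for local sections $s$ of $\psi$, $\pi_{\psi^\perp}$ being orthogonal projection onto $\psi^\perp$. For $\psi_0$ full holomorphic, $\psi_{j+1}$ is the line subbundle of $\psi_j^\perp$ coinciding almost everywhere with the image of $A'_{\psi_j}$; this gives mutually orthogonal line bundles $\psi_0,\ldots,\psi_n$ with $\psi_0\oplus\cdots\oplus\psi_n=\mathbb{C}^{n+1}$ (and $A'_{\psi_n}=0$). Put $\gamma_j=\mathrm{tr}\,A'_{\psi_j}(A'_{\psi_j})^*$.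 Full flag manifold: $F_{1,\ldots,1}=\mathrm{U}(n+1)/\mathrm{U}(1)^{n+1}$ is the manifold of $(n+1)$-tuples of mutually orthogonal complex lines in $\mathbb{C}^{n+1}$; its complexified tangent space at $(L_0,\ldots,L_n)$ is $\sum_{i\ne j}\mathrm{Hom}(L_i,L_j)$, and its $\mathrm{U}(n+1)$-invariant metrics are those of the form $g(\xi,\eta)=\sum_{i\neq j}\lambda_{ij}\,\mathrm{tr}\,\xi_{ij}\eta_{ij}^*$ with positive constants $\lambda_{ij}=\lambda_{ji}$. A map $\Psi=(\psi_0,\ldots,\psi_n)$ is primitive if $d\Psi(\partial/\partial z)$ takes values in $\sum_{j\in\mathbb{Z}_{n+1}}\mathrm{Hom}(\psi_j,\psi_{j+1})$; the lift $\Psi=(\psi_0,\ldots,\psi_n)$ of the harmonic sequence $\psi_0,\ldots,\psi_n$ of a full holomorphic map $\psi_0:M\to\mathbb{C}P^n$ is always primitive. Veronese map: $V^n:\mathbb{C}\cup\{\infty\}\to\mathbb{C}P^n$, $V^n(w)=\big[1,\sqrt{\tbinom{n}{1}}\,w,\ldots,\sqrt{\tbinom{n}{r}}\,w^r,\ldots,w^n\big]$. "Locally congruent with the Veronese map" means: every point of $M$ has a neighbourhood $U$ with a holomorphic coordinate $w:U\to\mathbb{C}$ and a constant $A\in\mathrm{U}(n+1)$ such that $\psi_0=A\,V^n(w)$ on $U$. *)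

theory Defs
  imports "HOL-Complex_Analysis.Complex_Analysis"
begin

section \<open>Hermitian linear algebra on \<open>complex ^ 'm\<close>\<close>

text \<open>Subspaces are complex subspaces, i.e. \<open>vec.subspace\<close>, \<open>vec.span\<close> and \<open>vec.dim\<close>;
  the unqualified \<open>subspace\<close>, \<open>span\<close> and \<open>dim\<close> are the real notions.\<close>

definition hinner :: "complex ^ 'm \<Rightarrow> complex ^ 'm \<Rightarrow> complex" where
  "hinner x y = (\<Sum>i\<in>UNIV. x $ i * cnj (y $ i))"

definition horth :: "(complex ^ 'm) set \<Rightarrow> (complex ^ 'm) set" where
  "horth L = {v. \<forall>u\<in>L. hinner v u = 0}"

definition hproj :: "(complex ^ 'm) set \<Rightarrow> complex ^ 'm \<Rightarrow> complex ^ 'm" where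
  "hproj L v = (THE u. u \<in> L \<and> v - u \<in> horth L)"

definition cadjoint :: "complex ^ 'm ^ 'k \<Rightarrow> complex ^ 'k ^ 'm" where
  "cadjoint A = (\<chi> i j. cnj (A $ j $ i))"

definition unitary_matrix :: "complex ^ 'm ^ 'm \<Rightarrow> bool" where
  "unitary_matrix A \<longleftrightarrow> A ** cadjoint A = mat 1 \<and> cadjoint A ** A = mat 1"

definition complex_line :: "(complex ^ 'm) set \<Rightarrow> bool" where
  "complex_line L \<longleftrightarrow> vec.subspace L \<and> vec.dim L = 1"


section \<open>Riemann surfaces\<close>

text \<open>The surface is a whole type \<open>'a\<close>. A chart is a domain together with a complex-valued
  function, of which only the values on the domain matter.\<close>

type_synonym 'a chart = "'a set \<times> ('a \<Rightarrow> complex)"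

definition is_chart :: "('a::topological_space) chart \<Rightarrow> bool" where
  "is_chart = (\<lambda>(U, z). open U \<and> open (z ` U) \<and> homeomorphism U (z ` U) z (inv_into U z))"

definition compatible_charts :: "'a chart \<Rightarrow> 'a chart \<Rightarrow> bool" where
  "compatible_charts = (\<lambda>(U, z) (V, y).
     (y \<circ> inv_into U z) holomorphic_on z ` (U \<inter> V) \<and>
     (z \<circ> inv_into V y) holomorphic_on y ` (U \<inter> V))"

definition riemann_surface :: "('a::t2_space) chart set \<Rightarrow> bool" where
  "riemann_surface \<A> \<longleftrightarrow>
     connected (UNIV :: 'a set) \<and>
     (\<forall>c\<in>\<A>. is_chart c) \<and>
     (\<forall>c\<in>\<A>. \<forall>d\<in>\<A>. compatible_charts c d) \<and>
     (\<Union>(U, z)\<in>\<A>. U) = UNIV"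

text \<open>The local complex coordinates, that is, the maximal atlas generated by \<open>\<A>\<close>.\<close>

definition coordinates :: "('a::t2_space) chart set \<Rightarrow> 'a chart set" where
  "coordinates \<A> = {c. is_chart c \<and> (\<forall>d\<in>\<A>. compatible_charts c d)}"

text \<open>The expression of a function on the surface in a coordinate; meaningful on \<open>z ` U\<close> only.\<close>

definition in_coord :: "'a set \<Rightarrow> ('a \<Rightarrow> complex) \<Rightarrow> ('a \<Rightarrow> 'b) \<Rightarrow> complex \<Rightarrow> 'b" where
  "in_coord U z f = f \<circ> inv_into U z"


section \<open>Line bundles in a coordinate domain\<close>

fun Ck_on :: "nat \<Rightarrow> complex set \<Rightarrow> (complex \<Rightarrow> 'b::real_normed_vector) \<Rightarrow> bool" where
  "Ck_on 0 W s \<longleftrightarrow> continuous_on W s"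
| "Ck_on (Suc k) W s \<longleftrightarrow> s differentiable_on W \<and>
     (\<forall>v. Ck_on k W (\<lambda>w. frechet_derivative s (at w) v))"

definition smooth_on :: "complex set \<Rightarrow> (complex \<Rightarrow> 'b::real_normed_vector) \<Rightarrow> bool" where
  "smooth_on W s \<longleftrightarrow> (\<forall>k. Ck_on k W s)"

definition local_section ::
  "(complex \<Rightarrow> (complex ^ 'm) set) \<Rightarrow> complex set \<Rightarrow> (complex \<Rightarrow> complex ^ 'm) \<Rightarrow> bool" where
  "local_section \<psi> W s \<longleftrightarrow> open W \<and> smooth_on W s \<and> (\<forall>w\<in>W. s w \<in> \<psi> w)"

text \<open>The pair \<open>(a, b)\<close> stands for the complexified tangent vector
  \<open>a * \<partial>/\<partial>x + b * \<partial>/\<partial>y\<close>; real tangent vectors are those with \<open>a\<close> and \<open>b\<close> real.\<close>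

type_synonym ctangent = "complex \<times> complex"

definition del_z :: ctangent where
  "del_z = (1/2, - \<i>/2)"

definition dvec :: "ctangent \<Rightarrow> (complex \<Rightarrow> complex ^ 'm) \<Rightarrow> complex \<Rightarrow> complex ^ 'm" where
  "dvec X s w =
     fst X *s frechet_derivative s (at w) 1 + snd X *s frechet_derivative s (at w) \<i>"

text \<open>For a line bundle \<open>\<psi>\<close> and a subspace \<open>L\<close> of \<open>horth (\<psi> w)\<close>, the assignment
  \<open>s w \<mapsto> hproj L (dvec X s w)\<close>, for local sections \<open>s\<close> of \<open>\<psi>\<close>, is tensorial in \<open>s\<close>,
  so it is an element of \<open>Hom(\<psi> w, L)\<close>. Such homomorphisms are represented by matrices on the
  whole space, extended by zero on \<open>horth (\<psi> w)\<close>; this changes neither composition with adjoints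
  nor traces.\<close>

definition second_fund ::
  "(complex \<Rightarrow> (complex ^ 'm) set) \<Rightarrow> (complex ^ 'm) set \<Rightarrow> ctangent \<Rightarrow> complex
     \<Rightarrow> complex ^ 'm ^ 'm" where
  "second_fund \<psi> L X w = matrix (\<lambda>v. THE u. \<exists>W s. local_section \<psi> W s \<and> w \<in> W \<and>
     s w = hproj (\<psi> w) v \<and> u = hproj L (dvec X s w))"

definition A' :: "(complex \<Rightarrow> (complex ^ 'm) set) \<Rightarrow> complex \<Rightarrow> complex ^ 'm ^ 'm" where
  "A' \<psi> w = second_fund \<psi> (horth (\<psi> w)) del_z w"

definition gamma :: "(complex \<Rightarrow> (complex ^ 'm) set) \<Rightarrow> complex \<Rightarrow> real" where
  "gamma \<psi> w = Re (trace (A' \<psi> w ** cadjoint (A' \<psi> w)))"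


section \<open>Maps to projective space and harmonic sequences\<close>

text \<open>Maps to projective space are line-valued maps; smoothness and holomorphy are
  expressed by local nowhere vanishing lifts.\<close>

definition smooth_line_bundle ::
  "('a::t2_space) chart set \<Rightarrow> ('a \<Rightarrow> (complex ^ 'm) set) \<Rightarrow> bool" where
  "smooth_line_bundle \<A> \<psi> \<longleftrightarrow> (\<forall>p. complex_line (\<psi> p)) \<and>
     (\<forall>(U, z)\<in>coordinates \<A>. \<forall>w\<in>z ` U. \<exists>W s. open W \<and> w \<in> W \<and> W \<subseteq> z ` U \<and>
        smooth_on W s \<and> (\<forall>v\<in>W. s v \<noteq> 0 \<and> in_coord U z \<psi> v = vec.span {s v}))"

definition holomorphic_line_map ::
  "('a::t2_space) chart set \<Rightarrow> ('a \<Rightarrow> (complex ^ 'm) set) \<Rightarrow> bool" where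
  "holomorphic_line_map \<A> \<psi> \<longleftrightarrow> (\<forall>p. complex_line (\<psi> p)) \<and>
     (\<forall>(U, z)\<in>coordinates \<A>. \<forall>w\<in>z ` U. \<exists>W s. open W \<and> w \<in> W \<and> W \<subseteq> z ` U \<and>
        (\<forall>i. (\<lambda>v. s v $ i) holomorphic_on W) \<and>
        (\<forall>v\<in>W. s v \<noteq> 0 \<and> in_coord U z \<psi> v = vec.span {s v}))"

definition full_map :: "('a \<Rightarrow> (complex ^ 'm) set) \<Rightarrow> bool" where
  "full_map \<psi> \<longleftrightarrow> \<not> (\<exists>V. vec.subspace V \<and> V \<noteq> UNIV \<and> (\<forall>p. \<psi> p \<subseteq> V))"

text \<open>Mutual orthogonality and \<open>A' (\<psi> n) = 0\<close> are consequences, not part of the definition.\<close>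

definition harmonic_sequence ::
  "('a::t2_space) chart set \<Rightarrow> nat \<Rightarrow> (nat \<Rightarrow> 'a \<Rightarrow> (complex ^ 'm) set) \<Rightarrow> bool" where
  "harmonic_sequence \<A> n \<psi> \<longleftrightarrow>
     (\<forall>j\<le>n. smooth_line_bundle \<A> (\<psi> j)) \<and>
     (\<forall>j<n. \<forall>p. \<psi> (Suc j) p \<subseteq> horth (\<psi> j p)) \<and>
     (\<forall>j<n. \<forall>(U, z)\<in>coordinates \<A>. negligible {w \<in> z ` U.
        in_coord U z (\<psi> (Suc j)) w \<noteq>
        (\<lambda>v. A' (in_coord U z (\<psi> j)) w *v v) ` in_coord U z (\<psi> j) w})"


section \<open>The full flag manifold\<close>

text \<open>A full flag \<open>(L\<^sub>0, \<dots>, L\<^sub>n)\<close> is a function on the naturals of which only the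
  values up to \<open>n\<close> matter; likewise for the components \<open>\<xi> i j \<in> Hom(L\<^sub>i, L\<^sub>j)\<close>,
  \<open>i \<noteq> j\<close>, of a complexified tangent vector \<open>\<xi>\<close>.\<close>

type_synonym 'm flag = "nat \<Rightarrow> (complex ^ 'm) set"
type_synonym 'm flag_tangent = "nat \<Rightarrow> nat \<Rightarrow> complex ^ 'm ^ 'm"

definition full_flag :: "nat \<Rightarrow> 'm::finite flag \<Rightarrow> bool" where
  "full_flag n L \<longleftrightarrow> CARD('m) = n + 1 \<and> (\<forall>i\<le>n. complex_line (L i)) \<and>
     (\<forall>i\<le>n. \<forall>j\<le>n. i \<noteq> j \<longrightarrow> L i \<subseteq> horth (L j))"

definition invariant_flag_metric :: "nat \<Rightarrow> (nat \<Rightarrow> nat \<Rightarrow> real) \<Rightarrow> bool" where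
  "invariant_flag_metric n lam \<longleftrightarrow>
     (\<forall>i\<le>n. \<forall>j\<le>n. i \<noteq> j \<longrightarrow> lam i j > 0 \<and> lam i j = lam j i)"

definition flag_metric ::
  "nat \<Rightarrow> (nat \<Rightarrow> nat \<Rightarrow> real) \<Rightarrow> 'm::finite flag_tangent \<Rightarrow> 'm flag_tangent \<Rightarrow> complex" where
  "flag_metric n lam \<xi> \<eta> =
     (\<Sum>i\<le>n. \<Sum>j\<in>{..n} - {i}. of_real (lam i j) * trace (\<xi> i j ** cadjoint (\<eta> i j)))"

definition flag_differential ::
  "(complex \<Rightarrow> 'm::finite flag) \<Rightarrow> ctangent \<Rightarrow> complex \<Rightarrow> 'm flag_tangent" where
  "flag_differential \<Psi> X w i j = second_fund (\<lambda>v. \<Psi> v i) (\<Psi> w j) X w"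

definition flag_lift :: "(nat \<Rightarrow> 'a \<Rightarrow> (complex ^ 'm) set) \<Rightarrow> 'a \<Rightarrow> 'm::finite flag" where
  "flag_lift \<psi> p i = \<psi> i p"

definition smooth_flag_map ::
  "('a::t2_space) chart set \<Rightarrow> nat \<Rightarrow> ('a \<Rightarrow> 'm::finite flag) \<Rightarrow> bool" where
  "smooth_flag_map \<A> n \<Psi> \<longleftrightarrow>
     (\<forall>p. full_flag n (\<Psi> p)) \<and> (\<forall>i\<le>n. smooth_line_bundle \<A> (\<lambda>p. \<Psi> p i))"

definition primitive_map ::
  "('a::t2_space) chart set \<Rightarrow> nat \<Rightarrow> ('a \<Rightarrow> 'm::finite flag) \<Rightarrow> bool" where
  "primitive_map \<A> n \<Psi> \<longleftrightarrow> smooth_flag_map \<A> n \<Psi> \<and>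
     (\<forall>(U, z)\<in>coordinates \<A>. \<forall>w\<in>z ` U. \<forall>i\<le>n. \<forall>j\<le>n.
        i \<noteq> j \<and> j \<noteq> Suc i mod Suc n \<longrightarrow>
        flag_differential (in_coord U z \<Psi>) del_z w i j = 0)"

definition flag_immersion ::
  "('a::t2_space) chart set \<Rightarrow> nat \<Rightarrow> ('a \<Rightarrow> 'm::finite flag) \<Rightarrow> bool" where
  "flag_immersion \<A> n \<Psi> \<longleftrightarrow> smooth_flag_map \<A> n \<Psi> \<and>
     (\<forall>(U, z)\<in>coordinates \<A>. \<forall>w\<in>z ` U. \<forall>a b :: real. (a, b) \<noteq> (0, 0) \<longrightarrow>
        (\<exists>i\<le>n. \<exists>j\<le>n. i \<noteq> j \<and>
           flag_differential (in_coord U z \<Psi>) (of_real a, of_real b) w i j \<noteq> 0))"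


section \<open>Induced metrics and Gaussian curvature\<close>

text \<open>The Gram matrix of the induced metric with respect to \<open>\<partial>/\<partial>x, \<partial>/\<partial>y\<close>, labelled by
  \<open>1\<close> and \<open>2\<close> in the two-element index type. On real tangent vectors the Hermitian form
  \<open>flag_metric\<close> is real, because \<open>\<xi> j i = - cadjoint (\<xi> i j)\<close> and \<open>lam\<close> is symmetric.\<close>

definition coord_vec :: "2 \<Rightarrow> ctangent" where
  "coord_vec a = (if a = 1 then (1, 0) else (0, 1))"

definition pullback_metric ::
  "nat \<Rightarrow> (nat \<Rightarrow> nat \<Rightarrow> real) \<Rightarrow> (complex \<Rightarrow> 'm::finite flag) \<Rightarrow> complex \<Rightarrow> real ^ 2 ^ 2" where
  "pullback_metric n lam \<Psi> w = (\<chi> a b. Re (flag_metric n lam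
     (flag_differential \<Psi> (coord_vec a) w) (flag_differential \<Psi> (coord_vec b) w)))"

definition pd :: "2 \<Rightarrow> (complex \<Rightarrow> real) \<Rightarrow> complex \<Rightarrow> real" where
  "pd a f w = frechet_derivative f (at w) (if a = 1 then 1 else \<i>)"

definition christoffel :: "(complex \<Rightarrow> real ^ 2 ^ 2) \<Rightarrow> 2 \<Rightarrow> 2 \<Rightarrow> 2 \<Rightarrow> complex \<Rightarrow> real" where
  "christoffel g l a b w = (1/2) * (\<Sum>m\<in>UNIV. matrix_inv (g w) $ l $ m *
     (pd a (\<lambda>v. g v $ b $ m) w + pd b (\<lambda>v. g v $ a $ m) w - pd m (\<lambda>v. g v $ a $ b) w))"

text \<open>The component \<open>l\<close> of \<open>R(\<partial>\<^sub>1, \<partial>\<^sub>2) \<partial>\<^sub>2\<close>, where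
  \<open>R(X, Y) = [\<nabla>\<^sub>X, \<nabla>\<^sub>Y] - \<nabla>\<close> in the direction \<open>[X, Y]\<close>;
  with this sign round spheres have positive curvature.\<close>

definition riemann_122 :: "(complex \<Rightarrow> real ^ 2 ^ 2) \<Rightarrow> 2 \<Rightarrow> complex \<Rightarrow> real" where
  "riemann_122 g l w =
     pd 1 (christoffel g l 2 2) w - pd 2 (christoffel g l 1 2) w +
     (\<Sum>m\<in>UNIV. christoffel g m 2 2 w * christoffel g l 1 m w
             - christoffel g m 1 2 w * christoffel g l 2 m w)"

definition gauss_curvature :: "(complex \<Rightarrow> real ^ 2 ^ 2) \<Rightarrow> complex \<Rightarrow> real" where
  "gauss_curvature g w = (\<Sum>l\<in>UNIV. g w $ 1 $ l * riemann_122 g l w) / det (g w)"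

definition constant_curvature ::
  "('a::t2_space) chart set \<Rightarrow> nat \<Rightarrow> (nat \<Rightarrow> nat \<Rightarrow> real) \<Rightarrow> ('a \<Rightarrow> 'm::finite flag) \<Rightarrow> bool" where
  "constant_curvature \<A> n lam \<Psi> \<longleftrightarrow> (\<exists>K. \<forall>(U, z)\<in>coordinates \<A>. \<forall>w\<in>z ` U.
     gauss_curvature (pullback_metric n lam (in_coord U z \<Psi>)) w = K)"

text \<open>The metric \<open>(\<Sum>j<n. k j * \<gamma>\<^sub>j) dz dz'\<close> with \<open>z'\<close> the conjugate of \<open>z\<close>, so that
  \<open>dz dz' = dx\<^sup>2 + dy\<^sup>2\<close>.\<close>

definition induces_sum_metric ::
  "('a::t2_space) chart set \<Rightarrow> nat \<Rightarrow> (nat \<Rightarrow> nat \<Rightarrow> real) \<Rightarrow> (nat \<Rightarrow> nat)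
     \<Rightarrow> (nat \<Rightarrow> 'a \<Rightarrow> (complex ^ 'm::finite) set) \<Rightarrow> bool" where
  "induces_sum_metric \<A> n lam k \<psi> \<longleftrightarrow> (\<forall>(U, z)\<in>coordinates \<A>. \<forall>w\<in>z ` U.
     pullback_metric n lam (in_coord U z (flag_lift \<psi>)) w =
     mat (\<Sum>j<n. of_nat (k j) * gamma (in_coord U z (\<psi> j)) w))"


section \<open>The Veronese map\<close>

text \<open>The parameter \<open>\<iota>\<close> numbers the coordinates of \<open>complex ^ 'm\<close> by \<open>0, \<dots>, n\<close>.\<close>

definition veronese :: "('m \<Rightarrow> nat) \<Rightarrow> nat \<Rightarrow> complex \<Rightarrow> (complex ^ 'm) set" where
  "veronese \<iota> n w = vec.span {\<chi> i. of_real (sqrt (of_nat (n choose \<iota> i))) * w ^ \<iota> i}"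

definition locally_congruent_veronese ::
  "('a::t2_space) chart set \<Rightarrow> ('m \<Rightarrow> nat) \<Rightarrow> nat \<Rightarrow> ('a \<Rightarrow> (complex ^ 'm::finite) set) \<Rightarrow> bool" where
  "locally_congruent_veronese \<A> \<iota> n \<psi> \<longleftrightarrow> (\<forall>p. \<exists>U w A. (U, w) \<in> coordinates \<A> \<and> p \<in> U \<and>
     unitary_matrix A \<and> (\<forall>q\<in>U. \<psi> q = (\<lambda>v. A *v v) ` veronese \<iota> n (w q)))"

end

theory Submission
  imports Defs
begin

text \<open>
In a coordinate \<open>z\<close> the induced metric is \<open>E dz dz'\<close> with \<open>E = \<Sum>j<n. k j * \<gamma> j\<close>. Let \<open>f\<close> be a local
holomorphic lift of \<open>\<psi> 0\<close> and \<open>\<sigma> j\<close> the wedge product of \<open>f\<close> and its first \<open>j\<close> derivatives. Because the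
lift to the flag manifold is primitive, the \<open>a\<close>-th derivative of \<open>f\<close> lies in the sum of \<open>\<psi> 0, ..., \<psi> a\<close>
(\<open>F_triangular\<close>), and this gives the Pluecker formula that \<open>\<gamma> j\<close> is the mixed second derivative of
\<open>log |\<sigma> j|\<^sup>2\<close> (\<open>wedge_log_curvature\<close>, \<open>sigma_jets\<close>). Thus \<open>E\<close> is the mixed derivative of \<open>log G\<close>, where
\<open>G\<close> is the product of the \<open>|\<sigma> j|\<close> to the powers \<open>2 * k j\<close>. Since the \<open>k j\<close> are integers, \<open>G\<close> is a finite
sum of squared moduli of holomorphic functions. Common zeros of \<open>\<sigma> j\<close> are divided out; they do not
affect the mixed derivative.

Constant curvature is a Liouville equation for \<open>log E\<close>. As \<open>G\<close> is given by holomorphic functions, the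
equation may be polarised (\<open>sesqui_polarize\<close>): \<open>z\<close> and its conjugate become independent variables. The
polarised equation can be integrated twice, and in the coordinate \<open>v\<close> of Bochner and Calabi, \<open>G\<close> is, up
to the squared modulus of a nonvanishing holomorphic function, a power of \<open>1 + a |v|\<^sup>2\<close> with exponent
\<open>1/a\<close>, or \<open>exp (|v|\<^sup>2)\<close> if \<open>a = 0\<close> (\<open>normal_coordinate\<close>). The Taylor coefficients of the functions that
make up \<open>G\<close> are then orthogonal vectors in a space of finite dimension, so only finitely many are nonzero.
This forces \<open>1/a\<close> to be a positive integer and these functions to be polynomials in \<open>v\<close>, up to a common
factor (\<open>finite_rank_quantisation\<close>).

Since \<open>k 0 > 0\<close>, \<open>|f|\<^sup>2\<close> is one of the factors of \<open>G\<close>. Factoring polynomials shows that the factor has the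
same shape: \<open>|f|\<^sup>2 = |q|\<^sup>2 * (1 + |v|\<^sup>2) ^ d\<close> after rescaling \<open>v\<close> (\<open>kernel_factor\<close>,
\<open>constant_curvature_factor\<close>). Hence the Taylor coefficients of \<open>f / q\<close> in \<open>v\<close> have the same inner products
as those of the Veronese curve of degree \<open>d\<close>, and \<open>d = n\<close> because the curve is full on every open set
(\<open>locally_full\<close>). So \<open>f / q\<close> is a unitary image of the Veronese curve (\<open>veronese_rigidity\<close>).
\<close>

section \<open>Sesquiholomorphic kernels and polarisation\<close>

text \<open>The kernels are \<open>k z y\<close>, holomorphic in both variables near the origin; setting
\<open>y = cnj z\<close> gives functions of \<open>z\<close> alone, and every real analytic function met below
arises in this way. Closing the functions of one variable under sums and products is all that is
needed, and it makes derivatives available by rule induction.\<close>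

inductive sesqui :: "real \<Rightarrow> (complex \<Rightarrow> complex \<Rightarrow> complex) \<Rightarrow> bool" for r where
  hol1: "h holomorphic_on ball 0 r \<Longrightarrow> sesqui r (\<lambda>z y. h z)"
| hol2: "h holomorphic_on ball 0 r \<Longrightarrow> sesqui r (\<lambda>z y. h y)"
| add: "sesqui r k \<Longrightarrow> sesqui r l \<Longrightarrow> sesqui r (\<lambda>z y. k z y + l z y)"
| mult: "sesqui r k \<Longrightarrow> sesqui r l \<Longrightarrow> sesqui r (\<lambda>z y. k z y * l z y)"

lemma sesqui_const: "sesqui r (\<lambda>z y. c)"
  by (rule hol1) auto

lemma sesqui_diff:
  assumes "sesqui r k" "sesqui r l" shows "sesqui r (\<lambda>z y. k z y - l z y)"
  using sesqui.add[OF assms(1) sesqui.mult[OF sesqui_const[of r "-1"] assms(2)]] by simp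

lemma sesqui_power:
  assumes "sesqui r k" shows "sesqui r (\<lambda>z y. k z y ^ n)"
  by (induction n) (auto intro: sesqui_const sesqui.mult[OF assms])

lemma has_derivative_cnj_compose:
  assumes "(h has_field_derivative D) (at (cnj z))"
  shows "((\<lambda>z. h (cnj z)) has_derivative (\<lambda>v. D * cnj v)) (at z)"
proof -
  have "(cnj has_derivative cnj) (at z)"
    using bounded_linear.has_derivative[OF bounded_linear_cnj has_derivative_ident] by simp
  moreover have "(h has_derivative (\<lambda>v. D * v)) (at (cnj z))"
    using assms by (simp add: has_field_derivative_def)
  ultimately show ?thesis
    using has_derivative_compose[of cnj cnj z UNIV h "(*) D"] by simp
qed

text \<open>Only the \<open>z\<close>-derivative is recorded as a kernel again, because polarisation differentiates
in no other direction; on the diagonal the \<open>y\<close>-derivative appears as the coefficient of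
\<open>cnj v\<close>.\<close>

lemma sesqui_derivative:
  assumes "sesqui r k"
  shows "\<exists>k' l. sesqui r k' \<and>
    (\<forall>z\<in>ball 0 r. \<forall>y\<in>ball 0 r. ((\<lambda>z. k z y) has_field_derivative k' z y) (at z)) \<and>
    (\<forall>z\<in>ball 0 r. ((\<lambda>z. k z (cnj z)) has_derivative (\<lambda>v. k' z (cnj z) * v + l z * cnj v)) (at z))"
  using assms
proof induction
  case (hol1 h)
  have d: "(h has_field_derivative deriv h z) (at z)" if "z \<in> ball 0 r" for z
    using hol1 holomorphic_derivI that by blast
  show ?case
    by (rule exI[of _ "\<lambda>z y. deriv h z"], rule exI[of _ "\<lambda>z. 0"])
       (use d in \<open>auto intro!: sesqui.hol1 holomorphic_deriv hol1 simp: has_field_derivative_def\<close>)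
next
  case (hol2 h)
  have d: "(h has_field_derivative deriv h z) (at z)" if "z \<in> ball 0 r" for z
    using hol2 holomorphic_derivI that by blast
  have e: "((\<lambda>z. h (cnj z)) has_derivative (\<lambda>v. deriv h (cnj z) * cnj v)) (at z)"
    if "z \<in> ball 0 r" for z
    using has_derivative_cnj_compose[OF d] that by simp
  show ?case
    by (rule exI[of _ "\<lambda>z y. 0"], rule exI[of _ "\<lambda>z. deriv h (cnj z)"])
       (use e in \<open>auto intro!: sesqui_const\<close>)
next
  case (add k1 k2)
  obtain k1' l1 where 1: "sesqui r k1'"
    "\<And>z y. z\<in>ball 0 r \<Longrightarrow> y\<in>ball 0 r \<Longrightarrow> ((\<lambda>z. k1 z y) has_field_derivative k1' z y) (at z)"
    "\<And>z. z\<in>ball 0 r \<Longrightarrow> ((\<lambda>z. k1 z (cnj z)) has_derivative (\<lambda>v. k1' z (cnj z) * v + l1 z * cnj v)) (at z)"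
    using add.IH(1) by blast
  obtain k2' l2 where 2: "sesqui r k2'"
    "\<And>z y. z\<in>ball 0 r \<Longrightarrow> y\<in>ball 0 r \<Longrightarrow> ((\<lambda>z. k2 z y) has_field_derivative k2' z y) (at z)"
    "\<And>z. z\<in>ball 0 r \<Longrightarrow> ((\<lambda>z. k2 z (cnj z)) has_derivative (\<lambda>v. k2' z (cnj z) * v + l2 z * cnj v)) (at z)"
    using add.IH(2) by blast
  show ?case
  proof (intro exI conjI ballI)
    show "sesqui r (\<lambda>z y. k1' z y + k2' z y)" by (intro sesqui.add 1 2)
    show "((\<lambda>z. k1 z y + k2 z y) has_field_derivative k1' z y + k2' z y) (at z)"
      if "z\<in>ball 0 r" "y\<in>ball 0 r" for z y
      by (intro DERIV_add 1 2 that)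
    show "((\<lambda>z. k1 z (cnj z) + k2 z (cnj z)) has_derivative
        (\<lambda>v. (k1' z (cnj z) + k2' z (cnj z)) * v + (l1 z + l2 z) * cnj v)) (at z)"
      if "z\<in>ball 0 r" for z
      by (rule has_derivative_eq_rhs[OF has_derivative_add[OF 1(3)[OF that] 2(3)[OF that]]])
         (auto simp: algebra_simps)
  qed
next
  case (mult k1 k2)
  obtain k1' l1 where 1: "sesqui r k1'"
    "\<And>z y. z\<in>ball 0 r \<Longrightarrow> y\<in>ball 0 r \<Longrightarrow> ((\<lambda>z. k1 z y) has_field_derivative k1' z y) (at z)"
    "\<And>z. z\<in>ball 0 r \<Longrightarrow> ((\<lambda>z. k1 z (cnj z)) has_derivative (\<lambda>v. k1' z (cnj z) * v + l1 z * cnj v)) (at z)"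
    using mult.IH(1) by blast
  obtain k2' l2 where 2: "sesqui r k2'"
    "\<And>z y. z\<in>ball 0 r \<Longrightarrow> y\<in>ball 0 r \<Longrightarrow> ((\<lambda>z. k2 z y) has_field_derivative k2' z y) (at z)"
    "\<And>z. z\<in>ball 0 r \<Longrightarrow> ((\<lambda>z. k2 z (cnj z)) has_derivative (\<lambda>v. k2' z (cnj z) * v + l2 z * cnj v)) (at z)"
    using mult.IH(2) by blast
  show ?case
  proof (intro exI conjI ballI)
    show "sesqui r (\<lambda>z y. k1' z y * k2 z y + k2' z y * k1 z y)"
      by (intro sesqui.add sesqui.mult 1 2 mult.hyps)
    show "((\<lambda>z. k1 z y * k2 z y) has_field_derivative k1' z y * k2 z y + k2' z y * k1 z y) (at z)"
      if "z\<in>ball 0 r" "y\<in>ball 0 r" for z y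
      by (intro DERIV_mult 1 2 that)
    show "((\<lambda>z. k1 z (cnj z) * k2 z (cnj z)) has_derivative
        (\<lambda>v. (k1' z (cnj z) * k2 z (cnj z) + k2' z (cnj z) * k1 z (cnj z)) * v
          + (l1 z * k2 z (cnj z) + l2 z * k1 z (cnj z)) * cnj v)) (at z)"
      if "z\<in>ball 0 r" for z
      by (rule has_derivative_eq_rhs[OF has_derivative_mult[OF 1(3)[OF that] 2(3)[OF that]]])
         (auto simp: algebra_simps)
  qed
qed

lemma wirtinger_zero:
  fixes p q :: complex
  assumes "(\<lambda>v. p * v + q * cnj v) = (\<lambda>v. 0)"
  shows "p = 0" "q = 0"
proof -
  have "p + q = 0" "p * \<i> - q * \<i> = 0"
    using fun_cong[OF assms, of 1] fun_cong[OF assms, of \<i>] by auto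
  then have "p + q = 0" "p - q = 0"
    by (auto simp: algebra_simps)
  then show "p = 0" "q = 0"
    by (auto simp: field_simps)
qed

text \<open>If \<open>k\<close> vanishes on the diagonal \<open>y = cnj z\<close>, then so does its \<open>z\<close>-derivative, since the
coefficients of \<open>v\<close> and \<open>cnj v\<close> in a real derivative are determined separately. Hence all
\<open>z\<close>-derivatives vanish at \<open>z = cnj y\<close>, and the identity theorem applies.\<close>

lemma sesqui_polarize:
  assumes k: "sesqui r k" and diag: "\<And>z. z \<in> ball 0 r \<Longrightarrow> k z (cnj z) = 0"
    and z: "z \<in> ball 0 r" and y: "y \<in> ball 0 r"
  shows "k z y = 0"
proof -
  define x where "x = cnj y"
  have x: "x \<in> ball 0 r" and yx: "y = cnj x" using y by (auto simp: x_def)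
  have hol: "(\<lambda>z. k z y) holomorphic_on ball 0 r" if "sesqui r k" for k
    using sesqui_derivative[OF that] y unfolding holomorphic_on_open[OF open_ball] by blast
  have "(deriv ^^ n) (\<lambda>z. k z y) x = 0" for n
    using k diag
  proof (induction n arbitrary: k)
    case 0
    then show ?case using x yx by simp
  next
    case (Suc n)
    obtain k' l where k': "sesqui r k'"
      "\<And>z y. z\<in>ball 0 r \<Longrightarrow> y\<in>ball 0 r \<Longrightarrow> ((\<lambda>z. k z y) has_field_derivative k' z y) (at z)"
      "\<And>z. z\<in>ball 0 r \<Longrightarrow> ((\<lambda>z. k z (cnj z)) has_derivative (\<lambda>v. k' z (cnj z) * v + l z * cnj v)) (at z)"
      using sesqui_derivative[OF Suc.prems(1)] by blast
    have "k' z (cnj z) = 0" if "z \<in> ball 0 r" for z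
    proof -
      have "((\<lambda>z. k z (cnj z)) has_derivative (\<lambda>v. 0)) (at z)"
        by (rule has_derivative_transform_within_open[OF has_derivative_const[of 0] _ that])
           (auto simp: Suc.prems(2))
      from has_derivative_unique[OF k'(3)[OF that] this] show ?thesis
        by (rule wirtinger_zero)
    qed
    then have IH: "(deriv ^^ n) (\<lambda>z. k' z y) x = 0"
      using Suc.IH k'(1) by blast
    have "(deriv ^^ n) (deriv (\<lambda>z. k z y)) x = (deriv ^^ n) (\<lambda>z. k' z y) x"
    proof (rule higher_deriv_transform_within_open[OF _ _ open_ball x])
      show "deriv (\<lambda>z. k z y) holomorphic_on ball 0 r"
        using hol[OF Suc.prems(1)] by (simp add: holomorphic_deriv)
      show "(\<lambda>z. k' z y) holomorphic_on ball 0 r" by (rule hol[OF k'(1)])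
      show "deriv (\<lambda>z. k z y) w = k' w y" if "w \<in> ball 0 r" for w
        using k'(2)[OF that y] by (rule DERIV_imp_deriv)
    qed
    then show ?case using IH by (simp add: funpow_Suc_right del: funpow.simps)
  qed
  from holomorphic_fun_eq_0_on_connected[OF hol[OF k] open_ball connected_ball this x z]
  show ?thesis .
qed

text \<open>A list of holomorphic functions stands for the kernel \<open>G z y = \<Sum> t z * cnj (t (cnj y))\<close>,
which on the diagonal is the squared norm of the vector of the functions. The indices \<open>a\<close> and
\<open>b\<close> count derivatives in \<open>z\<close> and in \<open>y\<close>.\<close>

definition jet :: "(complex \<Rightarrow> complex) list \<Rightarrow> nat \<Rightarrow> nat \<Rightarrow> complex \<Rightarrow> complex \<Rightarrow> complex" where
  "jet ts a b z y = (\<Sum>t\<leftarrow>ts. (deriv ^^ a) t z * cnj ((deriv ^^ b) t (cnj y)))"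

lemma has_field_derivative_conj_conj:
  assumes "(f has_field_derivative D) (at (cnj y))"
  shows "((\<lambda>y. cnj (f (cnj y))) has_field_derivative cnj D) (at y)"
  using has_field_derivative_cnj_cnj[of f D y] assms by (simp add: o_def)

context
  fixes r :: real and ts :: "(complex \<Rightarrow> complex) list"
  assumes hol: "\<And>t. t \<in> set ts \<Longrightarrow> t holomorphic_on ball 0 r"
begin

lemma jet_deriv1:
  assumes "z \<in> ball 0 r"
  shows "((\<lambda>z. jet ts a b z y) has_field_derivative jet ts (Suc a) b z y) (at z)"
  using hol
proof (induction ts)
  case (Cons t ts)
  have "((\<lambda>z. (deriv ^^ a) t z * cnj ((deriv ^^ b) t (cnj y)))
      has_field_derivative (deriv ^^ Suc a) t z * cnj ((deriv ^^ b) t (cnj y))) (at z)"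
    by (rule DERIV_cmult_right has_field_derivative_higher_deriv[OF _ open_ball assms] Cons.prems)+ auto
  from DERIV_add[OF this Cons.IH] Cons.prems show ?case
    by (simp add: jet_def del: funpow.simps)
qed (auto simp: jet_def[abs_def])

lemma jet_deriv2:
  assumes "y \<in> ball 0 r"
  shows "((\<lambda>y. jet ts a b z y) has_field_derivative jet ts a (Suc b) z y) (at y)"
  using hol
proof (induction ts)
  case (Cons t ts)
  have "((\<lambda>y. (deriv ^^ a) t z * cnj ((deriv ^^ b) t (cnj y)))
      has_field_derivative (deriv ^^ a) t z * cnj ((deriv ^^ Suc b) t (cnj y))) (at y)"
    using assms Cons.prems
    by (intro DERIV_cmult has_field_derivative_conj_conj
        has_field_derivative_higher_deriv[where S = "ball 0 r"]) auto
  from DERIV_add[OF this Cons.IH] Cons.prems show ?case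
    by (simp add: jet_def del: funpow.simps)
qed (auto simp: jet_def[abs_def])

lemma sesqui_jet: "sesqui r (jet ts a b)"
  using hol
proof (induction ts)
  case Nil
  then show ?case by (simp add: jet_def[abs_def] sesqui_const)
next
  case (Cons t ts)
  have "sesqui r (\<lambda>z y. (deriv ^^ a) t z * (cnj \<circ> (deriv ^^ b) t \<circ> cnj) y)"
  proof (intro sesqui.mult sesqui.hol1 sesqui.hol2 holomorphic_on_compose_cnj_cnj)
    have "t holomorphic_on ball 0 r" using Cons.prems by auto
    moreover have "cnj ` ball 0 r = ball 0 r"
      by (auto simp: image_iff intro!: bexI[of _ "cnj _"])
    ultimately show "(deriv ^^ a) t holomorphic_on ball 0 r"
      "(deriv ^^ b) t holomorphic_on cnj ` ball 0 r"
      by (auto intro!: holomorphic_higher_deriv)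
  qed auto
  from sesqui.add[OF this Cons.IH] Cons.prems show ?case
    by (simp add: jet_def[abs_def])
qed

lemma jet_diag_derivative:
  assumes "z \<in> ball 0 r"
  shows "((\<lambda>z. jet ts a b z (cnj z)) has_derivative
     (\<lambda>v. jet ts (Suc a) b z (cnj z) * v + jet ts a (Suc b) z (cnj z) * cnj v)) (at z)"
  using hol
proof (induction ts)
  case (Cons t ts)
  have t: "t holomorphic_on ball 0 r" using Cons.prems by auto
  have 1: "((deriv ^^ a) t has_derivative (\<lambda>v. (deriv ^^ Suc a) t z * v)) (at z)" for a
    using has_field_derivative_higher_deriv[OF t open_ball assms]
    by (simp add: has_field_derivative_def del: funpow.simps)
  have 2: "((\<lambda>z. cnj ((deriv ^^ b) t z)) has_derivative (\<lambda>v. cnj ((deriv ^^ Suc b) t z * v))) (at z)"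
    by (rule bounded_linear.has_derivative[OF bounded_linear_cnj 1])
  have "((\<lambda>z. (deriv ^^ a) t z * cnj ((deriv ^^ b) t z)) has_derivative
    (\<lambda>v. ((deriv ^^ Suc a) t z * cnj ((deriv ^^ b) t z)) * v +
       ((deriv ^^ a) t z * cnj ((deriv ^^ Suc b) t z)) * cnj v)) (at z)"
    by (rule has_derivative_eq_rhs[OF has_derivative_mult[OF 1 2]]) (auto simp: algebra_simps)
  from has_derivative_add[OF this Cons.IH] Cons.prems show ?case
    by (simp add: jet_def algebra_simps del: funpow.simps)
qed (auto simp: jet_def[abs_def])

end

lemma jet_higher_deriv:
  assumes hol: "\<And>t. t \<in> set ts \<Longrightarrow> t holomorphic_on ball 0 s" and z: "z \<in> ball 0 s"
  shows "(deriv ^^ i) (\<lambda>u. jet ts 0 j u y) z = jet ts i j z y"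
  using z
proof (induction i arbitrary: z)
  case (Suc i)
  have "((\<lambda>z. (deriv ^^ i) (\<lambda>u. jet ts 0 j u y) z) has_field_derivative jet ts (Suc i) j z y) (at z)"
    by (rule has_field_derivative_transform_within_open[OF jet_deriv1[OF hol Suc.prems] open_ball Suc.prems])
       (use Suc in auto)
  then show ?case using DERIV_imp_deriv by auto
qed auto

lemma jet_cnj: "cnj (jet ts a b z y) = jet ts b a (cnj y) (cnj z)"
  by (induction ts) (auto simp: jet_def mult.commute)

text \<open>The kernel of the list of all products is the product of the kernels: this is the norm of a
tensor product.\<close>

definition products :: "(complex \<Rightarrow> complex) list \<Rightarrow> (complex \<Rightarrow> complex) list \<Rightarrow> (complex \<Rightarrow> complex) list"
  where "products ms rs = concat (map (\<lambda>m. map (\<lambda>t z. m z * t z) rs) ms)"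

lemma set_products: "set (products ms rs) = {\<lambda>z. m z * t z | m t. m \<in> set ms \<and> t \<in> set rs}"
  by (auto simp: products_def)

lemma jet00: "jet ts 0 0 z y = (\<Sum>t\<leftarrow>ts. t z * cnj (t (cnj y)))"
  by (simp add: jet_def)

lemma jet_products00: "jet (products ms rs) 0 0 z y = jet ms 0 0 z y * jet rs 0 0 z y"
proof -
  have *: "(\<Sum>t\<leftarrow>rs. m z * (t z * (cnj (m (cnj y)) * cnj (t (cnj y))))) =
     m z * (cnj (m (cnj y)) * (\<Sum>t\<leftarrow>rs. t z * cnj (t (cnj y))))" for m
    by (induction rs) (auto simp: algebra_simps)
  show ?thesis
    by (induction ms) (auto simp: products_def jet00 o_def * algebra_simps)
qed

section \<open>Kernels whose metric has constant curvature\<close>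

lemma sesqui_continuous:
  assumes "sesqui r k"
  shows "continuous_on (ball 0 r \<times> ball 0 r) (\<lambda>p. k (fst p) (snd p))"
  using assms
proof induction
  case (hol1 h)
  have "continuous_on (ball 0 r) h" using hol1 holomorphic_on_imp_continuous_on by blast
  then show ?case by (rule continuous_on_compose2) (auto intro!: continuous_intros)
next
  case (hol2 h)
  have "continuous_on (ball 0 r) h" using hol2 holomorphic_on_imp_continuous_on by blast
  then show ?case by (rule continuous_on_compose2) (auto intro!: continuous_intros)
qed (auto intro!: continuous_intros)

lemma sesqui_nonzero_nbhd:
  assumes k: "sesqui r k" and r: "r > 0" and nz: "k 0 0 \<noteq> 0"
  obtains \<rho> where "0 < \<rho>" "\<rho> \<le> r" "\<And>z y. z \<in> ball 0 \<rho> \<Longrightarrow> y \<in> ball 0 \<rho> \<Longrightarrow> k z y \<noteq> 0"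
proof -
  define D :: "(complex \<times> complex) set" where "D = ball 0 r \<times> ball 0 r"
  have D: "open D" "(0,0) \<in> D" using r by (auto simp: D_def open_Times)
  have "open (D \<inter> (\<lambda>p. k (fst p) (snd p)) -` (- {0}))"
    using sesqui_continuous[OF k] D(1) unfolding D_def[symmetric]
    by (intro continuous_open_preimage) auto
  moreover have "(0,0) \<in> D \<inter> (\<lambda>p. k (fst p) (snd p)) -` (- {0})"
    using D nz by simp
  ultimately obtain A B where AB: "open A" "open B" "(0,0) \<in> A \<times> B"
    "A \<times> B \<subseteq> D \<inter> (\<lambda>p. k (fst p) (snd p)) -` (- {0})"
    by (rule open_prod_elim)
  have "0 \<in> A" "0 \<in> B" using AB(3) by auto
  obtain e1 where e1: "e1 > 0" "ball 0 e1 \<subseteq> A" using openE[OF AB(1) \<open>0 \<in> A\<close>] .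
  obtain e2 where e2: "e2 > 0" "ball 0 e2 \<subseteq> B" using openE[OF AB(2) \<open>0 \<in> B\<close>] .
  note e = e1 e2
  show ?thesis
  proof (rule that[of "min r (min e1 e2)"])
    fix z y :: complex assume "z \<in> ball 0 (min r (min e1 e2))" "y \<in> ball 0 (min r (min e1 e2))"
    then have "(z, y) \<in> A \<times> B" using e by auto
    then show "k z y \<noteq> 0" using AB(4) by auto
  qed (use r e in auto)
qed

lemma holomorphic_ball_isCont:
  assumes "f holomorphic_on ball 0 r" "r > 0"
  shows "isCont f (0::complex)"
  using holomorphic_on_imp_continuous_on[OF assms(1)] assms(2)
  by (simp add: continuous_on_eq_continuous_at)

lemma isCont_eventually_nonzero:
  assumes "isCont f x" "f x \<noteq> (0::complex)"
  shows "eventually (\<lambda>z. f z \<noteq> 0) (nhds x)"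
  using assms by (auto simp: isCont_def eventually_nhds_conv_at intro: tendsto_imp_eventually_ne)

lemma isCont_eventually_open:
  assumes "isCont f x" "open S" "f x \<in> S"
  shows "eventually (\<lambda>z. f z \<in> S) (nhds x)"
  using assms by (auto simp: isCont_def eventually_nhds_conv_at intro: topological_tendstoD)

text \<open>A second radius \<open>\<sigma>\<close> is provided because \<open>v\<close> need not map the whole disc into the disc on
which its inverse is defined.\<close>

lemma local_inverse:
  assumes v: "v holomorphic_on ball 0 \<rho>" "inj_on v (ball 0 \<rho>)" "v 0 = 0" and \<rho>: "\<rho> > 0"
  obtains s g \<sigma> where "s > 0" "g holomorphic_on ball 0 s" "\<And>u. u \<in> ball 0 s \<Longrightarrow> g u \<in> ball 0 \<rho>"
    "\<And>u. u \<in> ball 0 s \<Longrightarrow> v (g u) = u" "\<sigma> > 0" "\<sigma> \<le> \<rho>" "\<And>z. z \<in> ball 0 \<sigma> \<Longrightarrow> v z \<in> ball 0 s \<and> g (v z) = z"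
proof -
  have op: "open (v ` ball 0 \<rho>)"
    by (rule open_mapping_thm3[OF v(1) open_ball v(2)])
  obtain g where g: "g holomorphic_on v ` ball 0 \<rho>" "\<And>z. z \<in> ball 0 \<rho> \<Longrightarrow> g (v z) = z"
    using holomorphic_has_inverse[OF v(1) open_ball v(2)] by metis
  have "0 \<in> v ` ball 0 \<rho>" using v(3) \<rho> by (metis centre_in_ball image_eqI)
  from openE[OF op this] obtain s where s: "s > 0" "ball 0 s \<subseteq> v ` ball 0 \<rho>" .
  have gin: "g u \<in> ball 0 \<rho>" and vg: "v (g u) = u" if "u \<in> ball 0 s" for u
    using s(2) that g(2) by fastforce+
  have "eventually (\<lambda>z. z \<in> ball (0::complex) \<rho> \<and> v z \<in> ball 0 s) (nhds 0)"
    using \<rho> s(1) v(3) isCont_eventually_open[OF holomorphic_ball_isCont[OF v(1) \<rho>], of "ball 0 s"]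
    by (intro eventually_conj eventually_nhds_in_open) auto
  then obtain \<sigma> where \<sigma>: "\<sigma> > 0" "\<And>z. z \<in> ball 0 \<sigma> \<Longrightarrow> z \<in> ball 0 \<rho> \<and> v z \<in> ball 0 s"
    unfolding eventually_nhds_metric by (auto simp: dist_commute)
  have "ball (0::complex) \<sigma> \<subseteq> ball 0 \<rho>" using \<sigma>(2) by blast
  then have "\<sigma> \<le> \<rho>" using \<sigma>(1) by (simp add: ball_subset_ball_iff)
  moreover have "g holomorphic_on ball 0 s" using g(1) s(2) holomorphic_on_subset by blast
  ultimately show ?thesis using that[of s g \<sigma>] s(1) gin vg \<sigma> g(2) by blast
qed

lemma linear_ode_zero:
  assumes p: "p holomorphic_on ball 0 r"
    and d: "\<And>y. y \<in> ball 0 r \<Longrightarrow> (f has_field_derivative p y * f y) (at y)"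
    and f0: "f 0 = (0::complex)" and y: "y \<in> ball 0 r"
  shows "f y = 0"
proof -
  obtain P where P': "\<And>x. x \<in> ball 0 r \<Longrightarrow> (P has_field_derivative p x) (at x within ball 0 r)"
    using holomorphic_convex_primitive'[OF convex_ball open_ball p] by blast
  have P: "(P has_field_derivative p x) (at x)" if "x \<in> ball 0 r" for x
    using P'[OF that] at_within_open[OF that open_ball] by simp
  have "((\<lambda>y. f y * exp (- P y)) has_field_derivative 0) (at x within ball 0 r)"
    if "x \<in> ball 0 r" for x
  proof -
    have "((\<lambda>y. f y * exp (- P y)) has_field_derivative
        (p x * f x) * exp (- P x) + (exp (- P x) * - p x) * f x) (at x)"
      by (intro DERIV_mult DERIV_fun_exp DERIV_minus d P that)
    then show ?thesis by (simp add: algebra_simps has_field_derivative_at_within)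
  qed
  then have "\<exists>c. \<forall>x\<in>ball 0 r. f x * exp (- P x) = c"
    using has_field_derivative_zero_constant[OF convex_ball] by blast
  then obtain c where c: "\<And>x. x \<in> ball 0 r \<Longrightarrow> f x * exp (- P x) = c" by blast
  have "0 \<in> ball (0::complex) r" using y by (auto intro: le_less_trans[OF norm_ge_zero])
  then have "c = 0" using c[of 0] f0 by simp
  then show ?thesis using c[OF y] by simp
qed

lemma deriv_zero_on_ball:
  assumes d: "\<And>z. z \<in> ball 0 r \<Longrightarrow> (f has_field_derivative 0) (at z)" and z: "z \<in> ball 0 r"
  shows "f z = f (0::complex)"
proof -
  have "\<exists>c. \<forall>x\<in>ball 0 r. f x = c"
    using has_field_derivative_zero_constant[OF convex_ball] d has_field_derivative_at_within by blast
  moreover have "0 \<in> ball (0::complex) r" using z by (auto intro: le_less_trans[OF norm_ge_zero])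
  ultimately show ?thesis using z by metis
qed

text \<open>For a kernel \<open>G\<close>, \<open>levi\<close> is \<open>G\<^sup>2\<close> times the mixed second derivative of \<open>log G\<close>, and the other
three are its derivatives in \<open>z\<close>, in \<open>y\<close> and in both; the terms that cancel have been left out.\<close>

definition levi where
  "levi ts z y = jet ts 0 0 z y * jet ts 1 1 z y - jet ts 1 0 z y * jet ts 0 1 z y"
definition levi_z where
  "levi_z ts z y = jet ts 0 0 z y * jet ts 2 1 z y - jet ts 2 0 z y * jet ts 0 1 z y"
definition levi_y where
  "levi_y ts z y = jet ts 0 0 z y * jet ts 1 2 z y - jet ts 1 0 z y * jet ts 0 2 z y"
definition levi_zy where
  "levi_zy ts z y = jet ts 0 0 z y * jet ts 2 2 z y - jet ts 2 0 z y * jet ts 0 2 z y"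

text \<open>Write \<open>N\<close> for \<open>levi\<close> and \<open>E = N / G\<^sup>2\<close> for the metric with potential \<open>log G\<close>. Multiplied
by \<open>N\<^sup>2 * G\<^sup>2\<close>, the equation \<open>(log E)\<^sub>z\<^sub>y = - \<kappa> * E\<close> becomes the polynomial equation \<open>curv\<close>; on the
diagonal it says that the Gaussian curvature is \<open>2 * \<kappa>\<close>. The context solves this Liouville
equation after polarising it, when \<open>z\<close> and \<open>y\<close> are independent.\<close>

locale liouville =
  fixes r :: real and ts :: "(complex \<Rightarrow> complex) list" and \<kappa> :: real
  assumes hol: "\<And>t. t \<in> set ts \<Longrightarrow> t holomorphic_on ball 0 r"
    and rpos: "r > 0"
    and nzG: "\<And>z y. z \<in> ball 0 r \<Longrightarrow> y \<in> ball 0 r \<Longrightarrow> jet ts 0 0 z y \<noteq> 0"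
    and nzN: "\<And>z y. z \<in> ball 0 r \<Longrightarrow> y \<in> ball 0 r \<Longrightarrow> levi ts z y \<noteq> 0"
    and curv: "\<And>z. z \<in> ball 0 r \<Longrightarrow> y = cnj z \<Longrightarrow>
      (levi ts z y * levi_zy ts z y - levi_z ts z y * levi_y ts z y) * (jet ts 0 0 z y)\<^sup>2
        = (2 - of_real \<kappa>) * levi ts z y ^ 3"
begin

abbreviation "G \<equiv> jet ts 0 0"
abbreviation "N \<equiv> levi ts"
abbreviation "Ny \<equiv> levi_y ts"

lemma d1: "z \<in> ball 0 r \<Longrightarrow> ((\<lambda>z. jet ts a b z y) has_field_derivative jet ts (Suc a) b z y) (at z)"
  by (rule jet_deriv1[OF hol])

lemma d2: "y \<in> ball 0 r \<Longrightarrow> ((\<lambda>y. jet ts a b z y) has_field_derivative jet ts a (Suc b) z y) (at y)"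
  by (rule jet_deriv2[OF hol])

lemma curv_polar:
  assumes "z \<in> ball 0 r" "y \<in> ball 0 r"
  shows "(N z y * levi_zy ts z y - levi_z ts z y * Ny z y) * (G z y)\<^sup>2 = (2 - of_real \<kappa>) * N z y ^ 3"
proof -
  have "sesqui r (\<lambda>z y. (N z y * levi_zy ts z y - levi_z ts z y * Ny z y) * (G z y)\<^sup>2 - (2 - of_real \<kappa>) * N z y ^ 3)"
    unfolding levi_def levi_z_def levi_y_def levi_zy_def
    by (intro sesqui_diff sesqui.mult sesqui_power sesqui_jet[OF hol] sesqui_const)
  from sesqui_polarize[OF this _ assms] curv show ?thesis by simp
qed

lemma dN_z: "z \<in> ball 0 r \<Longrightarrow> ((\<lambda>z. N z y) has_field_derivative levi_z ts z y) (at z)"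
  unfolding levi_def levi_z_def
  by (rule DERIV_cong[OF DERIV_diff[OF DERIV_mult[OF d1 d1] DERIV_mult[OF d1 d1]]])
     (auto simp: numeral_2_eq_2)

lemma dN_y: "y \<in> ball 0 r \<Longrightarrow> ((\<lambda>y. N z y) has_field_derivative Ny z y) (at y)"
  unfolding levi_def levi_y_def
  by (rule DERIV_cong[OF DERIV_diff[OF DERIV_mult[OF d2 d2] DERIV_mult[OF d2 d2]]])
     (auto simp: numeral_2_eq_2)

lemma dNy_z: "z \<in> ball 0 r \<Longrightarrow> ((\<lambda>z. Ny z y) has_field_derivative levi_zy ts z y) (at z)"
  unfolding levi_y_def levi_zy_def
  by (rule DERIV_cong[OF DERIV_diff[OF DERIV_mult[OF d1 d1] DERIV_mult[OF d1 d1]]])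
     (auto simp: numeral_2_eq_2)

text \<open>\<open>Y\<close> and \<open>X\<close> are the \<open>y\<close>-derivatives of \<open>log G\<close> and of \<open>log E\<close>, and \<open>Yy\<close> is the
\<open>y\<close>-derivative of \<open>Y\<close>. Subtracting \<open>Y 0 y\<close> amounts to normalising \<open>G\<close> to be constant for
\<open>z = 0\<close>, without changing \<open>E\<close>.\<close>

definition Y where "Y z y = jet ts 0 1 z y / G z y"
definition Yh where "Yh z y = Y z y - Y 0 y"
definition X where "X z y = Ny z y / N z y - 2 * Y z y"
definition Yy where "Yy z y = jet ts 0 2 z y / G z y - (Y z y)\<^sup>2"

lemma dY_z:
  assumes "z \<in> ball 0 r" "y \<in> ball 0 r"
  shows "((\<lambda>z. Y z y) has_field_derivative N z y / (G z y)\<^sup>2) (at z)"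
  unfolding Y_def levi_def
  by (rule DERIV_cong[OF DERIV_divide[OF d1 d1]])
     (use assms nzG in \<open>auto simp: power2_eq_square algebra_simps\<close>)

lemma dY_y:
  assumes "z \<in> ball 0 r" "y \<in> ball 0 r"
  shows "((\<lambda>y. Y z y) has_field_derivative Yy z y) (at y)"
  unfolding Y_def Yy_def
  by (rule DERIV_cong[OF DERIV_divide[OF d2 d2]])
     (use assms nzG[OF assms] in \<open>auto simp: numeral_2_eq_2 divide_simps\<close>)

lemma dX_z:
  assumes z: "z \<in> ball 0 r" and y: "y \<in> ball 0 r"
  shows "((\<lambda>z. X z y) has_field_derivative - of_real \<kappa> * N z y / (G z y)\<^sup>2) (at z)"
proof -
  have "((\<lambda>z. X z y) has_field_derivative
      (levi_zy ts z y * N z y - Ny z y * levi_z ts z y) / (N z y * N z y) - 2 * (N z y / (G z y)\<^sup>2)) (at z)"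
    unfolding X_def
    by (intro DERIV_diff DERIV_divide DERIV_cmult dNy_z dN_z dY_z nzN assms)
  moreover have "(levi_zy ts z y * N z y - Ny z y * levi_z ts z y) / (N z y * N z y)
      = (2 - of_real \<kappa>) * N z y / (G z y)\<^sup>2"
    using curv_polar[OF assms] nzN[OF assms] nzG[OF assms]
    by (simp add: divide_simps power2_eq_square power3_eq_cube algebra_simps)
  ultimately have "((\<lambda>z. X z y) has_field_derivative
      (2 - of_real \<kappa>) * N z y / (G z y)\<^sup>2 - 2 * (N z y / (G z y)\<^sup>2)) (at z)"
    by (simp only:)
  then show ?thesis
    by (rule DERIV_cong) (simp add: left_diff_distrib diff_divide_distrib)
qed

text \<open>First integration in \<open>z\<close>: the equation says that \<open>X + \<kappa> * Y\<close> does not depend on \<open>z\<close>.\<close>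

lemma X_Yh:
  assumes z: "z \<in> ball 0 r" and y: "y \<in> ball 0 r"
  shows "X z y + of_real \<kappa> * Yh z y = X 0 y"
proof -
  have "((\<lambda>z. X z y + of_real \<kappa> * Yh z y) has_field_derivative 0) (at x)" if x: "x \<in> ball 0 r" for x
    unfolding Yh_def
    by (rule DERIV_cong[OF DERIV_add[OF dX_z[OF x y] DERIV_cmult[OF DERIV_diff[OF dY_z[OF x y] DERIV_const]]]])
       (auto simp: algebra_simps)
  from deriv_zero_on_ball[OF this z] show ?thesis by (simp add: Yh_def)
qed

lemma dYy_z:
  assumes z: "z \<in> ball 0 r" and y: "y \<in> ball 0 r"
  shows "((\<lambda>z. Yy z y) has_field_derivative X z y * (N z y / (G z y)\<^sup>2)) (at z)"
proof -
  have "((\<lambda>z. Yy z y) has_field_derivative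
     (jet ts 1 2 z y * G z y - jet ts 0 2 z y * jet ts 1 0 z y) / (G z y * G z y)
       - 2 * (Y z y * (N z y / (G z y)\<^sup>2))) (at z)"
    unfolding Yy_def power2_eq_square[of "Y _ _"]
    by (rule DERIV_cong[OF DERIV_diff[OF DERIV_divide[OF d1 d1] DERIV_mult[OF dY_z dY_z]]])
       (use nzG assms in auto)
  moreover have "(jet ts 1 2 z y * G z y - jet ts 0 2 z y * jet ts 1 0 z y) / (G z y * G z y)
       - 2 * (Y z y * (N z y / (G z y)\<^sup>2)) = X z y * (N z y / (G z y)\<^sup>2)"
    using nzN[OF assms] nzG[OF assms]
    by (simp add: X_def levi_y_def divide_simps power2_eq_square)
  ultimately show ?thesis by simp
qed

text \<open>Second integration in \<open>z\<close>: the difference of the two sides does not depend on \<open>z\<close>, and it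
vanishes at \<open>z = 0\<close>. For fixed \<open>z\<close> this is an ordinary differential equation in \<open>y\<close>.\<close>

lemma riccati:
  assumes z: "z \<in> ball 0 r" and y: "y \<in> ball 0 r"
  shows "((\<lambda>y. Yh z y) has_field_derivative X 0 y * Yh z y - of_real (\<kappa>/2) * (Yh z y)\<^sup>2) (at y)"
proof -
  define R where "R = (\<lambda>z. Yy z y - Yy 0 y + of_real (\<kappa>/2) * (Yh z y * Yh z y) - X 0 y * Yh z y)"
  have "(R has_field_derivative 0) (at x)" if x: "x \<in> ball 0 r" for x
  proof -
    define M where "M = N x y / (G x y)\<^sup>2"
    have Yh: "((\<lambda>z. Yh z y) has_field_derivative M) (at x)"
      unfolding Yh_def M_def using DERIV_diff[OF dY_z[OF x y] DERIV_const] by simp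
    have XY: "X x y = X 0 y - of_real \<kappa> * Yh x y" using X_Yh[OF x y] by (simp add: algebra_simps)
    show ?thesis
      unfolding R_def
      by (rule DERIV_cong[OF DERIV_diff[OF DERIV_add[OF DERIV_diff[OF dYy_z[OF x y, folded M_def] DERIV_const]
              DERIV_cmult[OF DERIV_mult[OF Yh Yh]]] DERIV_cmult[OF Yh]]])
         (simp add: XY algebra_simps)
  qed
  from deriv_zero_on_ball[OF this z] have "R z = 0" by (simp add: R_def Yh_def)
  then have "Yy z y - Yy 0 y = X 0 y * Yh z y - of_real (\<kappa>/2) * (Yh z y)\<^sup>2"
    unfolding R_def power2_eq_square by algebra
  moreover have "((\<lambda>y. Yh z y) has_field_derivative Yy z y - Yy 0 y) (at y)"
    unfolding Yh_def by (intro DERIV_diff dY_y assms) (use rpos in auto)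
  ultimately show ?thesis by simp
qed

text \<open>\<open>bochner\<close> is the coordinate of Bochner and Calabi attached to the potential \<open>log G\<close> at the
origin, up to a constant factor, \<open>bochner_conj\<close> is its conjugate as a function of \<open>y\<close>, and
\<open>dens\<close> is the derivative of the latter.\<close>

definition bochner where "bochner z = jet ts 0 1 z 0 / G z 0 - jet ts 0 1 0 0 / G 0 0"
definition bochner_conj where "bochner_conj y = jet ts 1 0 0 y / G 0 y - jet ts 1 0 0 0 / G 0 0"
definition dens where "dens y = N 0 y / (G 0 y)\<^sup>2"

lemma zero_in: "0 \<in> ball (0::complex) r" using rpos by simp

lemma Yh_0: "Yh z 0 = bochner z" by (simp add: Yh_def bochner_def Y_def)

lemma d_bochner_conj: "y \<in> ball 0 r \<Longrightarrow> (bochner_conj has_field_derivative dens y) (at y)"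
  unfolding bochner_conj_def[abs_def] dens_def levi_def
  by (rule DERIV_cong[OF DERIV_diff[OF DERIV_divide[OF d2 d2] DERIV_const]])
     (use nzG zero_in in \<open>auto simp: power2_eq_square algebra_simps\<close>)

lemma d_bochner: "z \<in> ball 0 r \<Longrightarrow> (bochner has_field_derivative N z 0 / (G z 0)\<^sup>2) (at z)"
  unfolding bochner_def[abs_def] levi_def
  by (rule DERIV_cong[OF DERIV_diff[OF DERIV_divide[OF d1 d1] DERIV_const]])
     (use nzG zero_in in \<open>auto simp: power2_eq_square algebra_simps\<close>)

lemma d_dens:
  assumes "y \<in> ball 0 r" shows "(dens has_field_derivative X 0 y * dens y) (at y)"
proof -
  have nz: "G 0 y \<noteq> 0" "N 0 y \<noteq> 0" using nzG nzN assms zero_in by blast+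
  have "((\<lambda>y. N 0 y / (G 0 y * G 0 y)) has_field_derivative X 0 y * dens y) (at y)"
    by (rule DERIV_cong[OF DERIV_divide[OF dN_y DERIV_mult[OF d2 d2]]])
       (use assms nz in \<open>auto simp: X_def dens_def Y_def divide_simps power2_eq_square\<close>,
        simp add: algebra_simps)
  then show ?thesis by (simp add: dens_def[abs_def] power2_eq_square)
qed

lemma hol_y: "(\<lambda>y. jet ts a b z y) holomorphic_on ball 0 r"
  using d2 holomorphic_on_open[OF open_ball] by blast

text \<open>The solution of the Riccati equation with initial value \<open>bochner z\<close> at \<open>y = 0\<close>. The difference
\<open>\<delta>\<close> of the two sides satisfies a linear homogeneous equation with \<open>\<delta> 0 = 0\<close>.\<close>

lemma normal_form_Yh:
  assumes z: "z \<in> ball 0 r" and y: "y \<in> ball 0 r"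
  shows "Yh z y * (1 + of_real (\<kappa>/2) / dens 0 * bochner z * bochner_conj y) = bochner z * dens y / dens 0"
proof -
  have e0: "dens 0 \<noteq> 0" using nzN nzG zero_in by (simp add: dens_def)
  define I k where "I = inverse (dens 0)" and "k = complex_of_real (\<kappa>/2)"
  define \<delta> where "\<delta> = (\<lambda>y. Yh z y * (1 + k * I * bochner z * bochner_conj y) - bochner z * I * dens y)"
  define p where "p = (\<lambda>y. X 0 y - k * Yh z y)"
  have nz: "G 0 y \<noteq> 0" "N 0 y \<noteq> 0" "G z y \<noteq> 0" if "y \<in> ball 0 r" for y
    using that nzG nzN z zero_in by blast+
  have "p holomorphic_on ball 0 r"
    using nz unfolding p_def X_def Yh_def Y_def levi_def levi_y_def
    by (intro holomorphic_intros hol_y) (auto simp: levi_def)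
  moreover have "(\<delta> has_field_derivative p y * \<delta> y) (at y)" if y: "y \<in> ball 0 r" for y
    unfolding \<delta>_def
    by (rule DERIV_cong[OF DERIV_diff[OF DERIV_mult[OF riccati[OF z y, folded k_def]
           DERIV_add[OF DERIV_const DERIV_cmult[OF d_bochner_conj[OF y]]]] DERIV_cmult[OF d_dens[OF y]]]])
       (simp add: p_def power2_eq_square algebra_simps)
  moreover have "\<delta> 0 = 0" using e0 by (simp add: \<delta>_def Yh_0 bochner_conj_def I_def)
  ultimately have "\<delta> y = 0" by (rule linear_ode_zero[OF _ _ _ y])
  then show ?thesis by (simp add: \<delta>_def I_def k_def inverse_eq_divide)
qed

end

lemma jet_map_scale:
  "jet (map (\<lambda>t u. t (g u) * q (g u)) ts) 0 0 u x =
     q (g u) * cnj (q (g (cnj x))) * jet ts 0 0 (g u) (cnj (g (cnj x)))"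
  by (induction ts) (auto simp: jet00 algebra_simps)

lemma jet_diag_real: "jet ts 0 0 z (cnj z) = of_real (\<Sum>t\<leftarrow>ts. (cmod (t z))\<^sup>2)"
  by (induction ts) (auto simp: jet00 complex_norm_square simp del: of_real_power)

context liouville
begin

text \<open>Multiplying all functions of the list by \<open>q\<close> makes the kernel equal to \<open>1\<close> along \<open>y = 0\<close>, and
\<open>g\<close> is the inverse of the coordinate \<open>v\<close>, the rescaled \<open>bochner\<close>. In this coordinate the solved
Riccati equation is a first-order equation for the kernel itself, whose solution is
\<open>(1 + \<kappa>/2 * u * x)\<close> to the power \<open>2/\<kappa>\<close>, or \<open>exp (u * x)\<close> when \<open>\<kappa> = 0\<close>.\<close>

lemma normal_coordinate:
  assumes e0: "dens 0 = of_real \<epsilon>" and eps: "\<epsilon> > 0"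
  obtains \<rho> v g s q where
    "0 < \<rho>" "\<rho> \<le> r" "v holomorphic_on ball 0 \<rho>" "inj_on v (ball 0 \<rho>)" "v 0 = 0"
    "q holomorphic_on ball 0 \<rho>" "\<And>z. z \<in> ball 0 \<rho> \<Longrightarrow> q z \<noteq> 0"
    "0 < s" "g holomorphic_on ball 0 s" "\<And>u. u \<in> ball 0 s \<Longrightarrow> g u \<in> ball 0 \<rho>"
    "\<And>u. u \<in> ball 0 s \<Longrightarrow> v (g u) = u"
    "\<And>u x. u \<in> ball 0 s \<Longrightarrow> x \<in> ball 0 s \<Longrightarrow>
       \<exists>d. ((\<lambda>x. jet (map (\<lambda>t u. t (g u) * q (g u)) ts) 0 0 u x) has_field_derivative d) (at x) \<and>
           d * (1 + of_real (\<kappa>/2) * u * x) = u * jet (map (\<lambda>t u. t (g u) * q (g u)) ts) 0 0 u x"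
    "\<And>u. u \<in> ball 0 s \<Longrightarrow> jet (map (\<lambda>t u. t (g u) * q (g u)) ts) 0 0 u 0 = 1"
proof -
  define se :: complex where "se = of_real (sqrt \<epsilon>)"
  have se: "se \<noteq> 0" "se * se = dens 0" "cnj se = se"
    using eps by (auto simp: se_def e0 simp flip: of_real_mult)
  define v where "v = (\<lambda>z. bochner z / se)"
  have dv: "(v has_field_derivative N z 0 / (G z 0)\<^sup>2 / se) (at z)" if "z \<in> ball 0 r" for z
    unfolding v_def using DERIV_cdivide[OF d_bochner[OF that]] .
  have hv: "v holomorphic_on ball 0 r"
    using dv holomorphic_on_open[OF open_ball] by blast
  have "deriv v 0 = N 0 0 / (G 0 0)\<^sup>2 / se" using DERIV_imp_deriv[OF dv[OF zero_in]] .
  then have "deriv v 0 \<noteq> 0" using se nzN nzG zero_in by simp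
  from has_complex_derivative_locally_injective[OF hv zero_in open_ball this]
  obtain \<rho> where \<rho>: "\<rho> > 0" "ball 0 \<rho> \<subseteq> ball (0::complex) r" "inj_on v (ball 0 \<rho>)" .
  have \<rho>r: "\<rho> \<le> r" using \<rho>(1,2) by (simp add: ball_subset_ball_iff)
  have hv': "v holomorphic_on ball 0 \<rho>" using hv \<rho>(2) holomorphic_on_subset by blast
  have v0: "v 0 = 0" by (simp add: v_def bochner_def)
  obtain s g \<sigma> where s: "s > 0" and hg: "g holomorphic_on ball 0 s"
    and gin: "\<And>u. u \<in> ball 0 s \<Longrightarrow> g u \<in> ball 0 \<rho>" and vg: "\<And>u. u \<in> ball 0 s \<Longrightarrow> v (g u) = u"
    and \<sigma>: "\<sigma> > 0" "\<sigma> \<le> \<rho>" "\<And>z. z \<in> ball 0 \<sigma> \<Longrightarrow> v z \<in> ball 0 s \<and> g (v z) = z"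
    by (rule local_inverse[OF hv' \<rho>(3) v0 \<rho>(1)], rule that)
  define C :: complex where "C = of_real (sqrt (Re (G 0 0)))"
  have G00: "G 0 0 = of_real (Re (G 0 0))" "Re (G 0 0) \<ge> 0"
    using jet_diag_real[of ts 0] by (auto intro!: sum_list_nonneg)
  have C: "C * C = G 0 0" "cnj C = C" using G00 by (auto simp: C_def simp flip: of_real_mult)
  have Cnz: "C \<noteq> 0" using C(1) nzG[OF zero_in zero_in] by auto
  define q where "q = (\<lambda>z. C / G z 0)"
  have Gz0: "G z 0 \<noteq> 0" if "z \<in> ball 0 r" for z using nzG[OF that zero_in] .
  have G0y: "G 0 y \<noteq> 0" if "y \<in> ball 0 r" for y using nzG[OF zero_in that] .
  have hq: "q holomorphic_on ball 0 r"
    unfolding q_def using Gz0 holomorphic_on_open[OF open_ball] d1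
    by (intro holomorphic_intros) blast+
  define gc where "gc = (\<lambda>x. cnj (g (cnj x)))"
  have gcin: "gc x \<in> ball 0 r" if "x \<in> ball 0 s" for x
    using gin[of "cnj x"] that \<rho>r by (auto simp: gc_def)
  have bwg: "bochner (g u) = se * u" if "u \<in> ball 0 s" for u
    using vg[OF that] se by (simp add: v_def field_simps)
  have bochner_conj_cnj: "bochner_conj y = cnj (bochner (cnj y))" for y
    by (simp add: bochner_def bochner_conj_def jet_cnj)
  have bwcg: "bochner_conj (gc x) = se * x" if "x \<in> ball 0 s" for x
    using bwg[of "cnj x"] that se by (simp add: bochner_conj_cnj gc_def)
  define H where "H = (\<lambda>u x. q (g u) * C * (G (g u) (gc x) / G 0 (gc x)))"
  have H: "jet (map (\<lambda>t u. t (g u) * q (g u)) ts) 0 0 u x = H u x" for u x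
    unfolding jet_map_scale by (simp add: H_def q_def gc_def C jet_cnj)
  have dgc: "\<exists>D. (gc has_field_derivative D) (at x) \<and> dens (gc x) * D = se" if x: "x \<in> ball 0 s" for x
  proof -
    have "cnj x \<in> ball 0 s" using x by simp
    then obtain D where "(g has_field_derivative D) (at (cnj x))"
      using hg holomorphic_on_open[OF open_ball] by blast
    then have D: "(gc has_field_derivative cnj D) (at x)"
      unfolding gc_def by (rule has_field_derivative_conj_conj)
    have "((\<lambda>x. bochner_conj (gc x)) has_field_derivative dens (gc x) * cnj D) (at x)"
      using DERIV_chain2[OF d_bochner_conj[OF gcin[OF x]] D] .
    moreover have "((\<lambda>x. bochner_conj (gc x)) has_field_derivative se) (at x)"
      by (rule has_field_derivative_transform_within_open[where f = "\<lambda>x. se * x", OF _ open_ball x])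
         (auto intro!: derivative_eq_intros simp: bwcg)
    ultimately show ?thesis using D DERIV_unique by blast
  qed
  have ode: "\<exists>d. ((\<lambda>x. H u x) has_field_derivative d) (at x) \<and>
           d * (1 + of_real (\<kappa>/2) * u * x) = u * H u x"
    if u: "u \<in> ball 0 s" and x: "x \<in> ball 0 s" for u x
  proof -
    obtain D where D: "(gc has_field_derivative D) (at x)" "dens (gc x) * D = se"
      using dgc[OF x] by blast
    have gu: "g u \<in> ball 0 r" using gin[OF u] \<rho>r by auto
    have y: "gc x \<in> ball 0 r" by (rule gcin[OF x])
    have L: "((\<lambda>y. G (g u) y / G 0 y) has_field_derivative G (g u) (gc x) / G 0 (gc x) * Yh (g u) (gc x)) (at (gc x))"
      by (rule DERIV_cong[OF DERIV_divide[OF d2[OF y] d2[OF y] G0y[OF y]]])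
         (use G0y[OF y] nzG[OF gu y] in \<open>simp add: Yh_def Y_def divide_simps\<close>)
    have dH: "((\<lambda>x. H u x) has_field_derivative
        q (g u) * C * (G (g u) (gc x) / G 0 (gc x) * Yh (g u) (gc x) * D)) (at x)"
      unfolding H_def by (rule DERIV_cmult[OF DERIV_chain2[OF L D(1)]])
    have "Yh (g u) (gc x) * (1 + of_real (\<kappa>/2) / dens 0 * bochner (g u) * bochner_conj (gc x))
        = bochner (g u) * dens (gc x) / dens 0"
      by (rule normal_form_Yh[OF gu y])
    moreover have "of_real (\<kappa>/2) / dens 0 * bochner (g u) * bochner_conj (gc x) = of_real (\<kappa>/2) * u * x"
      using se(1) by (simp add: bwg[OF u] bwcg[OF x] flip: se(2))
    ultimately have "Yh (g u) (gc x) * (1 + of_real (\<kappa>/2) * u * x) = bochner (g u) * dens (gc x) / dens 0"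
      by (simp only:)
    also have "\<dots> = u * dens (gc x) / se"
      using se(1) by (simp add: bwg[OF u] flip: se(2))
    finally have "Yh (g u) (gc x) * (1 + of_real (\<kappa>/2) * u * x) = u * dens (gc x) / se" .
    then have "Yh (g u) (gc x) * D * (1 + of_real (\<kappa>/2) * u * x) = u * (dens (gc x) * D) / se"
      by (simp add: mult.assoc mult.commute mult.left_commute)
    then have "Yh (g u) (gc x) * D * (1 + of_real (\<kappa>/2) * u * x) = u"
      using D(2) se(1) by simp
    then have "q (g u) * C * (G (g u) (gc x) / G 0 (gc x) * Yh (g u) (gc x) * D) * (1 + of_real (\<kappa>/2) * u * x)
       = u * H u x"
      by (metis H_def mult.assoc mult.commute)
    with dH show ?thesis by blast
  qed
  have g0: "g 0 = 0" using \<sigma>(3)[of 0] \<sigma>(1) v0 by simp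
  have H0: "H u 0 = 1" if "u \<in> ball 0 s" for u
    using Gz0[of "g u"] gin[OF that] \<rho>r Cnz C(1) nzG[OF zero_in zero_in]
    by (simp add: H_def gc_def g0 q_def)
  show ?thesis
  proof (rule that[of \<rho> v q s g])
    show "q holomorphic_on ball 0 \<rho>" using hq \<rho>(2) holomorphic_on_subset by blast
    show "q z \<noteq> 0" if "z \<in> ball 0 \<rho>" for z
      using that Gz0[of z] \<rho>r Cnz by (auto simp: q_def)
  qed (use \<rho> \<rho>r hv' v0 s hg gin vg ode H0 H in auto)
qed

end

text \<open>Bessel's inequality for the coordinate vectors: the squared norms of their projections to
the span of the family sum up to \<open>card I\<close>, and each of them is at most \<open>1\<close>.\<close>

lemma orthogonal_family_card_le:
  fixes x :: "'i \<Rightarrow> 'k \<Rightarrow> complex" and \<beta> :: "'i \<Rightarrow> real"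
  assumes I: "finite I" and J: "finite J"
    and orth: "\<And>i j. i \<in> I \<Longrightarrow> j \<in> I \<Longrightarrow>
       (\<Sum>k\<in>J. x i k * cnj (x j k)) = (if i = j then of_real (\<beta> i) else 0)"
    and pos: "\<And>i. i \<in> I \<Longrightarrow> \<beta> i > 0"
  shows "card I \<le> card J"
proof -
  define S where "S = (\<lambda>k. \<Sum>i\<in>I. (cmod (x i k))\<^sup>2 / \<beta> i)"
  have S1: "S k \<le> 1" if k: "k \<in> J" for k
  proof -
    define y where "y = (\<lambda>l. \<Sum>i\<in>I. cnj (x i k) * x i l / of_real (\<beta> i))"
    have yk: "y k = of_real (S k)"
      by (simp add: y_def S_def complex_norm_square mult.commute del: of_real_power)
    have "(\<Sum>l\<in>J. y l * cnj (y l)) =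
      (\<Sum>l\<in>J. \<Sum>i\<in>I. \<Sum>j\<in>I. cnj (x i k) * x j k / of_real (\<beta> i) / of_real (\<beta> j) * (x i l * cnj (x j l)))"
      unfolding y_def cnj_sum sum_product by (intro sum.cong refl) (simp add: mult_ac)
    also have "\<dots> = (\<Sum>i\<in>I. \<Sum>j\<in>I. cnj (x i k) * x j k / of_real (\<beta> i) / of_real (\<beta> j) *
        (\<Sum>l\<in>J. x i l * cnj (x j l)))"
      by (simp add: sum_distrib_left sum.swap[of _ _ J])
    also have "\<dots> = (\<Sum>i\<in>I. \<Sum>j\<in>I. if i = j then cnj (x i k) * x i k / of_real (\<beta> i) else 0)"
      using pos by (intro sum.cong refl) (auto simp: orth)
    also have "\<dots> = y k" using I by (simp add: y_def)
    finally have "(\<Sum>l\<in>J. y l * cnj (y l)) = of_real (S k)" using yk by simp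
    then have "of_real (\<Sum>l\<in>J. (cmod (y l))\<^sup>2) = complex_of_real (S k)"
      by (simp add: complex_norm_square del: of_real_power)
    then have eq: "(\<Sum>l\<in>J. (cmod (y l))\<^sup>2) = S k" using of_real_eq_iff by blast
    have "(cmod (y k))\<^sup>2 \<le> (\<Sum>l\<in>J. (cmod (y l))\<^sup>2)"
      by (rule member_le_sum[OF k _ J]) auto
    then have "(S k)\<^sup>2 \<le> S k" by (simp add: eq yk)
    then show ?thesis
      by (metis linorder_not_le mult_less_cancel_left_pos mult.right_neutral not_less_iff_gr_or_eq
          less_trans power2_eq_square zero_less_one)
  qed
  have "of_nat (card I) = (\<Sum>i\<in>I. (\<Sum>k\<in>J. (cmod (x i k))\<^sup>2) / \<beta> i)"
  proof -
    have "(\<Sum>k\<in>J. (cmod (x i k))\<^sup>2) = \<beta> i" if "i \<in> I" for i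
    proof -
      have "of_real (\<Sum>k\<in>J. (cmod (x i k))\<^sup>2) = complex_of_real (\<beta> i)"
        using orth[OF that that] by (simp add: complex_norm_square del: of_real_power)
      then show ?thesis using of_real_eq_iff by blast
    qed
    then have "(\<Sum>k\<in>J. (cmod (x i k))\<^sup>2) / \<beta> i = 1" if "i \<in> I" for i using pos that by force
    then have "(\<Sum>i\<in>I. (\<Sum>k\<in>J. (cmod (x i k))\<^sup>2) / \<beta> i) = (\<Sum>i\<in>I. 1)"
      by (intro sum.cong refl)
    then show ?thesis by simp
  qed
  also have "\<dots> = (\<Sum>k\<in>J. S k)"
    unfolding S_def sum_divide_distrib by (rule sum.swap)
  also have "\<dots> \<le> (\<Sum>k\<in>J. 1)" by (intro sum_mono S1)
  finally show ?thesis by simp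
qed

lemma jet_index: "jet ts a b z y = (\<Sum>k<length ts. (deriv ^^ a) (ts ! k) z * cnj ((deriv ^^ b) (ts ! k) (cnj y)))"
  by (simp add: jet_def sum_list_sum_nth atLeast0LessThan)

lemma higher_deriv_power_0:
  "(deriv ^^ i) (\<lambda>u. u ^ j) (0::complex) = (if i = j then fact j else 0)"
proof (cases "i \<le> j")
  case True
  have "(deriv ^^ i) (\<lambda>u. (u - 0) ^ j) (0::complex) = pochhammer (of_nat (Suc j - i)) i * (0 - 0) ^ (j - i)"
    by (rule higher_deriv_power)
  then show ?thesis using True by (auto simp: pochhammer_fact power_0_left)
next
  case False
  have "(deriv ^^ i) (\<lambda>u. (u - 0) ^ j) (0::complex) = pochhammer (of_nat (Suc j - i)) i * (0 - 0) ^ (j - i)"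
    by (rule higher_deriv_power)
  then show ?thesis using False by (simp add: pochhammer_0_left)
qed

text \<open>Differentiating the equation in \<open>x\<close> produces one further linear factor at each step; the product
of these factors will vanish exactly when \<open>1/a\<close> is a positive integer less than \<open>j\<close>.\<close>

lemma ode_jets:
  assumes hol: "\<And>t. t \<in> set ts \<Longrightarrow> t holomorphic_on ball 0 s"
    and ode: "\<And>u x. u \<in> ball 0 s \<Longrightarrow> x \<in> ball 0 s \<Longrightarrow>
       \<exists>d. ((\<lambda>x. jet ts 0 0 u x) has_field_derivative d) (at x) \<and> d * (1 + a * u * x) = u * jet ts 0 0 u x"
    and nz: "\<And>u x. u \<in> ball 0 s \<Longrightarrow> x \<in> ball 0 s \<Longrightarrow> 1 + a * u * x \<noteq> 0"
    and u: "u \<in> ball 0 s" and x: "x \<in> ball 0 s"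
  shows "jet ts 0 j u x = (\<Prod>l<j. 1 - of_nat l * a) * u ^ j * jet ts 0 0 u x / (1 + a * u * x) ^ j"
  using x
proof (induction j arbitrary: x)
  case 0
  then show ?case by simp
next
  case (Suc j)
  let ?H = "jet ts 0 0 u" and ?P = "\<Prod>l<j. 1 - of_nat l * a"
  have nzx: "1 + a * u * x \<noteq> 0" by (rule nz[OF u Suc.prems])
  obtain d where d: "(?H has_field_derivative d) (at x)" "d * (1 + a * u * x) = u * ?H x"
    using ode[OF u Suc.prems] by blast
  have d': "d = u * ?H x / (1 + a * u * x)" using d(2) nzx by (simp add: field_simps)
  have den: "((\<lambda>x. (1 + a * u * x) ^ j) has_field_derivative of_nat j * (1 + a * u * x) ^ (j - 1) * (a * u)) (at x)"
    by (auto intro!: derivative_eq_intros)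
  have pw: "of_nat j * (1 + a * u * x) ^ (j - 1) = of_nat j * (1 + a * u * x) ^ j / (1 + a * u * x)"
    using nzx by (cases j) auto
  have "((\<lambda>x. ?P * u ^ j * (?H x / (1 + a * u * x) ^ j)) has_field_derivative
      ?P * u ^ j * ((d * (1 + a * u * x) ^ j - ?H x * (of_nat j * (1 + a * u * x) ^ (j - 1) * (a * u)))
        / ((1 + a * u * x) ^ j * (1 + a * u * x) ^ j))) (at x)"
    using nzx by (intro DERIV_cmult DERIV_divide d(1) den) auto
  moreover have "((\<lambda>x. ?P * u ^ j * (?H x / (1 + a * u * x) ^ j)) has_field_derivative jet ts 0 (Suc j) u x) (at x)"
    by (rule has_field_derivative_transform_within_open[OF jet_deriv2[OF hol Suc.prems] open_ball Suc.prems])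
       (auto simp: Suc.IH)
  ultimately have "jet ts 0 (Suc j) u x = ?P * u ^ j * ((d * (1 + a * u * x) ^ j - ?H x * (of_nat j * (1 + a * u * x) ^ (j - 1) * (a * u)))
        / ((1 + a * u * x) ^ j * (1 + a * u * x) ^ j))"
    using DERIV_unique by blast
  also have "\<dots> = ?P * u ^ j * (u * ?H x * (1 - of_nat j * a) / (1 + a * u * x) / (1 + a * u * x) ^ j)"
    unfolding d' pw using nzx by (simp add: divide_simps) (simp add: algebra_simps)
  also have "\<dots> = (\<Prod>l<Suc j. 1 - of_nat l * a) * u ^ Suc j * ?H x / (1 + a * u * x) ^ Suc j"
    by simp
  finally show ?case .
qed

text \<open>The vectors of Taylor coefficients of the functions at the origin are mutually orthogonal, and
the squared length of the \<open>j\<close>-th one is a positive multiple of \<open>(1 - a) * (1 - 2 * a) * ...\<close>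
with factors up to \<open>1 - (j - 1) * a\<close>. Only finitely many of them can be nonzero, because they live in a finite-dimensional space. So
one of the factors vanishes, which fixes \<open>a\<close> as the reciprocal of an integer \<open>c\<close>, and
the coefficient vectors beyond \<open>c\<close>, having length zero, are zero: the functions are polynomials.\<close>

lemma finite_rank_quantisation:
  fixes a :: real
  assumes hol: "\<And>t. t \<in> set ts \<Longrightarrow> t holomorphic_on ball 0 s" and s: "s > 0"
    and ode: "\<And>u x. u \<in> ball 0 s \<Longrightarrow> x \<in> ball 0 s \<Longrightarrow>
       \<exists>d. ((\<lambda>x. jet ts 0 0 u x) has_field_derivative d) (at x) \<and>
          d * (1 + of_real a * u * x) = u * jet ts 0 0 u x"
    and nz: "\<And>u x. u \<in> ball 0 s \<Longrightarrow> x \<in> ball 0 s \<Longrightarrow> 1 + of_real a * u * x \<noteq> (0::complex)"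
    and norm: "\<And>u. u \<in> ball 0 s \<Longrightarrow> jet ts 0 0 u 0 = 1"
  obtains c :: nat where "c > 0" "a = 1 / of_nat c"
    "\<And>u x. u \<in> ball 0 s \<Longrightarrow> x \<in> ball 0 s \<Longrightarrow> jet ts 0 0 u x = (1 + of_real a * u * x) ^ c"
    "\<And>t. t \<in> set ts \<Longrightarrow> \<exists>p. \<forall>u\<in>ball 0 s. t u = poly p u"
proof -
  define P where "P = (\<lambda>j. \<Prod>l<j. 1 - of_nat l * a)"
  have s0: "0 \<in> ball (0::complex) s" using s by simp
  have j0: "jet ts 0 j u 0 = of_real (P j) * u ^ j" if "u \<in> ball 0 s" for u j
    using ode_jets[OF hol ode nz that s0] norm[OF that] by (simp add: P_def)
  have hol0: "(\<lambda>u. jet ts 0 j u 0) holomorphic_on ball 0 s" for j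
    using jet_deriv1[OF hol] holomorphic_on_open[OF open_ball] by blast
  have gram: "jet ts i j 0 0 = (if i = j then of_real (P j * fact j) else 0)" for i j
  proof -
    have "jet ts i j 0 0 = (deriv ^^ i) (\<lambda>u. jet ts 0 j u 0) 0"
      by (rule jet_higher_deriv[OF hol s0, symmetric])
    also have "\<dots> = (deriv ^^ i) (\<lambda>u. of_real (P j) * u ^ j) 0"
      by (rule higher_deriv_transform_within_open[OF hol0 _ open_ball s0])
         (use j0 in \<open>auto intro!: holomorphic_intros\<close>)
    also have "\<dots> = of_real (P j) * (deriv ^^ i) (\<lambda>u. u ^ j) 0"
      by (rule higher_deriv_cmult[of _ UNIV]) (auto intro!: holomorphic_intros)
    finally show ?thesis by (simp add: higher_deriv_power_0)
  qed
  have gram': "(\<Sum>k<length ts. (deriv ^^ i) (ts ! k) 0 * cnj ((deriv ^^ j) (ts ! k) 0))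
      = (if i = j then of_real (P i * fact i) else 0)" for i j
    using gram[of i j] by (auto simp: jet_index)
  have nonneg: "P i * fact i \<ge> 0" for i
  proof -
    have "of_real (\<Sum>k<length ts. (cmod ((deriv ^^ i) (ts ! k) 0))\<^sup>2) = complex_of_real (P i * fact i)"
      using gram'[of i i] by (simp add: complex_norm_square del: of_real_power)
    then have "(\<Sum>k<length ts. (cmod ((deriv ^^ i) (ts ! k) 0))\<^sup>2) = P i * fact i"
      using of_real_eq_iff by blast
    then show ?thesis by (metis sum_nonneg zero_le_power2)
  qed
  have "\<exists>i. P i = 0"
  proof (rule ccontr)
    assume "\<not> ?thesis"
    then have "P i * fact i > 0" for i using nonneg[of i] by (auto simp: less_le)
    then have "card {..length ts} \<le> card {..<length ts}"
      by (intro orthogonal_family_card_le[where x = "\<lambda>i k. (deriv ^^ i) (ts ! k) 0" and \<beta> = "\<lambda>i. P i * fact i"])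
         (use gram' in auto)
    then show False by simp
  qed
  then obtain c where "1 - of_nat c * a = 0" by (auto simp: P_def)
  then have c: "c > 0" "a = 1 / of_nat c" by (cases "c = 0"; simp add: field_simps)+
  have Pc: "P j = 0" if "j > c" for j
    unfolding P_def using that c by (intro prod_zero) auto
  have coef0: "(deriv ^^ j) t 0 = 0" if t: "t \<in> set ts" and j: "j > c" for t j
  proof -
    obtain k where k: "k < length ts" "t = ts ! k" using t by (auto simp: in_set_conv_nth)
    have "of_real (\<Sum>k<length ts. (cmod ((deriv ^^ j) (ts ! k) 0))\<^sup>2) = complex_of_real 0"
      using gram'[of j j] Pc[OF j] by (simp add: complex_norm_square del: of_real_power)
    then have "(\<Sum>k<length ts. (cmod ((deriv ^^ j) (ts ! k) 0))\<^sup>2) = 0"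
      using of_real_eq_iff by blast
    then show ?thesis using k by (subst (asm) sum_nonneg_eq_0_iff) auto
  qed
  show ?thesis
  proof (rule that[OF c])
    fix u x :: complex assume u: "u \<in> ball 0 s" and x: "x \<in> ball 0 s"
    define f where "f = (\<lambda>x. jet ts 0 0 u x / (1 + of_real a * u * x) ^ c)"
    have "(f has_field_derivative 0) (at x)" if x: "x \<in> ball 0 s" for x
    proof -
      let ?q = "1 + of_real a * u * x"
      obtain d where d: "((\<lambda>x. jet ts 0 0 u x) has_field_derivative d) (at x)" "d * ?q = u * jet ts 0 0 u x"
        using ode[OF u x] by blast
      have nzx: "?q \<noteq> 0" by (rule nz[OF u x])
      have "(f has_field_derivative (d * ?q ^ c - jet ts 0 0 u x * (of_nat c * ?q ^ (c - 1) * (of_real a * u)))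
          / (?q ^ c * ?q ^ c)) (at x)"
        unfolding f_def using nzx
        by (intro DERIV_divide d(1)) (auto intro!: derivative_eq_intros)
      moreover have "d * ?q ^ c - jet ts 0 0 u x * (of_nat c * ?q ^ (c - 1) * (of_real a * u)) = 0"
      proof -
        have "d * ?q ^ c = (d * ?q) * ?q ^ (c - 1)" using c(1) by (cases c) auto
        moreover have "of_nat c * complex_of_real a = 1" using c by simp
        moreover have "jet ts 0 0 u x * (of_nat c * ?q ^ (c - 1) * (of_real a * u))
            = u * jet ts 0 0 u x * ?q ^ (c - 1) * (of_nat c * of_real a)" by (simp only: mult_ac)
        ultimately show ?thesis unfolding d(2) by simp
      qed
      ultimately show ?thesis by simp
    qed
    from deriv_zero_on_ball[OF this x] have "f x = 1" using norm[OF u] by (simp add: f_def)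
    then show "jet ts 0 0 u x = (1 + of_real a * u * x) ^ c"
      using nz[OF u x] by (simp add: f_def)
  next
    fix t assume t: "t \<in> set ts"
    define p where "p = (\<Sum>n\<le>c. monom ((deriv ^^ n) t 0 / fact n) n)"
    have "t u = poly p u" if u: "u \<in> ball 0 s" for u
    proof -
      have "(\<lambda>n. (deriv ^^ n) t 0 / fact n * (u - 0) ^ n) sums t u"
        by (rule holomorphic_power_series[OF hol[OF t] u])
      moreover have "(\<lambda>n. (deriv ^^ n) t 0 / fact n * (u - 0) ^ n) sums
          (\<Sum>n\<in>{..c}. (deriv ^^ n) t 0 / fact n * (u - 0) ^ n)"
        by (rule sums_finite) (auto simp: coef0[OF t])
      ultimately have "t u = (\<Sum>n\<in>{..c}. (deriv ^^ n) t 0 / fact n * (u - 0) ^ n)"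
        using sums_unique2 by blast
      also have "\<dots> = poly p u" by (simp add: p_def poly_sum poly_monom)
      finally show ?thesis .
    qed
    then show "\<exists>p. \<forall>u\<in>ball 0 s. t u = poly p u" by blast
  qed
qed

section \<open>Factors of a rotationally symmetric kernel\<close>

text \<open>A root of the linear polynomial is a root of \<open>D\<close> or of \<open>E\<close>, so one linear factor after the
other can be cancelled.\<close>

lemma linear_poly_cases:
  fixes D E x :: "complex poly"
  assumes "D * E = x * [:\<beta>, \<alpha>:] ^ c" "\<alpha> \<noteq> 0"
  shows "\<exists>d\<le>c. \<exists>D1. D1 dvd x \<and> D = D1 * [:\<beta>, \<alpha>:] ^ d"
  using assms(1)
proof (induction c arbitrary: D E)
  case 0
  then have "D dvd x" by (metis dvd_triv_left mult.right_neutral power_0)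
  then show ?case by auto
next
  case (Suc c)
  let ?L = "[:\<beta>, \<alpha>:]"
  have L: "?L dvd p \<longleftrightarrow> poly p (- \<beta> / \<alpha>) = 0" for p
  proof -
    have "?L = smult \<alpha> [:- (- \<beta> / \<alpha>), 1:]" using assms(2) by simp
    then show ?thesis using assms(2) by (simp only: smult_dvd_iff poly_eq_0_iff_dvd) simp
  qed
  have nz: "?L \<noteq> 0" using assms(2) by simp
  have "D * E = ?L * (x * ?L ^ c)" using Suc.prems by (simp only: power_Suc mult_ac)
  then have "?L dvd D * E" by (metis dvd_triv_left)
  then consider "?L dvd D" | "?L dvd E" unfolding L poly_mult by auto
  then show ?case
  proof cases
    case 1
    then obtain D' where D': "D = ?L * D'" by (elim dvdE)
    have "?L * (D' * E) = ?L * (x * ?L ^ c)" using Suc.prems by (simp only: D' power_Suc mult_ac)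
    then have "D' * E = x * ?L ^ c" using nz mult_left_cancel by blast
    from Suc.IH[OF this] obtain d D1 where "d \<le> c" "D1 dvd x" "D' = D1 * ?L ^ d" by auto
    then show ?thesis unfolding D' by (intro exI[of _ "Suc d"] conjI exI[of _ D1]) (auto simp only: power_Suc mult_ac Suc_le_mono)
  next
    case 2
    then obtain E' where E': "E = ?L * E'" by (elim dvdE)
    have "?L * (D * E') = ?L * (x * ?L ^ c)" using Suc.prems by (simp only: E' power_Suc mult_ac)
    then have "D * E' = x * ?L ^ c" using nz mult_left_cancel by blast
    from Suc.IH[OF this] show ?thesis using le_Suc_eq by auto
  qed
qed

text \<open>Induction on the degree, splitting off a root of \<open>T\<close>; the normalisation at \<open>0\<close> removes
the freedom of constant factors.\<close>

lemma finite_normed_divisors: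
  fixes T :: "complex poly"
  assumes "T \<noteq> 0"
  shows "finite {D. D dvd T \<and> poly D 0 = 1}"
  using assms
proof (induction "degree T" arbitrary: T)
  case 0
  have "D = 1" if "D dvd T" "poly D 0 = 1" for D
  proof -
    have "degree D = 0" using dvd_imp_degree_le[OF that(1) 0(2)] 0(1) by simp
    then obtain c where "D = [:c:]" by (rule degree_eq_zeroE)
    then show ?thesis using that(2) by (simp add: one_pCons)
  qed
  then have "{D. D dvd T \<and> poly D 0 = 1} \<subseteq> {1}" by auto
  then show ?case using finite_subset by blast
next
  case (Suc n)
  have "coeff T (degree T) \<noteq> 0" "degree T \<in> {1..degree T}" using Suc(2) Suc.prems by auto
  then obtain \<alpha> where "(\<Sum>i\<le>degree T. coeff T i * \<alpha> ^ i) = 0"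
    using fundamental_theorem_of_algebra[of "coeff T" "degree T"] by metis
  then have "poly T \<alpha> = 0" by (simp add: poly_altdef)
  then have "[:- \<alpha>, 1:] dvd T" by (simp only: poly_eq_0_iff_dvd)
  then obtain T' where T': "T = [:- \<alpha>, 1:] * T'" by (elim dvdE)
  have nz: "T' \<noteq> 0" using T' Suc.prems by auto
  have "degree T' = n" using Suc(2) nz unfolding T' by (subst (asm) degree_mult_eq) auto
  then have fin: "finite {D. D dvd T' \<and> poly D 0 = 1}" using Suc(1) nz by blast
  define f where "f = (\<lambda>(E, d). let p = E * [:- \<alpha>, 1:] ^ d in smult (1 / poly p 0) p)"
  have "{D. D dvd T \<and> poly D 0 = 1} \<subseteq> f ` ({D. D dvd T' \<and> poly D 0 = 1} \<times> {..1::nat})"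
  proof safe
    fix D assume D: "D dvd T" "poly D 0 = 1"
    obtain E where "T = D * E" using D(1) by (elim dvdE)
    then have "D * E = T' * [:- \<alpha>, 1:] ^ 1" using T' by (simp only: mult.commute power_one_right)
    from linear_poly_cases[OF this one_neq_zero] obtain d D1 where
      d: "d \<le> 1" "D1 dvd T'" "D = D1 * [:- \<alpha>, 1:] ^ d" by blast
    have D10: "poly D1 0 \<noteq> 0" using D(2) d(3) by auto
    define E1 where "E1 = smult (1 / poly D1 0) D1"
    have "f (E1, d) = smult (1 / poly (smult (1 / poly D1 0) D) 0) (smult (1 / poly D1 0) D)"
      by (simp add: f_def E1_def d(3))
    also have "\<dots> = D" using D(2) D10 by simp
    finally have "D = f (E1, d)" by simp
    moreover have "E1 dvd T'" "poly E1 0 = 1" using d(2) D10 by (auto simp: E1_def smult_dvd_iff)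
    ultimately show "D \<in> f ` ({D. D dvd T' \<and> poly D 0 = 1} \<times> {..1})" using d(1) by blast
  qed
  then show ?case using fin finite_subset by blast
qed

lemma poly_eq_if_infinite:
  fixes p q :: "complex poly"
  assumes "infinite U" "\<And>u. u \<in> U \<Longrightarrow> poly p u = poly q u"
  shows "p = q"
proof (rule ccontr)
  assume "p \<noteq> q"
  then have "finite {u. poly (p - q) u = 0}" by (intro poly_roots_finite) simp
  moreover have "U \<subseteq> {u. poly (p - q) u = 0}" using assms(2) by auto
  ultimately show False using assms(1) finite_subset by blast
qed

abbreviation conj_poly :: "complex poly \<Rightarrow> complex poly" where "conj_poly \<equiv> map_poly cnj"

lemma poly_conj_poly: "poly (conj_poly p) x = cnj (poly p (cnj x))"
  by simp

definition poly_kernel :: "complex poly list \<Rightarrow> complex \<Rightarrow> complex \<Rightarrow> complex" where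
  "poly_kernel ps u x = (\<Sum>p\<leftarrow>ps. poly p u * cnj (poly p (cnj x)))"

lemma poly_kernel_poly2: "\<exists>A. \<forall>x. poly A x = poly_kernel ps u x"
  by (rule exI[of _ "\<Sum>p\<leftarrow>ps. smult (poly p u) (conj_poly p)"], induction ps)
     (auto simp: poly_kernel_def poly_conj_poly)

lemma poly_kernel_poly1: "\<exists>A. \<forall>u. poly A u = poly_kernel ps u x"
  by (rule exI[of _ "\<Sum>p\<leftarrow>ps. smult (cnj (poly p (cnj x))) p"], induction ps)
     (auto simp: poly_kernel_def)

lemma poly_kernel_cnj: "cnj (poly_kernel ps u x) = poly_kernel ps (cnj x) (cnj u)"
  by (induction ps) (auto simp: poly_kernel_def mult.commute)

lemma infinite_ball_minus: "r > 0 \<Longrightarrow> infinite (ball (0::complex) r - {0})"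
proof
  assume r: "r > 0" and "finite (ball (0::complex) r - {0})"
  then have "ball (0::complex) r - {0} = {}" by (intro finite_imp_not_open) auto
  moreover have "of_real (r/2) \<in> ball (0::complex) r - {0}" using r by simp
  ultimately show False by blast
qed

text \<open>For fixed \<open>u\<close> the first factor is, as a polynomial in \<open>x\<close>, a divisor of the right-hand side,
hence a multiple of \<open>S x * (1 + a * u * x) ^ d\<close> with one of finitely many \<open>S\<close> and \<open>d\<close>. By the
pigeonhole principle the same \<open>S\<close> and \<open>d\<close> serve infinitely many \<open>u\<close>, and then all \<open>u\<close>, since
both sides are polynomials in \<open>u\<close> as well. The remaining factor, a function of \<open>u\<close> alone, is
found by Hermitian symmetry.\<close>

lemma kernel_factor:
  fixes t :: "complex poly" and a :: complex
  assumes s: "s > 0" and a: "a \<noteq> 0" and t0: "poly t 0 \<noteq> 0"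
    and eq: "\<And>u x. u \<in> ball 0 s \<Longrightarrow> x \<in> ball 0 s \<Longrightarrow>
      poly_kernel ps u x * poly_kernel rs u x = poly t u * cnj (poly t (cnj x)) * (1 + a * u * x) ^ c"
  obtains S :: "complex poly" and d where "poly S 0 = 1"
    "\<And>u x. poly_kernel ps u x = poly_kernel ps 0 0 * poly S u * cnj (poly S (cnj x)) * (1 + a * u * x) ^ d"
proof -
  have "isCont (poly t) 0" by simp
  then have "eventually (\<lambda>u. poly t u \<noteq> 0) (nhds 0)"
    using t0 by (auto simp: isCont_def eventually_nhds_conv_at intro: tendsto_imp_eventually_ne)
  then obtain s1 where s1: "s1 > 0" "\<And>u. u \<in> ball 0 s1 \<Longrightarrow> poly t u \<noteq> 0"
    by (auto simp: eventually_nhds_metric dist_commute)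
  define U where "U = ball (0::complex) (min s s1) - {0}"
  have infU: "infinite U" unfolding U_def using s s1 by (intro infinite_ball_minus) simp
  obtain A where A: "\<And>u x. poly (A u) x = poly_kernel ps u x" using poly_kernel_poly2[of ps] by metis
  obtain B where B: "\<And>u x. poly (B u) x = poly_kernel rs u x" using poly_kernel_poly2[of rs] by metis
  define F where "F = {D. D dvd conj_poly t \<and> poly D 0 = 1}"
  have "conj_poly t \<noteq> 0" using t0 by (metis complex_cnj_zero poly_0 poly_conj_poly complex_cnj_cnj)
  then have finF: "finite F" unfolding F_def by (rule finite_normed_divisors)
  have ex: "\<exists>Sd\<in>F \<times> {..c}. A u = smult (poly (A u) 0) (fst Sd * [:1, a * u:] ^ snd Sd)"
    if u: "u \<in> U" for u
  proof -
    have u': "u \<noteq> 0" "u \<in> ball 0 s" "poly t u \<noteq> 0" using u s1 by (auto simp: U_def)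
    have "A u * B u = smult (poly t u) (conj_poly t * [:1, a * u:] ^ c)"
    proof (rule poly_eq_if_infinite)
      show "infinite (ball (0::complex) s - {0})" using s by (rule infinite_ball_minus)
      show "poly (A u * B u) x = poly (smult (poly t u) (conj_poly t * [:1, a * u:] ^ c)) x"
        if "x \<in> ball 0 s - {0}" for x
        using eq[of u x] u' that by (simp add: A B poly_conj_poly mult_ac)
    qed
    then have "smult (1 / poly t u) (A u * B u) = conj_poly t * [:1, a * u:] ^ c"
      using u'(3) by simp
    then have "A u * smult (1 / poly t u) (B u) = conj_poly t * [:1, a * u:] ^ c" by simp
    from linear_poly_cases[OF this] a u' obtain d D where
      d: "d \<le> c" "D dvd conj_poly t" "A u = D * [:1, a * u:] ^ d" by auto
    obtain E where "conj_poly t = D * E" using d(2) by (elim dvdE)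
    then have "poly (conj_poly t) 0 = poly D 0 * poly E 0" by simp
    then have D0: "poly D 0 \<noteq> 0" using t0 by (auto simp: poly_conj_poly)
    have "poly (A u) 0 = poly D 0" by (simp add: d(3))
    then have "A u = smult (poly (A u) 0) (smult (1 / poly D 0) D * [:1, a * u:] ^ d)"
      using D0 d(3) by simp
    moreover have "smult (1 / poly D 0) D \<in> F" using D0 d(2) by (auto simp: F_def smult_dvd_iff)
    ultimately show ?thesis using d(1) by (intro bexI[of _ "(smult (1 / poly D 0) D, d)"]) auto
  qed
  then obtain h where h: "\<And>u. u \<in> U \<Longrightarrow> h u \<in> F \<times> {..c}"
    "\<And>u. u \<in> U \<Longrightarrow> A u = smult (poly (A u) 0) (fst (h u) * [:1, a * u:] ^ snd (h u))"
    by metis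
  have "h ` U \<subseteq> F \<times> {..c}" using h(1) by blast
  then have "finite (h ` U)" by (rule finite_subset) (use finF in auto)
  from pigeonhole_infinite[OF infU this] obtain u0 where
    u0: "u0 \<in> U" "infinite {u \<in> U. h u = h u0}" by blast
  obtain S d where Sd: "h u0 = (S, d)" by fastforce
  have S0: "poly S 0 = 1" using h(1)[OF u0(1)] Sd by (simp add: F_def)
  have main: "poly_kernel ps u x = poly_kernel ps u 0 * poly S x * (1 + a * u * x) ^ d" for u x
  proof -
    obtain P where P: "\<And>u. poly P u = poly_kernel ps u x" using poly_kernel_poly1[of ps x] by metis
    obtain P0 where P0: "\<And>u. poly P0 u = poly_kernel ps u 0" using poly_kernel_poly1[of ps 0] by metis
    have "P = P0 * [:poly S x:] * [:1, a * x:] ^ d"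
    proof (rule poly_eq_if_infinite[OF u0(2)])
      fix u assume "u \<in> {u \<in> U. h u = h u0}"
      then have "A u = smult (poly (A u) 0) (S * [:1, a * u:] ^ d)" using h(2)[of u] Sd by auto
      then have "poly (A u) x = poly (smult (poly (A u) 0) (S * [:1, a * u:] ^ d)) x" by simp
      then show "poly P u = poly (P0 * [:poly S x:] * [:1, a * x:] ^ d) u"
        by (simp add: A P P0 mult_ac)
    qed
    then have "poly P u = poly (P0 * [:poly S x:] * [:1, a * x:] ^ d) u" by simp
    then show ?thesis by (simp add: P P0 mult_ac)
  qed
  have m0: "poly_kernel ps 0 x = poly_kernel ps 0 0 * poly S x" for x using main[of 0 x] by simp
  have real: "cnj (poly_kernel ps 0 0) = poly_kernel ps 0 0" by (simp add: poly_kernel_cnj)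
  have "poly_kernel ps u 0 = poly_kernel ps 0 0 * cnj (poly S (cnj u))" for u
  proof -
    have "poly_kernel ps u 0 = cnj (poly_kernel ps 0 (cnj u))" by (simp add: poly_kernel_cnj)
    also have "\<dots> = cnj (poly_kernel ps 0 0 * poly S (cnj u))" by (simp only: m0[of "cnj u"])
    finally show ?thesis by (simp only: complex_cnj_mult real)
  qed
  with main have main2: "poly_kernel ps u x = poly_kernel ps 0 0 * poly (conj_poly S) u * cnj (poly (conj_poly S) (cnj x)) * (1 + a * u * x) ^ d" for u x
    by (metis complex_cnj_cnj poly_conj_poly)
  show ?thesis by (rule that[of "conj_poly S" d]) (use S0 in simp, rule main2)
qed

text \<open>If the product of two sums of squared moduli is the potential of a metric of constant curvature,
then the first of them has the same form as the product. The product of the norms is that of the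
tensor product \<open>ts\<close>, whose components are polynomials in the coordinate \<open>v\<close> after multiplication by a common factor.
A column and a row of this matrix of polynomials are proportional to the vectors \<open>ms\<close> and
\<open>rs\<close>, which turns the question into one about polynomials.\<close>

theorem constant_curvature_factor:
  assumes r: "r > 0"
    and hm: "\<And>m. m \<in> set ms \<Longrightarrow> m holomorphic_on ball 0 r"
    and hr: "\<And>t. t \<in> set rs \<Longrightarrow> t holomorphic_on ball 0 r"
    and m0: "m0 \<in> set ms" "m0 0 \<noteq> 0" and r0: "r0 \<in> set rs" "r0 0 \<noteq> 0"
    and pos: "Re (levi (products ms rs) 0 0) > 0"
    and curv: "\<And>z y. z \<in> ball 0 r \<Longrightarrow> y = cnj z \<Longrightarrow>
      (levi (products ms rs) z y * levi_zy (products ms rs) z y - levi_z (products ms rs) z y * levi_y (products ms rs) z y)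
         * (jet (products ms rs) 0 0 z y)\<^sup>2 = (2 - of_real \<kappa>) * levi (products ms rs) z y ^ 3"
  obtains \<rho> v q d where "0 < \<rho>" "\<rho> \<le> r" "v holomorphic_on ball 0 \<rho>" "inj_on v (ball 0 \<rho>)" "v 0 = 0"
    "q holomorphic_on ball 0 \<rho>" "\<And>z. z \<in> ball 0 \<rho> \<Longrightarrow> q z \<noteq> 0"
    "\<And>z x. z \<in> ball 0 \<rho> \<Longrightarrow> x \<in> ball 0 \<rho> \<Longrightarrow>
       (\<Sum>m\<leftarrow>ms. m z * cnj (m x)) = q z * cnj (q x) * (1 + v z * cnj (v x)) ^ d"
proof -
  define ts where "ts = products ms rs"
  have ht: "t holomorphic_on ball 0 r" if "t \<in> set ts" for t
    using that hm hr by (auto simp: ts_def set_products intro!: holomorphic_intros)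
  have posker: "jet ks 0 0 0 0 \<noteq> 0" if k: "k \<in> set ks" "k 0 \<noteq> 0" for k ks
  proof -
    have "(cmod (k 0))\<^sup>2 \<le> (\<Sum>t\<leftarrow>ks. (cmod (t 0))\<^sup>2)"
      using k(1) by (intro member_le_sum_list) auto
    then have "(\<Sum>t\<leftarrow>ks. (cmod (t 0))\<^sup>2) \<noteq> 0" using k(2) by auto
    then show ?thesis using jet_diag_real[of ks 0] by (metis complex_cnj_zero of_real_eq_0_iff)
  qed
  have G0: "jet ts 0 0 0 0 \<noteq> 0" using posker[OF m0] posker[OF r0] by (simp add: ts_def jet_products00)
  have N0: "levi ts 0 0 = of_real (Re (levi ts 0 0))"
  proof -
    have "cnj (levi ts 0 0) = levi ts 0 0" by (simp add: levi_def jet_cnj)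
    then show ?thesis by (simp add: complex_eq_iff)
  qed
  have N0': "levi ts 0 0 \<noteq> 0" using pos by (auto simp: ts_def)
  obtain r1 where r1: "0 < r1" "r1 \<le> r" "\<And>z y. z \<in> ball 0 r1 \<Longrightarrow> y \<in> ball 0 r1 \<Longrightarrow> jet ts 0 0 z y \<noteq> 0"
    using sesqui_nonzero_nbhd[OF sesqui_jet[OF ht] r G0] by metis
  have hl: "sesqui r (levi ts)"
    unfolding levi_def[abs_def] by (intro sesqui_diff sesqui.mult sesqui_jet[OF ht])
  obtain r2 where r2: "0 < r2" "r2 \<le> r" "\<And>z y. z \<in> ball 0 r2 \<Longrightarrow> y \<in> ball 0 r2 \<Longrightarrow> levi ts z y \<noteq> 0"
    using sesqui_nonzero_nbhd[OF hl r N0'] by metis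
  define r3 where "r3 = min r1 r2"
  have r3: "0 < r3" "ball (0::complex) r3 \<subseteq> ball 0 r1" "ball (0::complex) r3 \<subseteq> ball 0 r2" "r3 \<le> r"
      "ball (0::complex) r3 \<subseteq> ball 0 r"
    using r1 r2 by (auto simp: r3_def)
  interpret liouville r3 ts \<kappa>
  proof
    show "t holomorphic_on ball 0 r3" if "t \<in> set ts" for t
      using ht[OF that] r3(5) holomorphic_on_subset by blast
    show "jet ts 0 0 z y \<noteq> 0" if "z \<in> ball 0 r3" "y \<in> ball 0 r3" for z y
      using r1(3) r3(2) that by blast
    show "levi ts z y \<noteq> 0" if "z \<in> ball 0 r3" "y \<in> ball 0 r3" for z y
      using r2(3) r3(3) that by blast
    show "(levi ts z y * levi_zy ts z y - levi_z ts z y * levi_y ts z y) * (jet ts 0 0 z y)\<^sup>2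
        = (2 - of_real \<kappa>) * levi ts z y ^ 3" if "z \<in> ball 0 r3" "y = cnj z" for z y
      unfolding ts_def by (rule curv) (use r3(5) that in blast)+
  qed (rule r3(1))
  define \<epsilon> where "\<epsilon> = Re (levi ts 0 0) / (\<Sum>t\<leftarrow>ts. (cmod (t 0))\<^sup>2)\<^sup>2"
  have jr: "jet ts 0 0 0 0 = of_real (\<Sum>t\<leftarrow>ts. (cmod (t 0))\<^sup>2)"
    using jet_diag_real[of ts 0] by simp
  have e0: "dens 0 = of_real \<epsilon>"
    unfolding dens_def \<epsilon>_def jr by (subst N0) simp
  have eps: "\<epsilon> > 0"
    using pos G0 unfolding \<epsilon>_def jr by (simp add: ts_def)
  obtain \<rho> v g s q where
    \<rho>: "0 < \<rho>" "\<rho> \<le> r3" and v: "v holomorphic_on ball 0 \<rho>" "inj_on v (ball 0 \<rho>)" "v 0 = 0"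
    and q: "q holomorphic_on ball 0 \<rho>" "\<And>z. z \<in> ball 0 \<rho> \<Longrightarrow> q z \<noteq> 0"
    and s: "0 < s" and g: "g holomorphic_on ball 0 s" "\<And>u. u \<in> ball 0 s \<Longrightarrow> g u \<in> ball 0 \<rho>"
       "\<And>u. u \<in> ball 0 s \<Longrightarrow> v (g u) = u"
    and ode: "\<And>u x. u \<in> ball 0 s \<Longrightarrow> x \<in> ball 0 s \<Longrightarrow>
       \<exists>d. ((\<lambda>x. jet (map (\<lambda>t u. t (g u) * q (g u)) ts) 0 0 u x) has_field_derivative d) (at x) \<and>
           d * (1 + of_real (\<kappa>/2) * u * x) = u * jet (map (\<lambda>t u. t (g u) * q (g u)) ts) 0 0 u x"
    and norm: "\<And>u. u \<in> ball 0 s \<Longrightarrow> jet (map (\<lambda>t u. t (g u) * q (g u)) ts) 0 0 u 0 = 1"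
    by (rule normal_coordinate[OF e0 eps], rule that)
  define hs where "hs = map (\<lambda>t u. t (g u) * q (g u)) ts"
  define a where "a = \<kappa>/2"
  \<comment> \<open>small enough for \<open>1 + a * u * x\<close> not to vanish; the sign of \<open>a\<close> is not yet known\<close>
  define s2 where "s2 = min s (1 / (1 + \<bar>a\<bar>))"
  have s2: "0 < s2" "ball (0::complex) s2 \<subseteq> ball 0 s" using s by (auto simp: s2_def)
  have nz: "1 + of_real a * u * x \<noteq> (0::complex)" if "u \<in> ball 0 s2" "x \<in> ball 0 s2" for u x
  proof -
    have u: "cmod u < 1 / (1 + \<bar>a\<bar>)" "cmod x < 1 / (1 + \<bar>a\<bar>)" using that by (auto simp: s2_def)
    have "1 / (1 + \<bar>a\<bar>) \<le> 1" by simp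
    then have x1: "cmod x \<le> 1" using u by linarith
    have "\<bar>a\<bar> * cmod u * cmod x \<le> \<bar>a\<bar> * (1 / (1 + \<bar>a\<bar>)) * 1"
      using u x1 by (intro mult_mono mult_left_mono) auto
    also have "\<dots> < 1" by simp
    finally have "cmod (of_real a * u * x) < 1" by (simp add: norm_mult)
    moreover have "cmod (of_real a * u * x) = 1" if "1 + of_real a * u * x = 0"
    proof -
      have "of_real a * u * x = -1" using that by algebra
      then show ?thesis by simp
    qed
    ultimately show ?thesis by auto
  qed
  have hh: "h holomorphic_on ball 0 s2" if "h \<in> set hs" for h
  proof -
    obtain t where t: "t \<in> set ts" "h = (\<lambda>u. t (g u) * q (g u))" using \<open>h \<in> set hs\<close> by (auto simp: hs_def)
    have gs: "g holomorphic_on ball 0 s2" using g(1) s2(2) holomorphic_on_subset by blast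
    have "g ` ball 0 s2 \<subseteq> ball 0 \<rho>" using g(2) s2(2) by blast
    moreover have "t holomorphic_on ball 0 \<rho>"
      using hol[OF t(1)] \<rho>(2) holomorphic_on_subset subset_ball by blast
    ultimately show ?thesis
      using holomorphic_on_compose_gen[OF gs, of t "ball 0 \<rho>"] holomorphic_on_compose_gen[OF gs q(1)]
      unfolding t(2) o_def by (intro holomorphic_on_mult) auto
  qed
  have ode2: "\<exists>d. ((\<lambda>x. jet hs 0 0 u x) has_field_derivative d) (at x) \<and>
           d * (1 + of_real a * u * x) = u * jet hs 0 0 u x"
    if "u \<in> ball 0 s2" "x \<in> ball 0 s2" for u x
    unfolding hs_def a_def by (rule ode) (use that s2(2) in blast)+
  have norm2: "jet hs 0 0 u 0 = 1" if "u \<in> ball 0 s2" for u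
    unfolding hs_def by (rule norm) (use that s2(2) in blast)
  obtain c where c: "c > 0" "a = 1 / of_nat c"
    "\<And>u x. u \<in> ball 0 s2 \<Longrightarrow> x \<in> ball 0 s2 \<Longrightarrow> jet hs 0 0 u x = (1 + of_real a * u * x) ^ c"
    "\<And>t. t \<in> set hs \<Longrightarrow> \<exists>p. \<forall>u\<in>ball 0 s2. t u = poly p u"
    using finite_rank_quantisation[OF hh s2(1) ode2 nz norm2] by metis
  \<comment> \<open>the components of the tensor product are polynomials in the new coordinate\<close>
  have "\<exists>p. \<forall>u\<in>ball 0 s2. m (g u) * t (g u) * q (g u) = poly p u" if "m \<in> set ms" "t \<in> set rs" for m t
    by (rule c(4)) (use that in \<open>auto simp: hs_def ts_def set_products intro!: image_eqI[where x = "\<lambda>z. m z * t z"]\<close>)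
  then obtain P where P: "\<And>m t u. m \<in> set ms \<Longrightarrow> t \<in> set rs \<Longrightarrow> u \<in> ball 0 s2 \<Longrightarrow>
      m (g u) * t (g u) * q (g u) = poly (P m t) u"
    by metis
  define gc where "gc = (\<lambda>x. cnj (g (cnj x)))"
  have pk1: "poly_kernel (map (\<lambda>m. P m r0) ms) u x =
     r0 (g u) * q (g u) * cnj (r0 (g (cnj x)) * q (g (cnj x))) * jet ms 0 0 (g u) (gc x)"
    if u: "u \<in> ball 0 s2" and x: "x \<in> ball 0 s2" for u x
  proof -
    have "poly_kernel (map (\<lambda>m. P m r0) ms) u x =
      (\<Sum>m\<leftarrow>ms. m (g u) * r0 (g u) * q (g u) * cnj (m (g (cnj x)) * r0 (g (cnj x)) * q (g (cnj x))))"
      unfolding poly_kernel_def map_map o_def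
      by (intro arg_cong[where f = sum_list] map_cong refl) (use P r0 u x in auto)
    also have "\<dots> = jet (map (\<lambda>t u. t (g u) * (\<lambda>z. r0 z * q z) (g u)) ms) 0 0 u x"
      by (simp add: jet00 o_def mult_ac)
    also have "\<dots> = r0 (g u) * q (g u) * cnj (r0 (g (cnj x)) * q (g (cnj x))) * jet ms 0 0 (g u) (gc x)"
      unfolding gc_def by (rule jet_map_scale)
    finally show ?thesis .
  qed
  have pk2: "poly_kernel (map (\<lambda>t. P m0 t) rs) u x =
     m0 (g u) * q (g u) * cnj (m0 (g (cnj x)) * q (g (cnj x))) * jet rs 0 0 (g u) (gc x)"
    if u: "u \<in> ball 0 s2" and x: "x \<in> ball 0 s2" for u x
  proof -
    have "poly_kernel (map (\<lambda>t. P m0 t) rs) u x =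
      (\<Sum>m\<leftarrow>rs. m0 (g u) * m (g u) * q (g u) * cnj (m0 (g (cnj x)) * m (g (cnj x)) * q (g (cnj x))))"
      unfolding poly_kernel_def map_map o_def
      by (intro arg_cong[where f = sum_list] map_cong refl) (use P m0 u x in auto)
    also have "\<dots> = jet (map (\<lambda>t u. t (g u) * (\<lambda>z. m0 z * q z) (g u)) rs) 0 0 u x"
      by (simp add: jet00 o_def mult_ac)
    also have "\<dots> = m0 (g u) * q (g u) * cnj (m0 (g (cnj x)) * q (g (cnj x))) * jet rs 0 0 (g u) (gc x)"
      unfolding gc_def by (rule jet_map_scale)
    finally show ?thesis .
  qed
  have eq: "poly_kernel (map (\<lambda>m. P m r0) ms) u x * poly_kernel (map (\<lambda>t. P m0 t) rs) u x =
      poly (P m0 r0) u * cnj (poly (P m0 r0) (cnj x)) * (1 + of_real a * u * x) ^ c"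
    if u: "u \<in> ball 0 s2" and x: "x \<in> ball 0 s2" for u x
  proof -
    have cx: "cnj x \<in> ball 0 s2" using x by simp
    have "(1 + of_real a * u * x) ^ c = q (g u) * cnj (q (g (cnj x))) * (jet ms 0 0 (g u) (gc x) * jet rs 0 0 (g u) (gc x))"
      unfolding c(3)[OF u x, symmetric] hs_def jet_map_scale ts_def jet_products00 gc_def by simp
    then show ?thesis
      unfolding pk1[OF u x] pk2[OF u x] P[OF m0(1) r0(1) u, symmetric] P[OF m0(1) r0(1) cx, symmetric]
      by (simp add: mult_ac)
  qed
  have s20: "0 \<in> ball (0::complex) s2" using s2 by simp
  have g0: "g 0 = 0"
  proof -
    have "v (g 0) = v 0" "g 0 \<in> ball 0 \<rho>" using g(2,3)[of 0] s v(3) by auto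
    then show ?thesis using inj_onD[OF v(2)] \<rho>(1) by auto
  qed
  have q0: "q 0 \<noteq> 0" using q(2) \<rho>(1) by simp
  have T0: "poly (P m0 r0) 0 \<noteq> 0"
    using P[OF m0(1) r0(1) s20] m0 r0 q0 unfolding g0 by (metis mult_eq_0_iff)
  have ane: "complex_of_real a \<noteq> 0" using c(1,2) by simp
  obtain S d where S0: "poly S 0 = 1" and
    S: "\<And>u x. poly_kernel (map (\<lambda>m. P m r0) ms) u x =
      poly_kernel (map (\<lambda>m. P m r0) ms) 0 0 * poly S u * cnj (poly S (cnj x)) * (1 + of_real a * u * x) ^ d"
    using kernel_factor[OF s2(1) ane T0 eq] by metis
  define \<alpha> where "\<alpha> = poly_kernel (map (\<lambda>m. P m r0) ms) 0 0"
  define \<alpha>r where "\<alpha>r = (cmod (r0 0 * q 0))\<^sup>2 * (\<Sum>t\<leftarrow>ms. (cmod (t 0))\<^sup>2)"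
  have "\<alpha> = of_real ((cmod (r0 0 * q 0))\<^sup>2) * jet ms 0 0 0 0"
    unfolding \<alpha>_def pk1[OF s20 s20] complex_norm_square by (simp add: g0 gc_def)
  also have "jet ms 0 0 0 0 = of_real (\<Sum>t\<leftarrow>ms. (cmod (t 0))\<^sup>2)" using jet_diag_real[of ms 0] by simp
  finally have \<alpha>: "\<alpha> = of_real \<alpha>r" unfolding \<alpha>r_def by simp
  have "\<alpha>r \<ge> 0" unfolding \<alpha>r_def by (intro mult_nonneg_nonneg sum_list_nonneg) auto
  then have sq\<alpha>: "of_real (sqrt \<alpha>r) * complex_of_real (sqrt \<alpha>r) = \<alpha>"
    unfolding \<alpha> by (simp flip: of_real_mult)
  have \<alpha>nz: "\<alpha> \<noteq> 0"
    unfolding \<alpha>_def pk1[OF s20 s20] using posker[OF m0] r0 q0 by (simp add: g0 gc_def)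
  have sqa: "of_real (sqrt a) * complex_of_real (sqrt a) = of_real a"
    using c(1,2) by (simp flip: of_real_mult)
  have hr0: "r0 holomorphic_on ball 0 \<rho>"
    using hr[OF r0(1)] r3(4) \<rho>(2) holomorphic_on_subset subset_ball order_trans by metis
  have "eventually (\<lambda>z. z \<in> ball 0 \<rho> \<and> v z \<in> ball 0 s2 \<and> poly S (v z) \<noteq> 0 \<and> r0 z \<noteq> 0) (nhds 0)"
  proof (intro eventually_conj)
    show "eventually (\<lambda>z. z \<in> ball (0::complex) \<rho>) (nhds 0)"
      using \<rho>(1) by (intro eventually_nhds_in_open) auto
    have vc: "isCont v 0" by (rule holomorphic_ball_isCont[OF v(1) \<rho>(1)])
    show "eventually (\<lambda>z. v z \<in> ball 0 s2) (nhds 0)"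
      by (rule isCont_eventually_open[OF vc]) (use v(3) s2(1) in auto)
    have "isCont (\<lambda>z. poly S (v z)) 0" using vc by (intro continuous_intros)
    then show "eventually (\<lambda>z. poly S (v z) \<noteq> 0) (nhds 0)"
      by (rule isCont_eventually_nonzero) (simp add: v(3) S0)
    show "eventually (\<lambda>z. r0 z \<noteq> 0) (nhds 0)"
      by (rule isCont_eventually_nonzero[OF holomorphic_ball_isCont[OF hr0 \<rho>(1)] r0(2)])
  qed
  then obtain \<sigma> where \<sigma>: "\<sigma> > 0" "\<And>z. z \<in> ball 0 \<sigma> \<Longrightarrow> z \<in> ball 0 \<rho> \<and> v z \<in> ball 0 s2 \<and> poly S (v z) \<noteq> 0 \<and> r0 z \<noteq> 0"
    unfolding eventually_nhds_metric by (auto simp: dist_commute)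
  have \<sigma>\<rho>: "ball (0::complex) \<sigma> \<subseteq> ball 0 \<rho>" using \<sigma>(2) by blast
  then have "\<sigma> \<le> \<rho>" using \<sigma>(1) by (simp add: ball_subset_ball_iff)
  show ?thesis
  proof (rule that[of \<sigma> "\<lambda>z. of_real (sqrt a) * v z" "\<lambda>z. of_real (sqrt \<alpha>r) * poly S (v z) / (r0 z * q z)" d])
    show "0 < \<sigma>" by fact
    show "\<sigma> \<le> r" using \<open>\<sigma> \<le> \<rho>\<close> \<rho>(2) r3(4) by linarith
    have hv: "v holomorphic_on ball 0 \<sigma>" using v(1) \<sigma>\<rho> holomorphic_on_subset by blast
    show "(\<lambda>z. of_real (sqrt a) * v z) holomorphic_on ball 0 \<sigma>"
      using hv by (intro holomorphic_intros)
    show "inj_on (\<lambda>z. of_real (sqrt a) * v z) (ball 0 \<sigma>)"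
      using inj_on_subset[OF v(2) \<sigma>\<rho>] c(1,2) by (auto simp: inj_on_def)
    show "of_real (sqrt a) * v 0 = 0" using v(3) by simp
    have qz: "q z \<noteq> 0" "r0 z \<noteq> 0" if "z \<in> ball 0 \<sigma>" for z using \<sigma>(2)[OF that] q(2) by auto
    show "(\<lambda>z. of_real (sqrt \<alpha>r) * poly S (v z) / (r0 z * q z)) holomorphic_on ball 0 \<sigma>"
      using hv holomorphic_on_subset[OF q(1) \<sigma>\<rho>] holomorphic_on_subset[OF hr0 \<sigma>\<rho>] qz
      by (intro holomorphic_intros) auto
    show "of_real (sqrt \<alpha>r) * poly S (v z) / (r0 z * q z) \<noteq> 0" if "z \<in> ball 0 \<sigma>" for z
      using qz[OF that] \<sigma>(2)[OF that] \<alpha>nz \<alpha> by auto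
    fix z x :: complex assume z: "z \<in> ball 0 \<sigma>" and x: "x \<in> ball 0 \<sigma>"
    have gv: "g (v z) = z" if "z \<in> ball 0 \<sigma>" for z
    proof -
      have "v z \<in> ball 0 s" using \<sigma>(2)[OF that] s2(2) by blast
      then have "v (g (v z)) = v z" "g (v z) \<in> ball 0 \<rho>" using g(2,3) by blast+
      then show ?thesis using inj_onD[OF v(2)] \<sigma>(2)[OF that] by blast
    qed
    define u w where "u = v z" and "w = cnj (v x)"
    have u: "u \<in> ball 0 s2" and w: "w \<in> ball 0 s2" using \<sigma>(2)[OF z] \<sigma>(2)[OF x] by (auto simp: u_def w_def)
    have "r0 z * q z * cnj (r0 x * q x) * jet ms 0 0 z (cnj x) =
       \<alpha> * poly S (v z) * cnj (poly S (v x)) * (1 + of_real a * v z * cnj (v x)) ^ d"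
      using S[of u w] pk1[OF u w] gv[OF z] gv[OF x] by (simp add: \<alpha>_def u_def w_def gc_def)
    then have "jet ms 0 0 z (cnj x) =
       \<alpha> * poly S (v z) * cnj (poly S (v x)) * (1 + of_real a * v z * cnj (v x)) ^ d / (r0 z * q z * cnj (r0 x * q x))"
      using qz[OF z] qz[OF x] by (simp add: field_simps)
    then show "(\<Sum>m\<leftarrow>ms. m z * cnj (m x)) = of_real (sqrt \<alpha>r) * poly S (v z) / (r0 z * q z) *
       cnj (of_real (sqrt \<alpha>r) * poly S (v x) / (r0 x * q x)) *
       (1 + of_real (sqrt a) * v z * cnj (of_real (sqrt a) * v x)) ^ d"
      by (simp add: jet00 sq\<alpha>[symmetric] sqa[symmetric] mult_ac)
  qed
qed

section \<open>Curvature of conformal metrics\<close>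

text \<open>\<open>p\<close> and \<open>q\<close> are the derivatives in \<open>z\<close> and in its conjugate.\<close>

definition wirtinger :: "(complex \<Rightarrow> complex) \<Rightarrow> complex \<Rightarrow> complex \<Rightarrow> complex \<Rightarrow> bool" where
  "wirtinger f p q z \<longleftrightarrow> (f has_derivative (\<lambda>v. p * v + q * cnj v)) (at z)"

lemma wirtinger_mult:
  assumes "wirtinger f p q z" "wirtinger g s t z"
  shows "wirtinger (\<lambda>z. f z * g z) (p * g z + f z * s) (q * g z + f z * t) z"
  unfolding wirtinger_def
  by (rule has_derivative_eq_rhs[OF has_derivative_mult[OF assms[unfolded wirtinger_def]]])
     (auto simp: algebra_simps)

lemma wirtinger_diff:
  assumes "wirtinger f p q z" "wirtinger g s t z"
  shows "wirtinger (\<lambda>z. f z - g z) (p - s) (q - t) z"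
  unfolding wirtinger_def
  by (rule has_derivative_eq_rhs[OF has_derivative_diff[OF assms[unfolded wirtinger_def]]])
     (auto simp: algebra_simps)

lemma wirtinger_divide:
  assumes "wirtinger f p q z" "wirtinger g s t z" "g z \<noteq> 0"
  shows "wirtinger (\<lambda>z. f z / g z) ((p * g z - f z * s) / (g z)\<^sup>2) ((q * g z - f z * t) / (g z)\<^sup>2) z"
  unfolding wirtinger_def
  by (rule has_derivative_eq_rhs[OF has_derivative_divide'[OF assms(1,2)[unfolded wirtinger_def] assms(3)]])
     (auto simp: fun_eq_iff power2_eq_square diff_divide_distrib add_divide_distrib algebra_simps)

lemma wirtinger_cong_open:
  assumes "wirtinger f p q z" "open S" "z \<in> S" "\<And>v. v \<in> S \<Longrightarrow> f v = g v"
  shows "wirtinger g p q z"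
  using assms has_derivative_transform_within_open unfolding wirtinger_def by blast

lemma christoffel_mat:
  fixes e :: "complex \<Rightarrow> real" and p :: "complex \<Rightarrow> complex"
  assumes S: "open S" and g: "\<And>v. v \<in> S \<Longrightarrow> g v = mat (e v)" and pos: "\<And>v. v \<in> S \<Longrightarrow> e v > 0"
    and de: "\<And>v. v \<in> S \<Longrightarrow> (e has_derivative (\<lambda>h. 2 * Re (p v * h))) (at v)"
    and v: "v \<in> S"
  defines "D \<equiv> \<lambda>c::2. Re (p v / of_real (e v) * (if c = 1 then 1 else \<i>))"
  shows "christoffel g l a b v = (if b = l then D a else 0) + (if a = l then D b else 0) - (if a = b then D l else 0)"
proof -
  have pd: "pd c (\<lambda>v. g v $ b $ m) v = (if b = m then 2 * e v * D c else 0)" for b c m :: 2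
  proof -
    have "((\<lambda>v. g v $ b $ m) has_derivative (\<lambda>h. if b = m then 2 * Re (p v * h) else 0)) (at v)"
    proof (cases "b = m")
      case True
      have "((\<lambda>v. g v $ b $ m) has_derivative (\<lambda>h. 2 * Re (p v * h))) (at v)"
        by (rule has_derivative_transform_within_open[OF de[OF v] S v]) (auto simp: g True mat_def)
      then show ?thesis using True by simp
    next
      case False
      have "((\<lambda>v. g v $ b $ m) has_derivative (\<lambda>h. 0)) (at v)"
        by (rule has_derivative_transform_within_open[OF has_derivative_const S v]) (auto simp: g False mat_def)
      then show ?thesis using False by simp
    qed
    from frechet_derivative_at[OF this, symmetric] show ?thesis
      using pos[OF v] by (auto simp: pd_def D_def)
  qed
  have inv: "matrix_inv (g v) = (mat (1 / e v) :: real^2^2)"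
  proof -
    have 1: "g v ** mat (1 / e v) = mat 1" "mat (1 / e v) ** g v = mat 1"
      using pos[OF v] unfolding g[OF v]
      by (simp_all add: matrix_matrix_mult_def mat_def vec_eq_iff forall_2 sum_2)
    then have "matrix_inv (g v) ** g v = mat 1"
      using someI[of "\<lambda>B. g v ** B = mat 1 \<and> B ** g v = mat 1" "mat (1 / e v)"]
      unfolding matrix_inv_def by blast
    then have "matrix_inv (g v) ** g v ** mat (1 / e v) = mat (1 / e v)" by simp
    then show ?thesis using 1 by (simp flip: matrix_mul_assoc)
  qed
  have "christoffel g l a b v = 1/2 * (\<Sum>m\<in>UNIV. (if l = m then 1 / e v else 0) *
      ((if b = m then 2 * e v * D a else 0) + (if a = m then 2 * e v * D b else 0) - (if a = b then 2 * e v * D m else 0)))"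
    unfolding christoffel_def inv pd by (simp add: mat_def)
  also have "\<dots> = 1/2 * (1 / e v * ((if b = l then 2 * e v * D a else 0) + (if a = l then 2 * e v * D b else 0)
      - (if a = b then 2 * e v * D l else 0)))"
    by (simp add: if_distribR if_distrib[of "\<lambda>x. x * _"] cong: if_cong)
  also have "\<dots> = (if b = l then D a else 0) + (if a = l then D b else 0) - (if a = b then D l else 0)"
    using pos[OF v] by (cases "b = l"; cases "a = l"; cases "a = b") simp_all
  finally show ?thesis .
qed

text \<open>With \<open>p\<close> the \<open>z\<close>-derivative of \<open>e\<close>, the Christoffel symbols are, up to sign, the real and
imaginary parts of \<open>p / e\<close>, the \<open>z\<close>-derivative of \<open>log e\<close>. Their quadratic terms cancel in the
curvature, and what remains is the mixed derivative \<open>\<beta>\<close> of \<open>log e\<close>.\<close>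

lemma gauss_curvature_conformal:
  fixes e :: "complex \<Rightarrow> real" and p :: "complex \<Rightarrow> complex"
  assumes S: "open S" and g: "\<And>v. v \<in> S \<Longrightarrow> g v = mat (e v)" and pos: "\<And>v. v \<in> S \<Longrightarrow> e v > 0"
    and de: "\<And>v. v \<in> S \<Longrightarrow> (e has_derivative (\<lambda>h. 2 * Re (p v * h))) (at v)"
    and w: "w \<in> S" and L: "wirtinger (\<lambda>v. p v / of_real (e v)) \<alpha> \<beta> w"
  shows "gauss_curvature g w = - 2 * Re \<beta> / e w"
proof -
  define M where "M = (\<lambda>v. p v / of_real (e v))"
  have ch: "christoffel g l a b v = (if b = l then Re (M v * (if a = 1 then 1 else \<i>)) else 0)
     + (if a = l then Re (M v * (if b = 1 then 1 else \<i>)) else 0)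
     - (if a = b then Re (M v * (if l = 1 then 1 else \<i>)) else 0)" if "v \<in> S" for l a b v
    unfolding M_def by (rule christoffel_mat[OF S g pos de that])
  have M: "(M has_derivative (\<lambda>h. \<alpha> * h + \<beta> * cnj h)) (at w)"
    using L by (simp add: wirtinger_def M_def)
  have dRe: "((\<lambda>v. - Re (M v)) has_derivative (\<lambda>h. - Re (\<alpha> * h + \<beta> * cnj h))) (at w)"
    by (intro has_derivative_minus bounded_linear.has_derivative[OF bounded_linear_Re M])
  have dIm: "((\<lambda>v. - Im (M v)) has_derivative (\<lambda>h. - Im (\<alpha> * h + \<beta> * cnj h))) (at w)"
    by (intro has_derivative_minus bounded_linear.has_derivative[OF bounded_linear_Im M])
  have 1: "pd 1 (christoffel g 1 2 2) w = - Re (\<alpha> + \<beta>)"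
  proof -
    have "(christoffel g 1 2 2 has_derivative (\<lambda>h. - Re (\<alpha> * h + \<beta> * cnj h))) (at w)"
      by (rule has_derivative_transform_within_open[OF dRe S w]) (simp add: ch)
    from frechet_derivative_at[OF this, symmetric] show ?thesis by (simp add: pd_def)
  qed
  have 2: "pd 2 (christoffel g 1 1 2) w = - Re (\<alpha> - \<beta>)"
  proof -
    have "(christoffel g 1 1 2 has_derivative (\<lambda>h. - Im (\<alpha> * h + \<beta> * cnj h))) (at w)"
      by (rule has_derivative_transform_within_open[OF dIm S w]) (simp add: ch)
    from frechet_derivative_at[OF this, symmetric] show ?thesis by (simp add: pd_def)
  qed
  have r: "riemann_122 g 1 w = - 2 * Re \<beta>"
    unfolding riemann_122_def 1 2 sum_2 by (simp add: ch[OF w])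
  show ?thesis
    using pos[OF w] unfolding gauss_curvature_def sum_2 r g[OF w] det_2
    by (simp add: mat_def)
qed

text \<open>Here \<open>log e\<close> is \<open>log levi - 2 * log G\<close> on the diagonal; its mixed derivative is computed in
this form, which avoids logarithms, and then cleared of denominators.\<close>

lemma curvature_equation:
  assumes hol: "\<And>t. t \<in> set ts \<Longrightarrow> t holomorphic_on ball 0 r"
    and S: "open S" "S \<subseteq> ball 0 r" "w \<in> S"
    and nzG: "\<And>z. z \<in> S \<Longrightarrow> jet ts 0 0 z (cnj z) \<noteq> 0"
    and pos: "\<And>z. z \<in> S \<Longrightarrow> e z > 0"
    and e: "\<And>z. z \<in> S \<Longrightarrow> of_real (e z) = levi ts z (cnj z) / (jet ts 0 0 z (cnj z))\<^sup>2"
    and g: "\<And>z. z \<in> S \<Longrightarrow> g z = mat (e z)"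
    and K: "gauss_curvature g w = 2 * \<kappa>"
    and y: "y = cnj w"
  shows "(levi ts w y * levi_zy ts w y - levi_z ts w y * levi_y ts w y) * (jet ts 0 0 w y)\<^sup>2
        = (2 - of_real \<kappa>) * levi ts w y ^ 3"
proof -
  define J where "J = (\<lambda>a b z. jet ts a b z (cnj z))"
  define N where "N = (\<lambda>z. levi ts z (cnj z))"
  have dJ: "wirtinger (J a b) (J (Suc a) b z) (J a (Suc b) z) z" if "z \<in> S" for a b z
    unfolding wirtinger_def J_def using jet_diag_derivative[OF hol] that S(2) by blast
  have dJs: "wirtinger (J 0 0) (J 1 0 z) (J 0 1 z) z" "wirtinger (J 1 1) (J 2 1 z) (J 1 2 z) z"
     "wirtinger (J 1 0) (J 2 0 z) (J 1 1 z) z" "wirtinger (J 0 1) (J 1 1 z) (J 0 2 z) z"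
     "wirtinger (J 2 1) (J 3 1 z) (J 2 2 z) z" "wirtinger (J 2 0) (J 3 0 z) (J 2 1 z) z" if "z \<in> S" for z
    using dJ[OF that, of 0 0] dJ[OF that, of 1 1] dJ[OF that, of 1 0] dJ[OF that, of 0 1]
      dJ[OF that, of 2 1] dJ[OF that, of 2 0]
    by (simp_all add: numeral_2_eq_2 numeral_3_eq_3)
  have dN: "wirtinger N (levi_z ts z (cnj z)) (levi_y ts z (cnj z)) z" if "z \<in> S" for z
  proof -
    have "wirtinger (\<lambda>z. J 0 0 z * J 1 1 z - J 1 0 z * J 0 1 z)
       (J 1 0 z * J 1 1 z + J 0 0 z * J 2 1 z - (J 2 0 z * J 0 1 z + J 1 0 z * J 1 1 z))
       (J 0 1 z * J 1 1 z + J 0 0 z * J 1 2 z - (J 1 1 z * J 0 1 z + J 1 0 z * J 0 2 z)) z"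
      by (intro wirtinger_diff wirtinger_mult dJs that)
    then show ?thesis by (simp add: N_def J_def levi_def levi_z_def levi_y_def algebra_simps)
  qed
  have dNz: "wirtinger (\<lambda>z. levi_z ts z (cnj z)) (J 0 0 z * J 3 1 z + J 1 0 z * J 2 1 z - J 3 0 z * J 0 1 z - J 2 0 z * J 1 1 z)
     (levi_zy ts z (cnj z)) z" if "z \<in> S" for z
  proof -
    have "wirtinger (\<lambda>z. J 0 0 z * J 2 1 z - J 2 0 z * J 0 1 z)
       (J 1 0 z * J 2 1 z + J 0 0 z * J 3 1 z - (J 3 0 z * J 0 1 z + J 2 0 z * J 1 1 z))
       (J 0 1 z * J 2 1 z + J 0 0 z * J 2 2 z - (J 2 1 z * J 0 1 z + J 2 0 z * J 0 2 z)) z"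
      by (intro wirtinger_diff wirtinger_mult dJs that)
    then show ?thesis by (simp add: J_def levi_zy_def levi_z_def algebra_simps)
  qed
  have G: "J 0 0 z \<noteq> 0" if "z \<in> S" for z using nzG[OF that] by (simp add: J_def)
  have eN: "of_real (e z) = N z / (J 0 0 z)\<^sup>2" if "z \<in> S" for z
    using e[OF that] by (simp add: N_def J_def)
  have Nnz: "N z \<noteq> 0" if "z \<in> S" for z
    using pos[OF that] eN[OF that] by auto
  define p where "p = (\<lambda>z. (levi_z ts z (cnj z) * J 0 0 z - 2 * N z * J 1 0 z) / (J 0 0 z) ^ 3)"
  have conj: "cnj (J a b z) = J b a z" for a b z by (simp add: J_def jet_cnj)
  have cN: "cnj (N z) = N z" for z by (simp add: N_def levi_def jet_cnj)
  have cNz: "cnj (levi_z ts z (cnj z)) = levi_y ts z (cnj z)" for z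
    by (simp add: levi_z_def levi_y_def jet_cnj)
  have de: "(e has_derivative (\<lambda>h. 2 * Re (p z * h))) (at z)" if z: "z \<in> S" for z
  proof -
    have "wirtinger (\<lambda>z. N z / (J 0 0 z * J 0 0 z)) (p z) (cnj (p z)) z"
    proof -
      have "wirtinger (\<lambda>z. N z / (J 0 0 z * J 0 0 z))
         ((levi_z ts z (cnj z) * (J 0 0 z * J 0 0 z) - N z * (J 1 0 z * J 0 0 z + J 0 0 z * J 1 0 z)) / (J 0 0 z * J 0 0 z)\<^sup>2)
         ((levi_y ts z (cnj z) * (J 0 0 z * J 0 0 z) - N z * (J 0 1 z * J 0 0 z + J 0 0 z * J 0 1 z)) / (J 0 0 z * J 0 0 z)\<^sup>2) z"
        using G[OF z] by (intro wirtinger_divide wirtinger_mult dJs dN z) simp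
      moreover have "(levi_z ts z (cnj z) * (J 0 0 z * J 0 0 z) - N z * (J 1 0 z * J 0 0 z + J 0 0 z * J 1 0 z)) / (J 0 0 z * J 0 0 z)\<^sup>2 = p z"
        using G[OF z] unfolding p_def by (simp add: divide_simps power2_eq_square power3_eq_cube) (simp add: algebra_simps)
      moreover have "(levi_y ts z (cnj z) * (J 0 0 z * J 0 0 z) - N z * (J 0 1 z * J 0 0 z + J 0 0 z * J 0 1 z)) / (J 0 0 z * J 0 0 z)\<^sup>2 = cnj (p z)"
        using G[OF z] unfolding p_def by (simp add: conj cN cNz divide_simps power2_eq_square power3_eq_cube) (simp add: algebra_simps)
      ultimately show ?thesis by simp
    qed
    then have "((\<lambda>z. Re (N z / (J 0 0 z * J 0 0 z))) has_derivative (\<lambda>v. Re (p z * v + cnj (p z) * cnj v))) (at z)"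
      unfolding wirtinger_def by (rule bounded_linear.has_derivative[OF bounded_linear_Re])
    then have "(e has_derivative (\<lambda>v. Re (p z * v + cnj (p z) * cnj v))) (at z)"
      by (rule has_derivative_transform_within_open[OF _ S(1) z])
         (metis Re_complex_of_real eN power2_eq_square)
    then show ?thesis by (rule has_derivative_eq_rhs) auto
  qed
  define \<beta> where "\<beta> = (levi_zy ts w y * N w - levi_z ts w y * levi_y ts w y) / (N w)\<^sup>2 - 2 * (N w / (J 0 0 w)\<^sup>2)"
  have w: "w \<in> S" by (rule S(3))
  obtain \<alpha> where L: "wirtinger (\<lambda>v. p v / of_real (e v)) \<alpha> \<beta> w"
  proof -
    have 1: "wirtinger (\<lambda>z. levi_z ts z (cnj z) / N z)
        (((J 0 0 w * J 3 1 w + J 1 0 w * J 2 1 w - J 3 0 w * J 0 1 w - J 2 0 w * J 1 1 w) * N w - levi_z ts w (cnj w) * levi_z ts w (cnj w)) / (N w)\<^sup>2)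
        ((levi_zy ts w (cnj w) * N w - levi_z ts w (cnj w) * levi_y ts w (cnj w)) / (N w)\<^sup>2) w"
      by (intro wirtinger_divide dNz dN w Nnz)
    have 2: "wirtinger (\<lambda>z. J 1 0 z / J 0 0 z)
        ((J 2 0 w * J 0 0 w - J 1 0 w * J 1 0 w) / (J 0 0 w)\<^sup>2)
        ((J 1 1 w * J 0 0 w - J 1 0 w * J 0 1 w) / (J 0 0 w)\<^sup>2) w"
      by (intro wirtinger_divide dJs w G)
    have 3: "(J 1 1 w * J 0 0 w - J 1 0 w * J 0 1 w) / (J 0 0 w)\<^sup>2 = N w / (J 0 0 w)\<^sup>2"
      by (simp add: N_def levi_def J_def algebra_simps)
    have four: "wirtinger (\<lambda>z. 2) 0 0 w" by (simp add: wirtinger_def)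
    obtain \<alpha> where "wirtinger (\<lambda>z. levi_z ts z (cnj z) / N z - 2 * (J 1 0 z / J 0 0 z)) \<alpha>
        ((levi_zy ts w (cnj w) * N w - levi_z ts w (cnj w) * levi_y ts w (cnj w)) / (N w)\<^sup>2 - (0 * (J 1 0 w / J 0 0 w) + 2 * (N w / (J 0 0 w)\<^sup>2))) w"
      using wirtinger_diff[OF 1 wirtinger_mult[OF four 2]] unfolding 3 by blast
    then have "wirtinger (\<lambda>z. levi_z ts z (cnj z) / N z - 2 * (J 1 0 z / J 0 0 z)) \<alpha> \<beta> w"
      unfolding \<beta>_def y by simp
    then have "wirtinger (\<lambda>v. p v / of_real (e v)) \<alpha> \<beta> w"
    proof (rule wirtinger_cong_open[OF _ S(1) w])
      show "levi_z ts v (cnj v) / N v - 2 * (J 1 0 v / J 0 0 v) = p v / of_real (e v)" if "v \<in> S" for v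
        unfolding p_def eN[OF that] using G[OF that] Nnz[OF that]
        by (simp add: divide_simps power2_eq_square power3_eq_cube)
    qed
    then show ?thesis using that by blast
  qed
  have "gauss_curvature g w = - 2 * Re \<beta> / e w"
    by (rule gauss_curvature_conformal[OF S(1) g pos de w L])
  then have "Re \<beta> = - \<kappa> * e w" using K pos[OF w] by (simp add: field_simps)
  moreover have "cnj \<beta> = \<beta>"
  proof -
    have "cnj (levi_zy ts w y) = levi_zy ts w y" by (simp add: levi_zy_def jet_cnj y)
    moreover have "cnj (levi_z ts w y) = levi_y ts w y" "cnj (levi_y ts w y) = levi_z ts w y"
      by (simp_all add: levi_z_def levi_y_def jet_cnj y)
    ultimately show ?thesis by (simp add: \<beta>_def cN conj mult.commute)
  qed
  ultimately have "\<beta> = of_real (- \<kappa> * e w)" by (simp add: complex_eq_iff)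
  then have "\<beta> = - of_real \<kappa> * (N w / (J 0 0 w)\<^sup>2)" by (simp flip: eN[OF w])
  moreover have "A = (2 - k) * M" if "A - 2 * M = - k * M" for A M k :: complex
    using that by (simp add: algebra_simps)
  ultimately have "(levi_zy ts w y * N w - levi_z ts w y * levi_y ts w y) / (N w)\<^sup>2
      = (2 - of_real \<kappa>) * (N w / (J 0 0 w)\<^sup>2)"
    unfolding \<beta>_def by blast
  then have "(levi_zy ts w y * N w - levi_z ts w y * levi_y ts w y) * (J 0 0 w)\<^sup>2 = (2 - of_real \<kappa>) * N w ^ 3"
    using G[OF w] Nnz[OF w] by (simp add: divide_simps power2_eq_square power3_eq_cube mult_ac)
  then show ?thesis by (simp add: N_def J_def y mult.commute)
qed

section \<open>Products of kernels and common zeros\<close>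

text \<open>The mixed derivative of the logarithm of the squared norm of the vector of functions \<open>ts\<close>.\<close>

definition ddbar_log :: "(complex \<Rightarrow> complex) list \<Rightarrow> complex \<Rightarrow> complex" where
  "ddbar_log ts z = levi ts z (cnj z) / (jet ts 0 0 z (cnj z))\<^sup>2"

context
  fixes r :: real and ms rs :: "(complex \<Rightarrow> complex) list"
  assumes hm: "\<And>m. m \<in> set ms \<Longrightarrow> m holomorphic_on ball 0 r"
    and hr: "\<And>t. t \<in> set rs \<Longrightarrow> t holomorphic_on ball 0 r"
begin

lemma hol_products: "t \<in> set (products ms rs) \<Longrightarrow> t holomorphic_on ball 0 r"
  using hm hr by (auto simp: set_products intro!: holomorphic_intros)

lemma jet_products10:
  assumes z: "z \<in> ball 0 r"
  shows "jet (products ms rs) 1 0 z y = jet ms 1 0 z y * jet rs 0 0 z y + jet rs 1 0 z y * jet ms 0 0 z y"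
proof -
  have "((\<lambda>z. jet ms 0 0 z y * jet rs 0 0 z y) has_field_derivative jet (products ms rs) (Suc 0) 0 z y) (at z)"
    using jet_deriv1[where ts = "products ms rs" and a = 0 and b = 0 and y = y, OF hol_products z] by (simp add: jet_products00)
  moreover have "((\<lambda>z. jet ms 0 0 z y * jet rs 0 0 z y) has_field_derivative
      jet ms (Suc 0) 0 z y * jet rs 0 0 z y + jet rs (Suc 0) 0 z y * jet ms 0 0 z y) (at z)"
    by (intro DERIV_mult jet_deriv1[OF hm z] jet_deriv1[OF hr z])
  ultimately show ?thesis using DERIV_unique by fastforce
qed

lemma jet_products01:
  assumes y: "y \<in> ball 0 r"
  shows "jet (products ms rs) 0 1 z y = jet ms 0 1 z y * jet rs 0 0 z y + jet rs 0 1 z y * jet ms 0 0 z y"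
proof -
  have "((\<lambda>y. jet ms 0 0 z y * jet rs 0 0 z y) has_field_derivative jet (products ms rs) 0 (Suc 0) z y) (at y)"
    using jet_deriv2[where ts = "products ms rs" and a = 0 and b = 0 and z = z, OF hol_products y] by (simp add: jet_products00)
  moreover have "((\<lambda>y. jet ms 0 0 z y * jet rs 0 0 z y) has_field_derivative
      jet ms 0 (Suc 0) z y * jet rs 0 0 z y + jet rs 0 (Suc 0) z y * jet ms 0 0 z y) (at y)"
    by (intro DERIV_mult jet_deriv2[OF hm y] jet_deriv2[OF hr y])
  ultimately show ?thesis using DERIV_unique by fastforce
qed

lemma jet_products11:
  assumes z: "z \<in> ball 0 r" and y: "y \<in> ball 0 r"
  shows "jet (products ms rs) 1 1 z y = jet ms 1 1 z y * jet rs 0 0 z y + jet rs 0 1 z y * jet ms 1 0 z y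
    + (jet rs 1 1 z y * jet ms 0 0 z y + jet ms 0 1 z y * jet rs 1 0 z y)"
proof -
  have "((\<lambda>y. jet ms 1 0 z y * jet rs 0 0 z y + jet rs 1 0 z y * jet ms 0 0 z y)
      has_field_derivative jet (products ms rs) 1 (Suc 0) z y) (at y)"
    using jet_deriv2[where ts = "products ms rs" and a = 1 and b = 0 and z = z, OF hol_products y] by (simp add: jet_products10[OF z, simplified])
  moreover have "((\<lambda>y. jet ms 1 0 z y * jet rs 0 0 z y + jet rs 1 0 z y * jet ms 0 0 z y) has_field_derivative
      jet ms 1 (Suc 0) z y * jet rs 0 0 z y + jet rs 0 (Suc 0) z y * jet ms 1 0 z y
      + (jet rs 1 (Suc 0) z y * jet ms 0 0 z y + jet ms 0 (Suc 0) z y * jet rs 1 0 z y)) (at y)"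
    by (intro DERIV_add DERIV_mult jet_deriv2[OF hm y] jet_deriv2[OF hr y])
  ultimately show ?thesis using DERIV_unique by fastforce
qed

lemma ddbar_log_products:
  assumes z: "z \<in> ball 0 r" and nz: "jet ms 0 0 z (cnj z) \<noteq> 0" "jet rs 0 0 z (cnj z) \<noteq> 0"
  shows "ddbar_log (products ms rs) z = ddbar_log ms z + ddbar_log rs z"
proof -
  have y: "cnj z \<in> ball 0 r" using z by simp
  have "levi (products ms rs) z (cnj z) = (jet rs 0 0 z (cnj z))\<^sup>2 * levi ms z (cnj z)
      + (jet ms 0 0 z (cnj z))\<^sup>2 * levi rs z (cnj z)"
    unfolding levi_def jet_products00 jet_products10[OF z] jet_products01[OF y] jet_products11[OF z y] by algebra
  then show ?thesis
    using nz by (simp add: ddbar_log_def jet_products00 divide_simps power_mult_distrib)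
qed

end

text \<open>The logarithm of the modulus of one holomorphic function is harmonic.\<close>

lemma ddbar_log_single: "ddbar_log [h] z = 0"
  by (simp add: ddbar_log_def levi_def jet_def mult_ac)

fun iterated_products :: "(complex \<Rightarrow> complex) list list \<Rightarrow> (complex \<Rightarrow> complex) list" where
  "iterated_products [] = [\<lambda>z. 1]"
| "iterated_products (ts # tss) = products ts (iterated_products tss)"

lemma hol_iterated_products:
  assumes "\<And>ts t. ts \<in> set tss \<Longrightarrow> t \<in> set ts \<Longrightarrow> t holomorphic_on ball 0 r" "t \<in> set (iterated_products tss)"
  shows "t holomorphic_on ball 0 r"
  using assms
proof (induction tss arbitrary: t)
  case (Cons ts tss)
  then show ?case using hol_products[of ts r "iterated_products tss" t] by auto
qed auto

lemma iterated_products_nonzero: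
  assumes "\<And>ts. ts \<in> set tss \<Longrightarrow> \<exists>t\<in>set ts. t z \<noteq> 0"
  shows "\<exists>t\<in>set (iterated_products tss). t z \<noteq> 0"
  using assms
proof (induction tss)
  case (Cons ts tss)
  have "\<exists>t\<in>set ts. t z \<noteq> 0" by (rule Cons.prems) simp
  moreover have "\<exists>u\<in>set (iterated_products tss). u z \<noteq> 0" by (rule Cons.IH, rule Cons.prems) simp
  ultimately obtain t u where tu: "t \<in> set ts" "t z \<noteq> 0" "u \<in> set (iterated_products tss)" "u z \<noteq> 0" by blast
  show ?case
  proof (rule bexI)
    show "(\<lambda>z. t z * u z) \<in> set (iterated_products (ts # tss))" using tu by (auto simp: set_products)
  qed (use tu in simp)
qed auto

lemma jet00_nonzero:
  assumes "\<exists>t\<in>set ts. t z \<noteq> 0"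
  shows "jet ts 0 0 z (cnj z) \<noteq> 0"
proof -
  obtain t where t: "t \<in> set ts" "t z \<noteq> 0" using assms by blast
  have "(cmod (t z))\<^sup>2 \<le> (\<Sum>t\<leftarrow>ts. (cmod (t z))\<^sup>2)"
    using t(1) by (intro member_le_sum_list) auto
  then have "(\<Sum>t\<leftarrow>ts. (cmod (t z))\<^sup>2) \<noteq> 0" using t(2) by auto
  then show ?thesis using jet_diag_real[of ts z] by (metis of_real_eq_0_iff)
qed

lemma ddbar_log_iterated_products:
  assumes "\<And>ts t. ts \<in> set tss \<Longrightarrow> t \<in> set ts \<Longrightarrow> t holomorphic_on ball 0 r" "z \<in> ball 0 r"
    and "\<And>ts. ts \<in> set tss \<Longrightarrow> \<exists>t\<in>set ts. t z \<noteq> 0"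
  shows "ddbar_log (iterated_products tss) z = (\<Sum>ts\<leftarrow>tss. ddbar_log ts z)"
  using assms
proof (induction tss)
  case Nil
  then show ?case by (simp add: ddbar_log_single)
next
  case (Cons ts tss)
  have "ddbar_log (products ts (iterated_products tss)) z = ddbar_log ts z + ddbar_log (iterated_products tss) z"
  proof (rule ddbar_log_products[OF _ _ Cons.prems(2)])
    show "t holomorphic_on ball 0 r" if "t \<in> set ts" for t using that Cons.prems(1) by auto
    show "t holomorphic_on ball 0 r" if "t \<in> set (iterated_products tss)" for t
      by (rule hol_iterated_products[OF _ that]) (use Cons.prems(1) in auto)
    show "jet ts 0 0 z (cnj z) \<noteq> 0" by (rule jet00_nonzero) (use Cons.prems(3) in auto)
    show "jet (iterated_products tss) 0 0 z (cnj z) \<noteq> 0"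
      by (intro jet00_nonzero iterated_products_nonzero) (use Cons.prems(3) in auto)
  qed
  then show ?case using Cons by auto
qed

text \<open>\<open>m\<close> is the least order of vanishing at the origin among the functions of the family.\<close>

lemma divide_common_zero:
  fixes H :: "'i \<Rightarrow> complex \<Rightarrow> complex"
  assumes hol: "\<And>i. i \<in> I \<Longrightarrow> H i holomorphic_on ball 0 r"
    and nz: "i0 \<in> I" "z0 \<in> ball 0 r" "H i0 z0 \<noteq> 0"
  obtains m \<tau> where "\<And>i. i \<in> I \<Longrightarrow> \<tau> i holomorphic_on ball 0 r"
    "\<And>i z. i \<in> I \<Longrightarrow> z \<in> ball 0 r \<Longrightarrow> H i z = z ^ m * \<tau> i z" "\<exists>i\<in>I. \<tau> i 0 \<noteq> 0"
proof -
  have r: "0 \<in> ball (0::complex) r" using nz(2) by (auto intro: le_less_trans[OF norm_ge_zero])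
  define Q where "Q = (\<lambda>m. \<exists>i\<in>I. (deriv ^^ m) (H i) 0 \<noteq> 0)"
  have "\<exists>m. Q m"
    using holomorphic_fun_eq_0_on_connected[OF hol[OF nz(1)] open_ball connected_ball _ r nz(2)] nz(1,3)
    by (auto simp: Q_def)
  define m where "m = (LEAST m. Q m)"
  have Qm: "Q m" unfolding m_def using \<open>\<exists>m. Q m\<close> by (rule LeastI_ex)
  have least: "\<not> Q n" if "n < m" for n using that not_less_Least unfolding m_def by blast
  define a where "a = (\<lambda>i n. (deriv ^^ n) (H i) 0 / fact n)"
  define \<tau> where "\<tau> = (\<lambda>i z. if z = 0 then a i m else H i z / z ^ m)"
  have sums: "(\<lambda>n. a i (n + m) * (z - 0) ^ n) sums \<tau> i z" if i: "i \<in> I" and z: "z \<in> ball 0 r" for i z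
  proof (cases "z = 0")
    case True
    then show ?thesis using powser_sums_zero[of "\<lambda>n. a i (n + m)"] by (simp add: \<tau>_def)
  next
    case False
    have "(\<lambda>n. a i n * z ^ n) sums H i z"
      using holomorphic_power_series[OF hol[OF i] z] by (simp add: a_def)
    moreover have "a i n = 0" if "n < m" for n using least[OF that] i by (auto simp: Q_def a_def)
    ultimately have "(\<lambda>n. a i (n + m) * z ^ (n + m)) sums H i z"
      using sums_iff_shift[of "\<lambda>n. a i n * z ^ n" m "H i z"] by simp
    then have "(\<lambda>n. a i (n + m) * z ^ (n + m) / z ^ m) sums (H i z / z ^ m)" by (rule sums_divide)
    then show ?thesis using False by (simp add: \<tau>_def power_add)
  qed
  show ?thesis
  proof (rule that[of \<tau> m])
    show "\<tau> i holomorphic_on ball 0 r" if "i \<in> I" for i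
      using power_series_holomorphic[OF sums[OF that]] by blast
    show "H i z = z ^ m * \<tau> i z" if i: "i \<in> I" and z: "z \<in> ball 0 r" for i z
    proof (cases "z = 0")
      case True
      have "(\<lambda>n. a i n * (0 - 0) ^ n) sums H i 0"
        using holomorphic_power_series[OF hol[OF i] r] by (simp add: a_def)
      then have H0: "H i 0 = a i 0" using powser_sums_zero[of "a i"] sums_unique2 by fastforce
      show ?thesis
      proof (cases "m = 0")
        case True then show ?thesis using H0 \<open>z = 0\<close> by (simp add: \<tau>_def)
      next
        case False
        then have "a i 0 = 0" using least[of 0] i by (auto simp: Q_def a_def)
        then show ?thesis using H0 \<open>z = 0\<close> False by (simp add: power_0_left)
      qed
    qed (simp add: \<tau>_def)
    show "\<exists>i\<in>I. \<tau> i 0 \<noteq> 0" using Qm by (auto simp: Q_def \<tau>_def a_def)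
  qed
qed

lemma jet_cong:
  assumes "list_all2 (\<lambda>s t. s holomorphic_on ball 0 r \<and> t holomorphic_on ball 0 r \<and> (\<forall>z\<in>ball 0 r. s z = t z)) ss ts"
    and z: "z \<in> ball 0 r" and y: "y \<in> ball 0 r"
  shows "jet ss a b z y = jet ts a b z y"
  using assms(1)
proof (induction rule: list_all2_induct)
  case Nil
  then show ?case by (simp add: jet_def)
next
  case (Cons s ss t ts)
  have y': "cnj y \<in> ball 0 r" using y by simp
  have "(deriv ^^ a) s z = (deriv ^^ a) t z" "(deriv ^^ b) s (cnj y) = (deriv ^^ b) t (cnj y)"
    using Cons(1) higher_deriv_transform_within_open[OF _ _ open_ball z]
      higher_deriv_transform_within_open[OF _ _ open_ball y'] by blast+
  then show ?case using Cons by (simp add: jet_def)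
qed

lemma ddbar_log_divide_common_zero:
  assumes hH: "\<And>i. i \<in> set is \<Longrightarrow> H i holomorphic_on ball 0 r"
    and h\<tau>: "\<And>i. i \<in> set is \<Longrightarrow> \<tau> i holomorphic_on ball 0 r"
    and eq: "\<And>i z. i \<in> set is \<Longrightarrow> z \<in> ball 0 r \<Longrightarrow> H i z = z ^ m * \<tau> i z"
    and z: "z \<in> ball 0 r" "z \<noteq> 0" and nz: "\<exists>i\<in>set is. \<tau> i z \<noteq> 0"
  shows "ddbar_log (map H is) z = ddbar_log (map \<tau> is) z"
proof -
  have y: "cnj z \<in> ball 0 r" using z by simp
  have lm: "products [\<lambda>z. z ^ m] (map \<tau> is) = map (\<lambda>i z. z ^ m * \<tau> i z) is"
    by (simp add: products_def o_def)
  have "jet (map H is) a b z (cnj z) = jet (map (\<lambda>i z. z ^ m * \<tau> i z) is) a b z (cnj z)" for a b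
    by (rule jet_cong[OF _ z(1) y])
       (use hH h\<tau> eq in \<open>auto simp: list_all2_map1 list_all2_map2 list_all2_same intro!: holomorphic_intros\<close>)
  then have "ddbar_log (map H is) z = ddbar_log (products [\<lambda>z. z ^ m] (map \<tau> is)) z"
    by (simp add: ddbar_log_def levi_def lm)
  also have "\<dots> = ddbar_log [\<lambda>z. z ^ m] z + ddbar_log (map \<tau> is) z"
    by (rule ddbar_log_products[OF _ _ z(1)])
       (use h\<tau> nz z in \<open>auto intro!: holomorphic_intros jet00_nonzero\<close>)
  finally show ?thesis by (simp add: ddbar_log_single)
qed

section \<open>Hermitian linear algebra\<close>

lemma hinner_add_left: "hinner (x + y) z = hinner x z + hinner y z"
  by (simp add: hinner_def algebra_simps sum.distrib)
lemma hinner_add_right: "hinner z (x + y) = hinner z x + hinner z y"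
  by (simp add: hinner_def algebra_simps sum.distrib)
lemma hinner_diff_left: "hinner (x - y) z = hinner x z - hinner y z"
  by (simp add: hinner_def algebra_simps sum_subtractf)
lemma hinner_scale_left: "hinner (c *s x) y = c * hinner x y"
  by (simp add: hinner_def sum_distrib_left mult_ac)
lemma hinner_scale_right: "hinner x (c *s y) = cnj c * hinner x y"
  by (simp add: hinner_def sum_distrib_left mult_ac)
lemma hinner_cnj: "cnj (hinner x y) = hinner y x"
  by (simp add: hinner_def mult.commute)
lemma hinner_zero_left [simp]: "hinner 0 y = 0" by (simp add: hinner_def)
lemma hinner_zero_right [simp]: "hinner y 0 = 0" by (simp add: hinner_def)
lemma hinner_sum_left: "hinner (sum f A) y = (\<Sum>a\<in>A. hinner (f a) y)"
  by (induction A rule: infinite_finite_induct) (auto simp: hinner_add_left)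

lemma hinner_self: "hinner x x = of_real ((norm x)\<^sup>2)"
proof -
  have "(norm x)\<^sup>2 = (\<Sum>i\<in>UNIV. (cmod (x $ i))\<^sup>2)"
    by (simp add: norm_vec_def L2_set_def sum_nonneg)
  then show ?thesis by (simp add: hinner_def complex_norm_square del: of_real_power)
qed

lemma hinner_self_eq_0 [simp]: "hinner x x = 0 \<longleftrightarrow> x = 0"
  by (simp add: hinner_self)

lemma hinner_eq_0_commute: "hinner x y = 0 \<Longrightarrow> hinner y x = 0"
  by (metis complex_cnj_zero hinner_cnj)

text \<open>The matrix with the vectors as rows has a right inverse, its adjoint, which is then a left inverse.\<close>

lemma orthonormal_complete:
  fixes e :: "nat \<Rightarrow> complex ^ 'm::finite" and \<iota> :: "'m \<Rightarrow> nat"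
  assumes \<iota>: "bij_betw \<iota> UNIV {..n}"
    and on: "\<And>c d. c \<le> n \<Longrightarrow> d \<le> n \<Longrightarrow> hinner (e c) (e d) = (if c = d then 1 else 0)"
  shows "v = (\<Sum>c\<le>n. hinner v (e c) *s e c)"
proof -
  define B :: "complex ^ 'm ^ 'm" where "B = (\<chi> i k. e (\<iota> i) $ k)"
  have \<iota>n: "\<iota> i \<le> n" for i using bij_betwE[OF \<iota>] by auto
  have "B ** cadjoint B = mat 1"
    using on[OF \<iota>n \<iota>n] bij_betw_imp_inj_on[OF \<iota>]
    by (auto simp: B_def cadjoint_def matrix_matrix_mult_def mat_def vec_eq_iff hinner_def inj_on_def)
  then have "cadjoint B ** B = mat 1" by (simp add: matrix_left_right_inverse)
  then have B: "(\<Sum>i\<in>UNIV. cnj (B $ i $ k) * B $ i $ l) = (if k = l then 1 else 0)" for k l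
    by (simp add: matrix_matrix_mult_def mat_def vec_eq_iff cadjoint_def)
  have "(\<Sum>c\<le>n. hinner v (e c) *s e c) $ l = v $ l" for l
  proof -
    have "(\<Sum>c\<le>n. hinner v (e c) *s e c) $ l = (\<Sum>c\<le>n. hinner v (e c) * e c $ l)" by simp
    also have "\<dots> = (\<Sum>i\<in>UNIV. hinner v (e (\<iota> i)) * e (\<iota> i) $ l)"
      by (rule sum.reindex_bij_betw[OF \<iota>, symmetric])
    also have "\<dots> = (\<Sum>i\<in>UNIV. \<Sum>k\<in>UNIV. v $ k * (cnj (B $ i $ k) * B $ i $ l))"
      by (simp add: hinner_def B_def sum_distrib_left sum_distrib_right mult_ac)
    also have "\<dots> = (\<Sum>k\<in>UNIV. v $ k * (\<Sum>i\<in>UNIV. cnj (B $ i $ k) * B $ i $ l))"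
      unfolding sum_distrib_left by (rule sum.swap)
    also have "\<dots> = v $ l" by (simp add: B if_distrib cong: if_cong)
    finally show ?thesis .
  qed
  then show ?thesis by (simp add: vec_eq_iff)
qed

section \<open>Exterior powers\<close>

text \<open>The coordinates of the wedge product of \<open>v 0, ..., v j\<close>, as an alternating tensor indexed by all
maps \<open>s\<close> from \<open>{..j}\<close> to the basis; each minor is repeated \<open>(j + 1)!\<close> times up to sign, so that
norms come out multiplied by \<open>(j + 1)!\<close>.\<close>

definition wedge :: "nat \<Rightarrow> (nat \<Rightarrow> complex ^ 'm) \<Rightarrow> (nat \<Rightarrow> 'm) \<Rightarrow> complex" where
  "wedge j v s = (\<Sum>p | p permutes {..j}. of_int (sign p) * (\<Prod>a\<le>j. v a $ s (p a)))"

lemma wedge_cong: "(\<And>a. a \<le> j \<Longrightarrow> u a = v a) \<Longrightarrow> wedge j u s = wedge j v s"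
  by (simp add: wedge_def)

lemma wedge_linear:
  assumes i: "i \<le> j"
  shows "wedge j (v(i := \<Sum>c\<in>C. m c *s e c)) s = (\<Sum>c\<in>C. m c * wedge j (v(i := e c)) s)"
proof -
  have split: "(\<Prod>a\<le>j. (v(i := x)) a $ s (p a)) = x $ s (p i) * (\<Prod>a\<in>{..j} - {i}. v a $ s (p a))" for x p
    using i by (subst prod.remove[of _ i]) (auto intro!: arg_cong2[where f = "(*)"] prod.cong)
  have "wedge j (v(i := \<Sum>c\<in>C. m c *s e c)) s =
     (\<Sum>p | p permutes {..j}. \<Sum>c\<in>C. m c * (of_int (sign p) * (e c $ s (p i) * (\<Prod>a\<in>{..j} - {i}. v a $ s (p a)))))"
    unfolding wedge_def split by (simp add: sum_distrib_left sum_distrib_right mult_ac)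
  also have "\<dots> = (\<Sum>c\<in>C. \<Sum>p | p permutes {..j}. m c * (of_int (sign p) * (e c $ s (p i) * (\<Prod>a\<in>{..j} - {i}. v a $ s (p a)))))"
    by (rule sum.swap)
  also have "\<dots> = (\<Sum>c\<in>C. m c * wedge j (v(i := e c)) s)"
    unfolding wedge_def split sum_distrib_left ..
  finally show ?thesis .
qed

lemma wedge_alternating:
  assumes a: "a \<le> j" and b: "b \<le> j" and ab: "a \<noteq> b" and eq: "v a = v b"
  shows "wedge j v s = 0"
proof -
  let ?t = "Transposition.transpose a b"
  let ?f = "\<lambda>p. of_int (sign p) * (\<Prod>c\<le>j. v c $ s (p c))"
  have t: "?t permutes {..j}" using a b by (intro permutes_swap_id) auto
  have f: "?f (p \<circ> ?t) = - ?f p" if p: "p permutes {..j}" for p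
  proof -
    have "sign (p \<circ> ?t) = - sign p"
      using permutes_imp_permutation[OF _ p] permutes_imp_permutation[OF _ t] ab
      by (simp add: sign_compose sign_swap_id)
    moreover have "(\<Prod>c\<le>j. v c $ s ((p \<circ> ?t) c)) = (\<Prod>c\<le>j. v c $ s (p c))"
    proof -
      have "(\<Prod>c\<le>j. v c $ s (p c)) = (\<Prod>c\<le>j. v (?t c) $ s (p (?t c)))"
        by (subst prod.permute[OF t]) (simp add: o_def)
      moreover have "v (?t c) = v c" for c using eq by (auto simp: Transposition.transpose_def)
      ultimately show ?thesis by simp
    qed
    ultimately show ?thesis by simp
  qed
  have "wedge j v s = (\<Sum>p | p permutes {..j}. ?f (p \<circ> ?t))"
    unfolding wedge_def by (rule sum_permutations_compose_right[OF t])
  also have "\<dots> = - wedge j v s" unfolding wedge_def using f by (simp add: sum_negf)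
  finally show ?thesis by simp
qed

text \<open>Row operations: the rows are replaced from the top, and the terms with a repeated row vanish.\<close>

lemma wedge_triangular:
  assumes "i \<le> Suc j" and "\<And>a. a < i \<Longrightarrow> v a = (\<Sum>c\<le>a. M a c *s e c)"
  shows "wedge j v s = (\<Prod>a<i. M a a) * wedge j (\<lambda>a. if a < i then e a else v a) s"
  using assms
proof (induction i)
  case 0
  then show ?case by simp
next
  case (Suc i)
  let ?u = "\<lambda>a. if a < i then e a else v a"
  have i: "i \<le> j" using Suc.prems by simp
  have "wedge j ?u s = wedge j (?u(i := \<Sum>c\<le>i. M i c *s e c)) s"
    using Suc.prems(2)[of i] by (intro wedge_cong) auto
  also have "\<dots> = (\<Sum>c\<le>i. M i c * wedge j (?u(i := e c)) s)" by (rule wedge_linear[OF i])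
  also have "\<dots> = (\<Sum>c\<le>i. if c = i then M i i * wedge j (?u(i := e i)) s else 0)"
  proof (rule sum.cong[OF refl])
    fix c assume "c \<in> {..i}"
    then show "M i c * wedge j (?u(i := e c)) s = (if c = i then M i i * wedge j (?u(i := e i)) s else 0)"
      using wedge_alternating[of c j i "?u(i := e c)" s] i by auto
  qed
  also have "\<dots> = M i i * wedge j (?u(i := e i)) s" by simp
  also have "wedge j (?u(i := e i)) s = wedge j (\<lambda>a. if a < Suc i then e a else v a) s"
    by (intro wedge_cong) auto
  finally show ?case using Suc by simp
qed

lemma wedge_inner:
  fixes u v :: "nat \<Rightarrow> complex ^ 'm::finite"
  shows "(\<Sum>s\<in>PiE {..j} (\<lambda>_. UNIV). wedge j u s * cnj (wedge j v s)) =
    (\<Sum>p | p permutes {..j}. \<Sum>q | q permutes {..j}. of_int (sign p) * of_int (sign q) *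
       (\<Prod>b\<le>j. hinner (u (inv p b)) (v (inv q b))))"
proof -
  have inv: "(\<Prod>a\<le>j. w a $ s (p a)) = (\<Prod>b\<le>j. w (inv p b) $ s b)" if p: "p permutes {..j}" for w :: "nat \<Rightarrow> complex ^ 'm" and p s
    by (subst prod.permute[OF p, of "\<lambda>b. w (inv p b) $ s b"]) (simp add: o_def permutes_inverses[OF p])
  have "(\<Sum>s\<in>PiE {..j} (\<lambda>_. UNIV). wedge j u s * cnj (wedge j v s)) =
    (\<Sum>s\<in>PiE {..j} (\<lambda>_. UNIV). \<Sum>p | p permutes {..j}. \<Sum>q | q permutes {..j}. of_int (sign p) * of_int (sign q) *
       (\<Prod>b\<le>j. u (inv p b) $ s b * cnj (v (inv q b) $ s b)))"
    unfolding wedge_def cnj_sum sum_product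
    by (intro sum.cong refl) (auto simp: inv prod.distrib mult_ac)
  also have "\<dots> = (\<Sum>p | p permutes {..j}. \<Sum>q | q permutes {..j}. \<Sum>s\<in>PiE {..j} (\<lambda>_. UNIV). of_int (sign p) * of_int (sign q) *
       (\<Prod>b\<le>j. u (inv p b) $ s b * cnj (v (inv q b) $ s b)))"
    by (subst sum.swap) (rule sum.cong[OF refl], rule sum.swap)
  also have "\<dots> = (\<Sum>p | p permutes {..j}. \<Sum>q | q permutes {..j}. of_int (sign p) * of_int (sign q) *
       (\<Prod>b\<le>j. hinner (u (inv p b)) (v (inv q b))))"
    unfolding hinner_def by (subst prod_sum_PiE) (auto simp: sum_distrib_left)
  finally show ?thesis .
qed

lemma wedge_inner_orthonormal:
  fixes e :: "nat \<Rightarrow> complex ^ 'm::finite"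
  assumes on: "\<And>c d. c \<le> j \<Longrightarrow> d \<le> j \<Longrightarrow> hinner (e c) (e d) = (if c = d then 1 else 0)"
  shows "(\<Sum>s\<in>PiE {..j} (\<lambda>_. UNIV). wedge j e s * cnj (wedge j e s)) = fact (Suc j)"
proof -
  have pr: "(\<Prod>b\<le>j. hinner (e (inv p b)) (e (inv q b))) = (if p = q then 1 else 0)"
    if p: "p permutes {..j}" and q: "q permutes {..j}" for p q
  proof (cases "p = q")
    case True
    have "inv p b \<le> j" if "b \<le> j" for b
      using permutes_in_image[OF permutes_inv[OF p], of b] that by simp
    then show ?thesis using True on by simp
  next
    case False
    then obtain b where b: "inv p b \<noteq> inv q b"
      by (metis p q permutes_inv_inv ext)
    have bj: "b \<le> j"
    proof (rule ccontr)
      assume "\<not> b \<le> j"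
      then have "inv p b = b" "inv q b = b"
        using permutes_not_in[OF permutes_inv[OF p], of b] permutes_not_in[OF permutes_inv[OF q], of b] by auto
      then show False using b by simp
    qed
    have "inv p b \<le> j" "inv q b \<le> j"
      using permutes_in_image[OF permutes_inv[OF p], of b] permutes_in_image[OF permutes_inv[OF q], of b] bj by auto
    then have "hinner (e (inv p b)) (e (inv q b)) = 0" using on b by simp
    then have "(\<Prod>b\<le>j. hinner (e (inv p b)) (e (inv q b))) = 0" using bj by (intro prod_zero) auto
    then show ?thesis using False by simp
  qed
  have "(\<Sum>s\<in>PiE {..j} (\<lambda>_. UNIV). wedge j e s * cnj (wedge j e s)) =
     (\<Sum>p | p permutes {..j}. \<Sum>q | q permutes {..j}. if q = p then 1 else 0)"
    unfolding wedge_inner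
    by (intro sum.cong refl) (auto simp: pr simp flip: of_int_mult)
  also have "\<dots> = of_nat (card {p. p permutes {..j}})"
    by (simp add: finite_permutations)
  also have "\<dots> = fact (Suc j)" by (simp add: card_permutations algebra_simps)
  finally show ?thesis .
qed

lemma wedge_inner_zero:
  fixes u v :: "nat \<Rightarrow> complex ^ 'm::finite"
  assumes k: "k \<le> j" and orth: "\<And>b. b \<le> j \<Longrightarrow> hinner (u k) (v b) = 0"
  shows "(\<Sum>s\<in>PiE {..j} (\<lambda>_. UNIV). wedge j u s * cnj (wedge j v s)) = 0"
proof -
  have pr0: "(\<Prod>b\<le>j. hinner (u (inv p b)) (v (inv q b))) = 0"
    if p: "p permutes {..j}" and q: "q permutes {..j}" for p q
  proof (rule prod_zero)
    have pk: "p k \<le> j" using permutes_in_image[OF p, of k] k by simp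
    then have "inv q (p k) \<le> j" using permutes_in_image[OF permutes_inv[OF q], of "p k"] by simp
    then show "\<exists>b\<in>{..j}. hinner (u (inv p b)) (v (inv q b)) = 0"
      using pk orth by (intro bexI[of _ "p k"]) (auto simp: permutes_inverses[OF p])
  qed auto
  show ?thesis unfolding wedge_inner by (auto intro!: sum.neutral simp: pr0 simp del: prod_zero_iff)
qed

text \<open>When \<open>v (Suc a)\<close> is the derivative of \<open>v a\<close>, differentiating any row but the last one
produces two equal rows.\<close>

lemma wedge_derivative:
  fixes v :: "nat \<Rightarrow> complex \<Rightarrow> complex ^ 'm"
  assumes "\<And>a k. ((\<lambda>z. v a z $ k) has_field_derivative v (Suc a) z $ k) (at z)"
  shows "((\<lambda>z. wedge j (\<lambda>a. v a z) s) has_field_derivative wedge j ((\<lambda>a. v a z)(j := v (Suc j) z)) s) (at z)"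
proof -
  have split: "(\<Prod>a\<le>j. ((\<lambda>a. v a z)(i := x)) a $ s (p a)) = x $ s (p i) * (\<Prod>a\<in>{..j} - {i}. v a z $ s (p a))"
    if "i \<le> j" for x p i
    using that by (subst prod.remove[of _ i]) (auto intro!: arg_cong2[where f = "(*)"] prod.cong)
  have "((\<lambda>z. wedge j (\<lambda>a. v a z) s) has_field_derivative
     (\<Sum>p | p permutes {..j}. of_int (sign p) * (\<Sum>i\<le>j. v (Suc i) z $ s (p i) * (\<Prod>a\<in>{..j} - {i}. v a z $ s (p a))))) (at z)"
    unfolding wedge_def by (intro DERIV_sum DERIV_cmult has_field_derivative_prod assms)
  also have "(\<Sum>p | p permutes {..j}. of_int (sign p) * (\<Sum>i\<le>j. v (Suc i) z $ s (p i) * (\<Prod>a\<in>{..j} - {i}. v a z $ s (p a))))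
     = (\<Sum>p | p permutes {..j}. \<Sum>i\<le>j. of_int (sign p) * (\<Prod>a\<le>j. ((\<lambda>a. v a z)(i := v (Suc i) z)) a $ s (p a)))"
    unfolding sum_distrib_left by (intro sum.cong refl) (simp only: split atMost_iff)
  also have "\<dots> = (\<Sum>i\<le>j. wedge j ((\<lambda>a. v a z)(i := v (Suc i) z)) s)"
    unfolding wedge_def by (rule sum.swap)
  also have "\<dots> = (\<Sum>i\<le>j. if i = j then wedge j ((\<lambda>a. v a z)(j := v (Suc j) z)) s else 0)"
    by (intro sum.cong refl) (auto intro!: wedge_alternating[where a = "_::nat" and b = "Suc _"])
  also have "\<dots> = wedge j ((\<lambda>a. v a z)(j := v (Suc j) z)) s" by simp
  finally show ?thesis .
qed

text \<open>The infinitesimal Pluecker formula. If \<open>v a\<close> is the \<open>a\<close>-th derivative of a curve, then \<open>H\<close> is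
its \<open>j\<close>-th osculating wedge product and \<open>H'\<close> the derivative of \<open>H\<close>. Modulo \<open>H\<close>, the latter is a
multiple of the wedge product with \<open>e (Suc j)\<close> in place of \<open>e j\<close>, which is orthogonal to \<open>H\<close>
and of the same length.\<close>

lemma wedge_log_curvature:
  fixes e v :: "nat \<Rightarrow> complex ^ 'm::finite"
  assumes on: "\<And>c d. c \<le> Suc j \<Longrightarrow> d \<le> Suc j \<Longrightarrow> hinner (e c) (e d) = (if c = d then 1 else 0)"
    and v: "\<And>a. a \<le> Suc j \<Longrightarrow> v a = (\<Sum>c\<le>a. M a c *s e c)"
  defines "I \<equiv> PiE {..j} (\<lambda>_. UNIV :: 'm set)"
  defines "H \<equiv> wedge j v" and "H' \<equiv> wedge j (v(j := v (Suc j)))"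
  defines "A \<equiv> (\<Sum>s\<in>I. H s * cnj (H s))" and "B \<equiv> (\<Sum>s\<in>I. H' s * cnj (H s))"
    and "D \<equiv> (\<Sum>s\<in>I. H' s * cnj (H' s))"
  shows "A = fact (Suc j) * of_real ((\<Prod>a\<le>j. cmod (M a a))\<^sup>2)"
    and "A \<noteq> 0 \<Longrightarrow> (A * D - B * cnj B) / A\<^sup>2 = of_real ((cmod (M (Suc j) (Suc j)))\<^sup>2 / (cmod (M j j))\<^sup>2)"
proof -
  define E where "E = wedge j e"
  define E' where "E' = wedge j (e(j := e (Suc j)))"
  define P where "P = (\<Prod>a<j. M a a)"
  define x where "x = M (Suc j) j"
  define y where "y = M (Suc j) (Suc j)"
  define C :: complex where "C = fact (Suc j)"
  have H: "H s = P * M j j * E s" for s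
  proof -
    have "H s = (\<Prod>a<Suc j. M a a) * wedge j (\<lambda>a. if a < Suc j then e a else v a) s"
      unfolding H_def by (rule wedge_triangular) (use v in auto)
    also have "wedge j (\<lambda>a. if a < Suc j then e a else v a) s = E s"
      unfolding E_def by (rule wedge_cong) auto
    finally show ?thesis by (simp add: P_def)
  qed
  have H': "H' s = P * (x * E s + y * E' s)" for s
  proof -
    let ?v' = "v(j := v (Suc j))"
    have "H' s = (\<Prod>a<j. M a a) * wedge j (\<lambda>a. if a < j then e a else ?v' a) s"
      unfolding H'_def by (rule wedge_triangular) (use v in auto)
    also have "wedge j (\<lambda>a. if a < j then e a else ?v' a) s = wedge j (e(j := \<Sum>c\<le>Suc j. M (Suc j) c *s e c)) s"
      using v[of "Suc j"] by (intro wedge_cong) auto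
    also have "\<dots> = (\<Sum>c\<le>Suc j. M (Suc j) c * wedge j (e(j := e c)) s)"
      by (rule wedge_linear) simp
    also have "\<dots> = (\<Sum>c\<in>{j, Suc j}. M (Suc j) c * wedge j (e(j := e c)) s)"
    proof (rule sum.mono_neutral_right)
      show "\<forall>c\<in>{..Suc j} - {j, Suc j}. M (Suc j) c * wedge j (e(j := e c)) s = 0"
      proof
        fix c assume "c \<in> {..Suc j} - {j, Suc j}"
        then have "wedge j (e(j := e c)) s = 0" by (intro wedge_alternating[of c j j]) auto
        then show "M (Suc j) c * wedge j (e(j := e c)) s = 0" by simp
      qed
    qed auto
    also have "\<dots> = x * E s + y * E' s" by (simp add: x_def y_def E_def E'_def)
    finally show ?thesis by (simp add: P_def)
  qed
  have EE: "(\<Sum>s\<in>I. E s * cnj (E s)) = C"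
    unfolding E_def I_def C_def by (rule wedge_inner_orthonormal) (use on in auto)
  have EE': "(\<Sum>s\<in>I. E' s * cnj (E' s)) = C"
    unfolding E'_def I_def C_def by (rule wedge_inner_orthonormal) (use on in auto)
  have E'E: "(\<Sum>s\<in>I. E' s * cnj (E s)) = 0"
    unfolding E_def E'_def I_def by (rule wedge_inner_zero[of j]) (use on in auto)
  have EE'0: "(\<Sum>s\<in>I. E s * cnj (E' s)) = 0"
    unfolding E_def E'_def I_def by (rule wedge_inner_zero[of j]) (use on in auto)
  have A: "A = P * cnj P * (M j j * cnj (M j j)) * C"
  proof -
    have "A = P * cnj P * (M j j * cnj (M j j)) * (\<Sum>s\<in>I. E s * cnj (E s))"
      unfolding A_def H sum_distrib_left by (intro sum.cong refl) (simp add: mult_ac)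
    then show ?thesis unfolding EE .
  qed
  have B: "B = P * cnj P * x * cnj (M j j) * C"
  proof -
    have "B = P * cnj P * cnj (M j j) * (x * (\<Sum>s\<in>I. E s * cnj (E s)) + y * (\<Sum>s\<in>I. E' s * cnj (E s)))"
      unfolding B_def H H' sum_distrib_left distrib_left sum.distrib[symmetric]
      by (intro sum.cong refl) (simp add: algebra_simps)
    then show ?thesis unfolding EE E'E by simp
  qed
  have D: "D = P * cnj P * (x * cnj x + y * cnj y) * C"
  proof -
    have "D = P * cnj P * (x * cnj x * (\<Sum>s\<in>I. E s * cnj (E s)) + y * cnj x * (\<Sum>s\<in>I. E' s * cnj (E s))
       + x * cnj y * (\<Sum>s\<in>I. E s * cnj (E' s)) + y * cnj y * (\<Sum>s\<in>I. E' s * cnj (E' s)))"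
      unfolding D_def H' sum_distrib_left distrib_left sum.distrib[symmetric]
      by (intro sum.cong refl) (simp add: algebra_simps)
    then show ?thesis unfolding EE E'E EE'0 EE' by (simp add: algebra_simps)
  qed
  have sq: "z * cnj z = of_real ((cmod z)\<^sup>2)" for z by (simp add: complex_norm_square del: of_real_power)
  have Pr: "(\<Prod>a\<le>j. cmod (M a a)) = cmod P * cmod (M j j)"
    by (simp add: P_def prod_norm norm_mult lessThan_Suc_atMost[symmetric])
  show "A = fact (Suc j) * of_real ((\<Prod>a\<le>j. cmod (M a a))\<^sup>2)"
    unfolding A sq Pr C_def by (simp add: power_mult_distrib mult_ac)
  assume A0: "A \<noteq> 0"
  then have nz: "P \<noteq> 0" "M j j \<noteq> 0" "C \<noteq> 0" by (auto simp: A)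
  have cC: "cnj C = C" by (simp add: C_def)
  have "A * D - B * cnj B = A\<^sup>2 * (y * cnj y / (M j j * cnj (M j j)))"
    unfolding A B D using nz by (simp add: cC field_simps power2_eq_square)
  then have "(A * D - B * cnj B) / A\<^sup>2 = y * cnj y / (M j j * cnj (M j j))" using A0 by simp
  then show "(A * D - B * cnj B) / A\<^sup>2 = of_real ((cmod (M (Suc j) (Suc j)))\<^sup>2 / (cmod (M j j))\<^sup>2)"
    unfolding sq y_def by simp
qed

section \<open>Second fundamental forms in orthogonal frames\<close>

lemma bounded_linear_smult: "bounded_linear (\<lambda>x. c *s (x :: complex ^ 'm::finite))"
  by (intro linear_conv_bounded_linear[THEN iffD1] linearI)
     (auto simp: vec_eq_iff algebra_simps scaleR_conv_of_real)

lemma bounded_bilinear_hinner: "bounded_bilinear (hinner :: complex ^ 'm::finite \<Rightarrow> _)"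
proof -
  have "hinner (a *\<^sub>R x) y = a *\<^sub>R hinner x y" "hinner x (a *\<^sub>R y) = a *\<^sub>R hinner x y" for a and x y :: "complex ^ 'm"
    by (simp_all add: hinner_def scaleR_sum_right)
  then have "bilinear (hinner :: complex ^ 'm \<Rightarrow> _)"
    unfolding bilinear_def by (auto intro!: linearI simp: hinner_add_left hinner_add_right)
  then show ?thesis by (simp add: bilinear_conv_bounded_bilinear)
qed

lemma bounded_bilinear_smult: "bounded_bilinear (\<lambda>c x. c *s (x :: complex ^ 'm::finite))"
proof -
  have "bilinear (\<lambda>c x. c *s (x :: complex ^ 'm))"
    unfolding bilinear_def
    by (auto intro!: linearI simp: vec_eq_iff algebra_simps)
  then show ?thesis by (simp add: bilinear_conv_bounded_bilinear)
qed

lemmas has_derivative_hinner = bounded_bilinear.FDERIV[OF bounded_bilinear_hinner]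
lemmas has_derivative_smult = bounded_bilinear.FDERIV[OF bounded_bilinear_smult]

lemma Ck_on_cong:
  assumes "open W" "\<And>w. w \<in> W \<Longrightarrow> s w = t w" "Ck_on k W s"
  shows "Ck_on k W t"
  using assms(2,3)
proof (induction k arbitrary: s t)
  case 0
  then show ?case using continuous_on_cong[of W W s t] by simp
next
  case (Suc k)
  have d: "s differentiable at w" if "w \<in> W" for w
    using Suc.prems(2) that assms(1) by (simp add: differentiable_on_eq_differentiable_at)
  have eq: "frechet_derivative s (at w) = frechet_derivative t (at w)" if "w \<in> W" for w
    using frechet_derivative_transform_within_open[OF d[OF that] assms(1) that] Suc.prems(1) by blast
  have dt: "t differentiable at w" if "w \<in> W" for w
  proof -
    have "(s has_derivative frechet_derivative s (at w)) (at w)" using d[OF that] frechet_derivative_works by blast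
    then have "(t has_derivative frechet_derivative s (at w)) (at w)"
      by (rule has_derivative_transform_within_open[OF _ assms(1) that]) (use Suc.prems(1) in auto)
    then show ?thesis by (auto simp: differentiable_def)
  qed
  have "Ck_on k W (\<lambda>w. frechet_derivative t (at w) v)" for v
    by (rule Suc.IH[of "\<lambda>w. frechet_derivative s (at w) v"]) (use eq Suc.prems(2) in auto)
  then show ?case using dt assms(1) by (simp add: differentiable_on_eq_differentiable_at)
qed

lemma Ck_on_bounded_linear:
  assumes T: "bounded_linear T" and W: "open W" and s: "Ck_on k W s"
  shows "Ck_on k W (\<lambda>w. T (s w))"
  using s
proof (induction k arbitrary: s)
  case 0
  then show ?case using bounded_linear.continuous_on[OF T] by simp
next
  case (Suc k)
  have d: "(s has_derivative frechet_derivative s (at w)) (at w)" if "w \<in> W" for w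
    using Suc.prems that W by (simp add: differentiable_on_eq_differentiable_at frechet_derivative_works)
  have dT: "((\<lambda>w. T (s w)) has_derivative (\<lambda>h. T (frechet_derivative s (at w) h))) (at w)" if "w \<in> W" for w
    by (rule bounded_linear.has_derivative[OF T d[OF that]])
  have "Ck_on k W (\<lambda>w. frechet_derivative (\<lambda>w. T (s w)) (at w) v)" for v
  proof (rule Ck_on_cong[OF W])
    show "T (frechet_derivative s (at w) v) = frechet_derivative (\<lambda>w. T (s w)) (at w) v" if "w \<in> W" for w
      using frechet_derivative_at[OF dT[OF that]] by metis
    show "Ck_on k W (\<lambda>w. T (frechet_derivative s (at w) v))"
      using Suc.IH Suc.prems by simp
  qed
  moreover have "(\<lambda>w. T (s w)) differentiable_on W"
    using dT W by (auto simp: differentiable_on_eq_differentiable_at differentiable_def)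
  ultimately show ?case by simp
qed

lemma smooth_on_smult: "smooth_on W s \<Longrightarrow> open W \<Longrightarrow> smooth_on W (\<lambda>w. c *s (s w :: complex ^ 'm::finite))"
  unfolding smooth_on_def using Ck_on_bounded_linear[OF bounded_linear_smult] by blast

lemma smooth_on_has_derivative:
  assumes "smooth_on W s" "open W" "w \<in> W"
  shows "(s has_derivative frechet_derivative s (at w)) (at w)"
proof -
  have "Ck_on (Suc 0) W s" using assms(1) unfolding smooth_on_def by blast
  then show ?thesis
    using assms(2,3) by (simp add: differentiable_on_eq_differentiable_at frechet_derivative_works)
qed

lemma smooth_on_continuous_derivative:
  assumes "smooth_on W s" shows "continuous_on W (\<lambda>w. frechet_derivative s (at w) v)"
proof -
  have "Ck_on (Suc 0) W s" using assms(1) unfolding smooth_on_def by blast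
  then show ?thesis by simp
qed

lemma smooth_on_continuous: "smooth_on W s \<Longrightarrow> continuous_on W s"
  unfolding smooth_on_def by (metis Ck_on.simps(1))

lemma dvec_eq: "(s has_derivative D) (at w) \<Longrightarrow> dvec X s w = fst X *s D 1 + snd X *s D \<i>"
  using frechet_derivative_at[of s D w] by (simp add: dvec_def)

lemma span_single: "vec.span {s} = range (\<lambda>c. c *s s)" for s :: "complex ^ 'm"
  by (rule vec.span_singleton)

lemma hproj_eqI:
  assumes closed: "\<And>x y. x \<in> L \<Longrightarrow> y \<in> L \<Longrightarrow> x - y \<in> L"
    and u: "u \<in> L" "v - u \<in> horth L"
  shows "hproj L v = u"
  unfolding hproj_def
proof (rule the_equality)
  show "u \<in> L \<and> v - u \<in> horth L" using u by simp
  fix x assume x: "x \<in> L \<and> v - x \<in> horth L"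
  have "u - x \<in> L" using closed u x by blast
  then have "hinner (v - u) (u - x) = 0" "hinner (v - x) (u - x) = 0"
    using u(2) x by (auto simp: horth_def)
  then have "hinner (u - x) (u - x) = 0"
    by (simp add: hinner_diff_left)
  then show "x = u" by simp
qed

definition proj_coef :: "complex ^ 'm \<Rightarrow> complex ^ 'm \<Rightarrow> complex" where
  "proj_coef v s = hinner v s / hinner s s"

lemma proj_coef_add: "proj_coef (x + y) s = proj_coef x s + proj_coef y s"
  by (simp add: proj_coef_def hinner_add_left add_divide_distrib)

lemma proj_coef_scale: "proj_coef (c *s x) s = c * proj_coef x s"
  by (simp add: proj_coef_def hinner_scale_left)

lemma hproj_span:
  assumes "s \<noteq> 0" shows "hproj (vec.span {s}) v = proj_coef v s *s s"
proof (rule hproj_eqI)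
  show "v - proj_coef v s *s s \<in> horth (vec.span {s})"
    using assms by (auto simp: horth_def span_single hinner_scale_right hinner_diff_left hinner_scale_left proj_coef_def)
qed (auto intro: vec.span_diff vec.span_scale vec.span_base)

lemma hproj_horth:
  assumes "s \<noteq> 0" shows "hproj (horth (vec.span {s})) v = v - proj_coef v s *s s"
proof (rule hproj_eqI)
  show "v - proj_coef v s *s s \<in> horth (vec.span {s})"
    using assms by (auto simp: horth_def span_single hinner_scale_right hinner_diff_left hinner_scale_left proj_coef_def)
  show "v - (v - proj_coef v s *s s) \<in> horth (horth (vec.span {s}))"
  proof -
    have "hinner s u = 0" if "u \<in> horth (vec.span {s})" for u
      using that hinner_eq_0_commute vec.span_base[of s "{s}"] unfolding horth_def by blast
    then show ?thesis by (simp add: horth_def hinner_scale_left)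
  qed
qed (auto simp: horth_def hinner_diff_left)

text \<open>This evaluates the definite description in \<open>second_fund\<close>. A competing section through the same
value is \<open>\<mu> * s\<close> with the same \<open>\<mu> w\<close>, and the derivative of \<open>\<mu>\<close> contributes a multiple of
\<open>s w\<close>, which \<open>P\<close> annihilates. The projection is passed as a function \<open>P\<close> so
that the lemma covers lines as well as orthogonal complements of lines.\<close>

lemma second_fund_frame:
  fixes s :: "complex \<Rightarrow> complex ^ 'm::finite" and P :: "complex ^ 'm \<Rightarrow> complex ^ 'm"
  assumes W: "open W" "smooth_on W s" and s: "\<And>v. v \<in> W \<Longrightarrow> s v \<noteq> 0 \<and> \<psi> v = vec.span {s v}"
    and w: "w \<in> W"
    and P: "\<And>x. hproj L x = P x" and Padd: "\<And>x y. P (x + y) = P x + P y"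
    and Pscale: "\<And>c x. P (c *s x) = c *s P x" and Ps: "P (s w) = 0"
  shows "second_fund \<psi> L X w *v v = proj_coef v (s w) *s P (dvec X s w)"
proof -
  have sw: "s w \<noteq> 0" using s[OF w] by simp
  have val: "(THE u. \<exists>W t. local_section \<psi> W t \<and> w \<in> W \<and> t w = hproj (\<psi> w) v \<and> u = hproj L (dvec X t w))
      = proj_coef v (s w) *s P (dvec X s w)" for v
  proof (rule the_equality)
    let ?c = "proj_coef v (s w)"
    have Ds: "(s has_derivative frechet_derivative s (at w)) (at w)"
      by (rule smooth_on_has_derivative[OF W(2,1) w])
    have hp: "hproj (\<psi> w) v = ?c *s s w" using s[OF w] hproj_span by metis
    have "local_section \<psi> W (\<lambda>x. ?c *s s x)"
      unfolding local_section_def using W s smooth_on_smult by (auto simp: span_single)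
    moreover have "dvec X (\<lambda>x. ?c *s s x) w = ?c *s dvec X s w"
      using dvec_eq[OF bounded_linear.has_derivative[OF bounded_linear_smult Ds, of ?c], of X]
      by (simp add: dvec_def vec_eq_iff algebra_simps)
    ultimately show "\<exists>W t. local_section \<psi> W t \<and> w \<in> W \<and> t w = hproj (\<psi> w) v \<and>
        ?c *s P (dvec X s w) = hproj L (dvec X t w)"
      using w hp by (intro exI[of _ W] exI[of _ "\<lambda>x. ?c *s s x"]) (simp add: P Pscale)
    fix u assume "\<exists>W t. local_section \<psi> W t \<and> w \<in> W \<and> t w = hproj (\<psi> w) v \<and> u = hproj L (dvec X t w)"
    then obtain V t where t: "local_section \<psi> V t" "w \<in> V" "t w = ?c *s s w" "u = P (dvec X t w)"
      by (auto simp: hp P)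
    have V: "open V" "smooth_on V t" "\<And>x. x \<in> V \<Longrightarrow> t x \<in> \<psi> x" using t(1) by (auto simp: local_section_def)
    have Dt: "(t has_derivative frechet_derivative t (at w)) (at w)"
      by (rule smooth_on_has_derivative[OF V(2,1) t(2)])
    define \<mu> where "\<mu> = (\<lambda>x. hinner (t x) (s x) / hinner (s x) (s x))"
    have "(\<mu> has_derivative (\<lambda>h. - hinner (t w) (s w) *
        (inverse (hinner (s w) (s w)) * (hinner (s w) (frechet_derivative s (at w) h) + hinner (frechet_derivative s (at w) h) (s w)) * inverse (hinner (s w) (s w)))
        + (hinner (t w) (frechet_derivative s (at w) h) + hinner (frechet_derivative t (at w) h) (s w)) / hinner (s w) (s w))) (at w)"
      unfolding \<mu>_def using sw by (intro has_derivative_divide has_derivative_hinner Dt Ds) simp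
    then obtain M where M: "(\<mu> has_derivative M) (at w)" by blast
    have \<mu>w: "\<mu> w = ?c" using sw by (simp add: \<mu>_def t(3) hinner_scale_left)
    have "((\<lambda>x. \<mu> x *s s x) has_derivative (\<lambda>h. \<mu> w *s frechet_derivative s (at w) h + M h *s s w)) (at w)"
      by (rule has_derivative_smult[OF M Ds])
    then have "(t has_derivative (\<lambda>h. ?c *s frechet_derivative s (at w) h + M h *s s w)) (at w)"
      unfolding \<mu>w
    proof (rule has_derivative_transform_within_open[of _ _ _ _ "V \<inter> W"])
      show "\<mu> x *s s x = t x" if "x \<in> V \<inter> W" for x
      proof -
        have "t x \<in> range (\<lambda>c. c *s s x)" using V(3)[of x] s[of x] that by (simp add: span_single)
        then obtain d where "t x = d *s s x" by blast
        then show ?thesis using s[of x] that by (simp add: \<mu>_def hinner_scale_left)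
      qed
    qed (use V W w t in auto)
    from dvec_eq[OF this, of X]
    have "dvec X t w = ?c *s dvec X s w + (fst X * M 1 + snd X * M \<i>) *s s w"
      by (simp add: dvec_def vec_eq_iff algebra_simps)
    then have "P (dvec X t w) = ?c *s P (dvec X s w)"
      by (simp add: Padd Pscale Ps)
    then show "u = ?c *s P (dvec X s w)" using t(4) by simp
  qed
  have lin: "Vector_Spaces.linear (*s) (*s) (\<lambda>v. proj_coef v (s w) *s P (dvec X s w))"
    unfolding Vector_Spaces.linear_iff
    by (auto simp: proj_coef_add proj_coef_scale vec.scale_left_distrib vec.vector_space_axioms)
  show ?thesis
    unfolding second_fund_def val by (rule matrix_works[OF lin])
qed

lemma trace_rank_one:
  fixes A :: "complex ^ 'm ^ 'm::finite"
  assumes A: "\<And>v. A *v v = proj_coef v s *s u" and s: "s \<noteq> 0"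
  shows "trace (A ** cadjoint A) = hinner u u / hinner s s"
proof -
  have ent: "A $ k $ l = cnj (s $ l) / hinner s s * u $ k" for k l
  proof -
    have "A $ k $ l = (A *v axis l 1) $ k"
      by (simp add: matrix_vector_mult_def axis_def if_distrib cong: if_cong)
    also have "\<dots> = proj_coef (axis l 1) s * u $ k" by (simp add: A)
    also have "proj_coef (axis l 1) s = cnj (s $ l) / hinner s s"
      by (simp add: proj_coef_def hinner_def axis_def if_distrib if_distribR cong: if_cong)
    finally show ?thesis .
  qed
  have "trace (A ** cadjoint A) = (\<Sum>k\<in>UNIV. \<Sum>l\<in>UNIV. A $ k $ l * cnj (A $ k $ l))"
    by (simp add: trace_def matrix_matrix_mult_def cadjoint_def)
  also have "\<dots> = (\<Sum>k\<in>UNIV. \<Sum>l\<in>UNIV. (u $ k * cnj (u $ k)) * (s $ l * cnj (s $ l)) / (hinner s s * hinner s s))"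
    unfolding ent by (intro sum.cong refl) (simp add: hinner_cnj mult_ac)
  also have "\<dots> = hinner u u * hinner s s / (hinner s s * hinner s s)"
    by (simp add: hinner_def sum_product sum_divide_distrib)
  finally show ?thesis using s by simp
qed

text \<open>The flag in a coordinate domain, with a nowhere vanishing section \<open>s j\<close> of each line. The sections
are not normalised, as only their first derivatives will be used.\<close>

locale orthogonal_frames =
  fixes n :: nat and W :: "complex set" and s :: "nat \<Rightarrow> complex \<Rightarrow> complex ^ 'm::finite"
    and \<Psi> :: "nat \<Rightarrow> complex \<Rightarrow> (complex ^ 'm) set" and \<iota> :: "'m \<Rightarrow> nat"
  assumes W: "open W"
    and smooth: "\<And>j. j \<le> n \<Longrightarrow> smooth_on W (s j)"
    and nz: "\<And>j w. j \<le> n \<Longrightarrow> w \<in> W \<Longrightarrow> s j w \<noteq> 0"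
    and \<Psi>: "\<And>j w. j \<le> n \<Longrightarrow> w \<in> W \<Longrightarrow> \<Psi> j w = vec.span {s j w}"
    and orth: "\<And>i j w. i \<le> n \<Longrightarrow> j \<le> n \<Longrightarrow> i \<noteq> j \<Longrightarrow> w \<in> W \<Longrightarrow> hinner (s i w) (s j w) = 0"
    and \<iota>: "bij_betw \<iota> UNIV {..n}"
begin

lemma second_fund_component:
  assumes i: "i \<le> n" and j: "j \<le> n" and ij: "i \<noteq> j" and w: "w \<in> W"
  shows "second_fund (\<Psi> i) (\<Psi> j w) X w *v v = proj_coef v (s i w) *s (proj_coef (dvec X (s i) w) (s j w) *s s j w)"
proof (rule second_fund_frame[OF W smooth[OF i] _ w, where P = "\<lambda>x. proj_coef x (s j w) *s s j w"])
  show "hproj (\<Psi> j w) x = proj_coef x (s j w) *s s j w" for x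
    unfolding \<Psi>[OF j w] by (rule hproj_span[OF nz[OF j w]])
  show "proj_coef (s i w) (s j w) *s s j w = 0"
    by (simp add: proj_coef_def orth[OF i j ij w])
qed (use nz i \<Psi> in \<open>auto simp: proj_coef_add proj_coef_scale vec.scale_left_distrib\<close>)

lemma second_fund_zero:
  assumes "i \<le> n" "j \<le> n" "i \<noteq> j" "w \<in> W" "second_fund (\<Psi> i) (\<Psi> j w) X w = 0"
  shows "hinner (dvec X (s i) w) (s j w) = 0"
proof -
  have "proj_coef (s i w) (s i w) *s (proj_coef (dvec X (s i) w) (s j w) *s s j w) = 0"
    unfolding second_fund_component[OF assms(1-4), symmetric] assms(5) by simp
  moreover have "proj_coef (s i w) (s i w) = 1" using nz[OF assms(1,4)] by (simp add: proj_coef_def)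
  ultimately have "proj_coef (dvec X (s i) w) (s j w) = 0" using nz[OF assms(2,4)] by simp
  then show ?thesis using nz[OF assms(2,4)] by (simp add: proj_coef_def)
qed

lemma A'_frame:
  assumes i: "i \<le> n" and w: "w \<in> W"
  shows "A' (\<Psi> i) w *v v = proj_coef v (s i w) *s
     (dvec del_z (s i) w - proj_coef (dvec del_z (s i) w) (s i w) *s s i w)"
  unfolding A'_def
proof (rule second_fund_frame[OF W smooth[OF i] _ w, where P = "\<lambda>x. x - proj_coef x (s i w) *s s i w"])
  show "hproj (horth (\<Psi> i w)) x = x - proj_coef x (s i w) *s s i w" for x
    unfolding \<Psi>[OF i w] by (rule hproj_horth[OF nz[OF i w]])
  show "s i w - proj_coef (s i w) (s i w) *s s i w = 0"
    using nz[OF i w] by (simp add: proj_coef_def)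
qed (use nz i \<Psi> in \<open>auto simp: proj_coef_add proj_coef_scale vec.scale_left_distrib vec.scale_right_diff_distrib\<close>)

definition e where "e c w = of_real (inverse (norm (s c w))) *s s c w"

lemma e_orthonormal:
  assumes "c \<le> n" "d \<le> n" "w \<in> W"
  shows "hinner (e c w) (e d w) = (if c = d then 1 else 0)"
  using orth[OF assms(1,2) _ assms(3)] nz[OF assms(1,3)]
  by (auto simp: e_def hinner_scale_left hinner_scale_right hinner_self power2_eq_square field_simps)

lemma expand_e:
  assumes w: "w \<in> W" shows "v = (\<Sum>c\<le>n. hinner v (e c w) *s e c w)"
  by (rule orthonormal_complete[OF \<iota>]) (use e_orthonormal[OF _ _ w] in auto)

lemma expand_s:
  assumes w: "w \<in> W" shows "v = (\<Sum>c\<le>n. proj_coef v (s c w) *s s c w)"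
proof -
  have "hinner v (e c w) *s e c w = proj_coef v (s c w) *s s c w" for c
    by (simp add: e_def hinner_scale_right proj_coef_def hinner_self vec.scale_scale divide_inverse
        power2_eq_square mult_ac)
  then show ?thesis using expand_e[OF w, of v] by simp
qed

end

locale primitive_frames = orthogonal_frames +
  assumes prim: "\<And>i j w. i < n \<Longrightarrow> j \<le> n \<Longrightarrow> j \<noteq> i \<Longrightarrow> j \<noteq> Suc i \<Longrightarrow> w \<in> W \<Longrightarrow>
    hinner (dvec del_z (s i) w) (s j w) = 0"
begin

text \<open>Up to the lengths of the frame vectors, the component of \<open>A' (\<Psi> i)\<close> in \<open>\<Psi> (Suc i)\<close>.\<close>

definition b where "b i w = hinner (dvec del_z (s i) w) (s (Suc i) w)"

lemma A'_primitive:
  assumes i: "i < n" and w: "w \<in> W"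
  shows "A' (\<Psi> i) w *v v = proj_coef v (s i w) *s (proj_coef (dvec del_z (s i) w) (s (Suc i) w) *s s (Suc i) w)"
proof -
  let ?d = "dvec del_z (s i) w"
  have "?d = (\<Sum>c\<le>n. proj_coef ?d (s c w) *s s c w)" by (rule expand_s[OF w])
  also have "\<dots> = (\<Sum>c\<in>{i, Suc i}. proj_coef ?d (s c w) *s s c w)"
    using i prim[OF i _ _ _ w] by (intro sum.mono_neutral_right) (auto simp: proj_coef_def)
  finally have "?d - proj_coef ?d (s i w) *s s i w = proj_coef ?d (s (Suc i) w) *s s (Suc i) w"
    by (simp add: algebra_simps)
  then show ?thesis using A'_frame[of i w v] i w by simp
qed

lemma gamma_frame:
  assumes i: "i < n" and w: "w \<in> W"
  shows "gamma (\<Psi> i) w = (cmod (b i w))\<^sup>2 / ((norm (s i w))\<^sup>2 * (norm (s (Suc i) w))\<^sup>2)"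
proof -
  let ?d = "dvec del_z (s i) w" and ?t = "s (Suc i) w"
  have nzi: "s i w \<noteq> 0" "?t \<noteq> 0" using nz i w by auto
  have "trace (A' (\<Psi> i) w ** cadjoint (A' (\<Psi> i) w)) = hinner (proj_coef ?d ?t *s ?t) (proj_coef ?d ?t *s ?t) / hinner (s i w) (s i w)"
    by (rule trace_rank_one[OF A'_primitive[OF i w] nzi(1)])
  also have "\<dots> = b i w * cnj (b i w) / (hinner (s i w) (s i w) * hinner ?t ?t)"
  proof -
    have "hinner (proj_coef ?d ?t *s ?t) (proj_coef ?d ?t *s ?t) = proj_coef ?d ?t * cnj (proj_coef ?d ?t) * hinner ?t ?t"
      by (simp add: hinner_scale_left hinner_scale_right)
    also have "\<dots> = b i w * cnj (b i w) / hinner ?t ?t"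
      using nzi by (simp add: proj_coef_def b_def hinner_cnj)
    finally show ?thesis by simp
  qed
  also have "\<dots> = of_real ((cmod (b i w))\<^sup>2 / ((norm (s i w))\<^sup>2 * (norm ?t)\<^sup>2))"
    by (simp add: hinner_self complex_norm_square del: of_real_power)
  finally show ?thesis by (simp add: gamma_def)
qed

lemma b_nonzero:
  assumes i: "i < n" and w: "w \<in> W" and im: "\<Psi> (Suc i) w = (\<lambda>v. A' (\<Psi> i) w *v v) ` \<Psi> i w"
  shows "b i w \<noteq> 0"
proof
  assume "b i w = 0"
  then have "A' (\<Psi> i) w *v v = 0" for v
    using A'_primitive[OF i w, of v] by (simp add: proj_coef_def b_def)
  then have "\<Psi> (Suc i) w \<subseteq> {0}" using im by auto
  moreover have "s (Suc i) w \<in> \<Psi> (Suc i) w" using \<Psi>[of "Suc i" w] i w vec.span_base by auto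
  ultimately show False using nz[of "Suc i" w] i w by auto
qed

lemma gamma_continuous:
  assumes i: "i < n" shows "continuous_on W (gamma (\<Psi> i))"
proof -
  have c: "continuous_on W (s j)" if "j \<le> n" for j using smooth_on_continuous[OF smooth[OF that]] .
  have "continuous_on W (\<lambda>w. dvec del_z (s i) w)"
    unfolding dvec_def using smooth_on_continuous_derivative[OF smooth[of i]] i
    by (intro continuous_intros bounded_linear.continuous_on[OF bounded_linear_smult]) auto
  then have "continuous_on W (\<lambda>w. (cmod (b i w))\<^sup>2 / ((norm (s i w))\<^sup>2 * (norm (s (Suc i) w))\<^sup>2))"
    unfolding b_def using c[of i] c[of "Suc i"] i nz
    by (intro continuous_intros bounded_bilinear.continuous_on[OF bounded_bilinear_hinner]) auto
  then show ?thesis using gamma_frame[OF i] continuous_on_cong by (metis (no_types, lifting))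
qed

end

section \<open>Derivatives of the holomorphic lift\<close>

locale holomorphic_frames = primitive_frames n W s \<Psi> \<iota>
    for n W and s :: "nat \<Rightarrow> complex \<Rightarrow> complex ^ 'm::finite" and \<Psi> \<iota> +
  fixes f :: "complex \<Rightarrow> complex ^ 'm"
  assumes f_hol: "\<And>k. (\<lambda>z. f z $ k) holomorphic_on W"
    and f_nz: "\<And>w. w \<in> W \<Longrightarrow> f w \<noteq> 0"
    and f_in: "\<And>w. w \<in> W \<Longrightarrow> f w \<in> \<Psi> 0 w"
begin

definition F where "F a z = (\<chi> k. (deriv ^^ a) (\<lambda>z. f z $ k) z)"

lemma F_0: "F 0 z = f z" by (simp add: F_def)

lemma F_component_deriv:
  "z \<in> W \<Longrightarrow> ((\<lambda>z. F a z $ k) has_field_derivative F (Suc a) z $ k) (at z)"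
  unfolding F_def using has_field_derivative_higher_deriv[OF f_hol W, of z a k] by simp

lemma F_has_derivative:
  assumes "z \<in> W" shows "(F a has_derivative (\<lambda>h. h *s F (Suc a) z)) (at z)"
proof -
  have "((\<lambda>z. F a z $ k) has_derivative (\<lambda>h. F (Suc a) z $ k * h)) (at z)" for k
    using F_component_deriv[OF assms] by (simp add: has_field_derivative_def)
  then have "((\<lambda>z. \<Sum>k\<in>UNIV. F a z $ k *s axis k 1) has_derivative
      (\<lambda>h. \<Sum>k\<in>UNIV. (F (Suc a) z $ k * h) *s (axis k 1 :: complex ^ 'm))) (at z)"
    by (intro has_derivative_sum bounded_linear.has_derivative[OF
          bounded_bilinear.bounded_linear_left[OF bounded_bilinear_smult]])
  moreover have "(\<Sum>k\<in>UNIV. (F (Suc a) z $ k * h) *s (axis k 1 :: complex ^ 'm)) = h *s F (Suc a) z" for h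
  proof -
    have "h *s F (Suc a) z = (\<Sum>k\<in>UNIV. (h *s F (Suc a) z) $ k *s axis k 1)"
      by (rule basis_expansion[symmetric])
    then show ?thesis by (simp add: mult.commute)
  qed
  ultimately show ?thesis by (simp add: basis_expansion)
qed

definition dzbar where "dzbar t w = dvec (1/2, \<i>/2) t w"

lemma s_has_derivative: "j \<le> n \<Longrightarrow> w \<in> W \<Longrightarrow> (s j has_derivative frechet_derivative (s j) (at w)) (at w)"
  by (rule smooth_on_has_derivative[OF smooth W])

lemma inner_derivative_zero:
  assumes "(u has_derivative U) (at w)" "(t has_derivative T) (at w)" "w \<in> W"
    and zero: "\<And>x. x \<in> W \<Longrightarrow> hinner (u x) (t x) = 0"
  shows "hinner (u w) (T h) + hinner (U h) (t w) = 0"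
proof -
  have "((\<lambda>x. 0) has_derivative (\<lambda>h. hinner (u w) (T h) + hinner (U h) (t w))) (at w)"
    by (rule has_derivative_transform_within_open[OF has_derivative_hinner[OF assms(1,2)] W assms(3)])
       (use zero in auto)
  from fun_cong[OF has_derivative_unique[OF this has_derivative_const]] show ?thesis .
qed

lemma F_orth_step:
  assumes c: "c \<le> n" and w: "w \<in> W" and zero: "\<And>x. x \<in> W \<Longrightarrow> hinner (F a x) (s c x) = 0"
  shows "hinner (F (Suc a) w) (s c w) = - hinner (F a w) (dzbar (s c) w)"
proof -
  let ?T = "frechet_derivative (s c) (at w)"
  have d: "hinner (F a w) (?T h) + hinner (h *s F (Suc a) w) (s c w) = 0" for h
    by (rule inner_derivative_zero[OF F_has_derivative[OF w] s_has_derivative[OF c w] w zero])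
  have "hinner (F a w) (?T 1) = - hinner (F (Suc a) w) (s c w)"
    "hinner (F a w) (?T \<i>) = - \<i> * hinner (F (Suc a) w) (s c w)"
    using d[of 1] d[of \<i>] by (auto simp: hinner_scale_left algebra_simps eq_neg_iff_add_eq_0)
  then show ?thesis
    by (simp add: dzbar_def dvec_def hinner_add_right hinner_scale_right algebra_simps)
qed

lemma s_orth_step:
  assumes c: "c \<le> n" and d: "d \<le> n" and cd: "d \<noteq> c" and w: "w \<in> W"
  shows "hinner (s d w) (dzbar (s c) w) = - hinner (dvec del_z (s d) w) (s c w)"
proof -
  let ?T = "frechet_derivative (s c) (at w)" and ?U = "frechet_derivative (s d) (at w)"
  have "hinner (s d w) (?T h) + hinner (?U h) (s c w) = 0" for h
    by (rule inner_derivative_zero[OF s_has_derivative[OF d w] s_has_derivative[OF c w] w])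
       (rule orth[OF d c cd])
  then have "hinner (s d w) (?T h) = - hinner (?U h) (s c w)" for h
    by (simp add: eq_neg_iff_add_eq_0)
  then show ?thesis
    by (simp add: dzbar_def dvec_def del_z_def hinner_add_left hinner_diff_left hinner_add_right hinner_scale_right
        hinner_scale_left algebra_simps)
qed

text \<open>Differentiate \<open>hinner (F a) (s c) = 0\<close>: the new term involves the antiholomorphic derivative
of \<open>s c\<close>, whose components along \<open>s d\<close> with \<open>d \<le> a\<close> are by orthogonality those of the holomorphic
derivative of \<open>s d\<close> along \<open>s c\<close>. These vanish unless \<open>c = Suc d\<close>.\<close>

lemma F_triangular:
  assumes "a \<le> n" "c \<le> n" "a < c" "w \<in> W"
  shows "hinner (F a w) (s c w) = 0"
  using assms
proof (induction a arbitrary: c w)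
  case 0
  have "f w \<in> vec.span {s 0 w}" using f_in[OF 0(4)] \<Psi>[of 0 w] 0 by simp
  then show ?case using orth[of 0 c w] 0 by (auto simp: span_single F_0 hinner_scale_left)
next
  case (Suc a)
  have IH: "hinner (F a x) (s d x) = 0" if "d \<le> n" "a < d" "x \<in> W" for d x
    using Suc.IH[of d x] Suc.prems that by simp
  have "hinner (F (Suc a) w) (s c w) = - hinner (F a w) (dzbar (s c) w)"
    by (rule F_orth_step) (use Suc.prems IH in auto)
  also have "F a w = (\<Sum>d\<le>n. proj_coef (F a w) (s d w) *s s d w)" by (rule expand_s[OF Suc.prems(4)])
  also have "hinner \<dots> (dzbar (s c) w) = (\<Sum>d\<le>n. proj_coef (F a w) (s d w) * hinner (s d w) (dzbar (s c) w))"
    by (simp add: hinner_sum_left hinner_scale_left)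
  also have "\<dots> = 0"
  proof (rule sum.neutral, rule ballI)
    fix d assume d: "d \<in> {..n}"
    show "proj_coef (F a w) (s d w) * hinner (s d w) (dzbar (s c) w) = 0"
    proof (cases "a < d")
      case True
      then show ?thesis using IH[of d w] d Suc.prems by (simp add: proj_coef_def)
    next
      case False
      then show ?thesis using s_orth_step[of c d w] prim[of d c w] d Suc.prems by auto
    qed
  qed
  finally show ?case by simp
qed

lemma F_diagonal_step:
  assumes a: "a < n" and w: "w \<in> W"
  shows "hinner (F (Suc a) w) (s (Suc a) w) = proj_coef (F a w) (s a w) * b a w"
proof -
  let ?c = "Suc a"
  have "hinner (F (Suc a) w) (s ?c w) = - hinner (F a w) (dzbar (s ?c) w)"
    by (rule F_orth_step) (use a w F_triangular[of a ?c] in auto)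
  also have "F a w = (\<Sum>d\<le>n. proj_coef (F a w) (s d w) *s s d w)" by (rule expand_s[OF w])
  also have "hinner \<dots> (dzbar (s ?c) w) = (\<Sum>d\<le>n. proj_coef (F a w) (s d w) * hinner (s d w) (dzbar (s ?c) w))"
    by (simp add: hinner_sum_left hinner_scale_left)
  also have "\<dots> = (\<Sum>d\<in>{a}. proj_coef (F a w) (s d w) * hinner (s d w) (dzbar (s ?c) w))"
  proof (rule sum.mono_neutral_right)
    show "\<forall>d\<in>{..n} - {a}. proj_coef (F a w) (s d w) * hinner (s d w) (dzbar (s ?c) w) = 0"
    proof
      fix d assume d: "d \<in> {..n} - {a}"
      show "proj_coef (F a w) (s d w) * hinner (s d w) (dzbar (s ?c) w) = 0"
      proof (cases "a < d")
        case True
        then show ?thesis using F_triangular[of a d w] d a w by (simp add: proj_coef_def)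
      next
        case False
        then show ?thesis using s_orth_step[of ?c d w] prim[of d ?c w] d a w by auto
      qed
    qed
  qed (use a in auto)
  finally show ?thesis using s_orth_step[of ?c a w] a w by (simp add: b_def)
qed

text \<open>The coordinates of the derivatives of \<open>f\<close> in the normalised frame; a lower triangular matrix.\<close>

definition M where "M w a c = hinner (F a w) (e c w)"

lemma F_expand:
  assumes a: "a \<le> n" and w: "w \<in> W"
  shows "F a w = (\<Sum>c\<le>a. M w a c *s e c w)"
proof -
  have "F a w = (\<Sum>c\<le>n. M w a c *s e c w)" unfolding M_def by (rule expand_e[OF w])
  also have "\<dots> = (\<Sum>c\<le>a. M w a c *s e c w)"
    using a F_triangular[OF a _ _ w]
    by (intro sum.mono_neutral_right) (auto simp: M_def e_def hinner_scale_right)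
  finally show ?thesis .
qed

lemma M_diagonal: "w \<in> W \<Longrightarrow> M w a a = hinner (F a w) (s a w) / of_real (norm (s a w))"
  by (simp add: M_def e_def hinner_scale_right divide_inverse)

lemma M_step:
  assumes a: "a < n" and w: "w \<in> W"
  shows "M w (Suc a) (Suc a) = M w a a * b a w / (of_real (norm (s a w)) * of_real (norm (s (Suc a) w)))"
  unfolding M_diagonal[OF w] F_diagonal_step[OF a w]
  by (simp add: proj_coef_def hinner_self power2_eq_square)

lemma M_ratio:
  assumes a: "a < n" and w: "w \<in> W" and "M w a a \<noteq> 0"
  shows "(cmod (M w (Suc a) (Suc a)))\<^sup>2 / (cmod (M w a a))\<^sup>2 = gamma (\<Psi> a) w"
  using assms(3) unfolding M_step[OF a w] gamma_frame[OF a w]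
  by (simp add: norm_mult norm_divide power_mult_distrib power_divide)

lemma M_nonzero:
  assumes w: "w \<in> W" and b: "\<And>i. i < n \<Longrightarrow> b i w \<noteq> 0" and a: "a \<le> n"
  shows "M w a a \<noteq> 0"
  using a
proof (induction a)
  case 0
  have "f w \<in> vec.span {s 0 w}" using f_in[OF w] \<Psi>[of 0 w] w by simp
  then obtain c where c: "f w = c *s s 0 w" by (auto simp: span_single)
  then have "c \<noteq> 0" using f_nz[OF w] by auto
  then show ?case using c nz[of 0 w] w by (simp add: M_diagonal F_0 hinner_scale_left)
next
  case (Suc a)
  then show ?case using M_step[of a w] b[of a] nz[of a w] nz[of "Suc a" w] w by simp
qed

definition sigma where "sigma j t z = wedge j (\<lambda>a. F a z) t"

lemma sigma_deriv:
  assumes "z \<in> W"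
  shows "(sigma j t has_field_derivative wedge j ((\<lambda>a. F a z)(j := F (Suc j) z)) t) (at z)"
  unfolding sigma_def by (rule wedge_derivative) (rule F_component_deriv[OF assms])

lemma sigma_holomorphic: "sigma j t holomorphic_on W"
  using sigma_deriv W by (auto simp: holomorphic_on_open)

text \<open>The metric \<open>gamma (\<Psi> j)\<close> is the one induced by the \<open>j\<close>-th osculating curve, so it has the
logarithm of a sum of squared moduli as its potential.\<close>

lemma sigma_jets:
  assumes z: "z \<in> W" and j: "j < n"
    and ts: "set ts = PiE {..j} (\<lambda>_. UNIV :: 'm set)" "distinct ts"
  shows "jet (map (sigma j) ts) 0 0 z (cnj z) = fact (Suc j) * of_real ((\<Prod>a\<le>j. cmod (M z a a))\<^sup>2)"
    and "jet (map (sigma j) ts) 0 0 z (cnj z) \<noteq> 0 \<Longrightarrow> ddbar_log (map (sigma j) ts) z = of_real (gamma (\<Psi> j) z)"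
proof -
  let ?I = "PiE {..j} (\<lambda>_. UNIV :: 'm set)"
  let ?v = "\<lambda>a. F a z"
  let ?H = "wedge j ?v" and ?H' = "wedge j (?v(j := ?v (Suc j)))"
  have d: "deriv (sigma j t) z = ?H' t" for t using sigma_deriv[OF z] by (rule DERIV_imp_deriv)
  have sum: "(\<Sum>t\<leftarrow>ts. g t) = (\<Sum>t\<in>?I. g t)" for g :: "_ \<Rightarrow> complex"
    using ts sum_list_distinct_conv_sum_set by metis
  have j00: "jet (map (sigma j) ts) 0 0 z (cnj z) = (\<Sum>t\<in>?I. ?H t * cnj (?H t))"
    by (simp add: jet_def o_def sum sigma_def)
  have j10: "jet (map (sigma j) ts) 1 0 z (cnj z) = (\<Sum>t\<in>?I. ?H' t * cnj (?H t))"
    by (simp add: jet_def o_def sum d) (simp add: sigma_def)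
  have j11: "jet (map (sigma j) ts) 1 1 z (cnj z) = (\<Sum>t\<in>?I. ?H' t * cnj (?H' t))"
    by (simp add: jet_def o_def sum d)
  have j01: "jet (map (sigma j) ts) 0 1 z (cnj z) = cnj (\<Sum>t\<in>?I. ?H' t * cnj (?H t))"
    unfolding j10[symmetric] by (simp add: jet_cnj)
  have on: "hinner (e c z) (e d z) = (if c = d then 1 else 0)" if "c \<le> Suc j" "d \<le> Suc j" for c d
    using e_orthonormal[of c d z] that j z by simp
  have v: "?v a = (\<Sum>c\<le>a. M z a c *s e c z)" if "a \<le> Suc j" for a
    using F_expand[of a z] that j z by simp
  note wl = wedge_log_curvature[of j "\<lambda>c. e c z" ?v "M z", OF on v]
  show 1: "jet (map (sigma j) ts) 0 0 z (cnj z) = fact (Suc j) * of_real ((\<Prod>a\<le>j. cmod (M z a a))\<^sup>2)"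
    unfolding j00 by (rule wl(1))
  assume nz0: "jet (map (sigma j) ts) 0 0 z (cnj z) \<noteq> 0"
  then have "M z j j \<noteq> 0" unfolding 1 by auto
  have "ddbar_log (map (sigma j) ts) z = of_real ((cmod (M z (Suc j) (Suc j)))\<^sup>2 / (cmod (M z j j))\<^sup>2)"
    using wl(2) nz0 unfolding ddbar_log_def levi_def j00 j10 j11 j01 by blast
  then show "ddbar_log (map (sigma j) ts) z = of_real (gamma (\<Psi> j) z)"
    using M_ratio[OF j z \<open>M z j j \<noteq> 0\<close>] by simp
qed

end

section \<open>The induced metric as the metric of a kernel\<close>

lemma wedge_0: "wedge 0 v s = v 0 $ s 0"
proof -
  have "{p. p permutes {..0::nat}} = {id}"
    by (auto simp: permutes_sing)
  then show ?thesis by (simp add: wedge_def)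
qed

lemma tendsto_punctured_unique:
  fixes f g :: "complex \<Rightarrow> complex"
  assumes "isCont f 0" "isCont g 0" "r > 0" "\<And>z. z \<in> ball 0 r \<Longrightarrow> z \<noteq> 0 \<Longrightarrow> f z = g z"
  shows "f 0 = g 0"
proof -
  have "eventually (\<lambda>z. f z = g z) (at 0)"
    unfolding eventually_at using assms(3,4) by (intro exI[of _ r]) (auto simp: dist_commute)
  then have "(f \<longlongrightarrow> g 0) (at 0)"
    using assms(2) unfolding isCont_def by (simp add: tendsto_cong)
  then show ?thesis using assms(1) unfolding isCont_def by (intro tendsto_unique[of "at 0" f]) auto
qed

lemma eventually_nonzero_list:
  assumes "t \<in> set ts" "t holomorphic_on ball 0 r" "r > 0" "t 0 \<noteq> 0"
  shows "eventually (\<lambda>z. \<exists>t\<in>set ts. t z \<noteq> 0) (nhds (0::complex))"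
  using isCont_eventually_nonzero[OF holomorphic_ball_isCont[OF assms(2,3)] assms(4)]
  by eventually_elim (use assms(1) in blast)

lemma jet00_zero: "(\<And>t. t \<in> set ts \<Longrightarrow> t z = 0) \<Longrightarrow> jet ts 0 0 z y = 0"
  by (induction ts) (auto simp: jet00)

lemma sum_list_concat_replicate:
  "(\<Sum>x\<leftarrow>concat (map (\<lambda>j. replicate (k j) (T j)) js). (g x :: complex)) = (\<Sum>j\<leftarrow>js. of_nat (k j) * g (T j))"
  by (induction js) (auto simp: sum_list_replicate)

text \<open>By definition of the harmonic sequence the entries \<open>b i\<close> vanish at most on a negligible set; it
is enough to know that their common nonvanishing set is dense.\<close>

locale ball_frames = holomorphic_frames n "ball 0 r" s \<Psi> \<iota> f
  for n and r :: real and s :: "nat \<Rightarrow> complex \<Rightarrow> complex ^ 'm::finite" and \<Psi> \<iota> f +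
  assumes r: "r > 0" and n: "n > 0"
    and b_dense: "\<And>V. open V \<Longrightarrow> V \<subseteq> ball 0 r \<Longrightarrow> V \<noteq> {} \<Longrightarrow> \<exists>w\<in>V. \<forall>i<n. b i w \<noteq> 0"
begin

text \<open>At a point where no \<open>b i\<close> vanishes, the derivatives of \<open>f\<close> span the whole space, and a
vector orthogonal to all values of \<open>f\<close> is orthogonal to its derivatives.\<close>

lemma locally_full:
  assumes V: "open V" "V \<subseteq> ball 0 r" "V \<noteq> {}" and u: "\<And>w. w \<in> V \<Longrightarrow> hinner (f w) u = 0"
  shows "u = 0"
proof -
  obtain z where z: "z \<in> V" "\<And>i. i < n \<Longrightarrow> b i z \<noteq> 0" using b_dense[OF V] by blast
  have zW: "z \<in> ball 0 r" using z V by blast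
  have Fu: "hinner (F a w) u = 0" if "w \<in> V" for a w
    using that
  proof (induction a arbitrary: w)
    case 0
    then show ?case using u by (simp add: F_0)
  next
    case (Suc a)
    have w: "w \<in> ball 0 r" using Suc.prems V(2) by blast
    have "((\<lambda>x. hinner (F a x) u) has_derivative (\<lambda>h. hinner (F a w) 0 + hinner (h *s F (Suc a) w) u)) (at w)"
      by (rule has_derivative_hinner[OF F_has_derivative[OF w] has_derivative_const])
    then have "((\<lambda>x. 0) has_derivative (\<lambda>h. hinner (F a w) 0 + hinner (h *s F (Suc a) w) u)) (at w)"
      by (rule has_derivative_transform_within_open[OF _ V(1) Suc.prems]) (rule Suc.IH)
    from fun_cong[OF has_derivative_unique[OF this has_derivative_const], of 1]
    show ?case by simp
  qed
  have eu: "a \<le> n \<Longrightarrow> hinner (e a z) u = 0" for a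
  proof (induction a rule: less_induct)
    case (less a)
    have "0 = hinner (F a z) u" using Fu[OF z(1)] by simp
    also have "\<dots> = (\<Sum>c\<le>a. M z a c * hinner (e c z) u)"
      by (subst F_expand[OF less.prems zW]) (simp add: hinner_sum_left hinner_scale_left)
    also have "\<dots> = (\<Sum>c\<in>{a}. M z a c * hinner (e c z) u)"
      using less by (intro sum.mono_neutral_right) auto
    finally show ?case using M_nonzero[OF zW z(2) less.prems] by simp
  qed
  have "u = (\<Sum>c\<le>n. hinner u (e c z) *s e c z)" by (rule expand_e[OF zW])
  also have "\<dots> = 0" using hinner_eq_0_commute[OF eu] by simp
  finally show ?thesis .
qed

text \<open>The osculating wedge product may vanish at the origin. Dividing it by a power of \<open>z\<close> does not
change the mixed derivative of the logarithm of its norm.\<close>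

lemma sigma_list:
  assumes j: "j < n"
  shows "\<exists>T. (\<forall>t\<in>set T. t holomorphic_on ball 0 r) \<and> (\<exists>t\<in>set T. t 0 \<noteq> 0) \<and>
     eventually (\<lambda>z. z \<noteq> 0 \<longrightarrow> ddbar_log T z = of_real (gamma (\<Psi> j) z)) (nhds 0)"
proof -
  have "finite (PiE {..j} (\<lambda>_. UNIV :: 'm set))" by (intro finite_PiE) auto
  from finite_distinct_list[OF this] obtain ts where ts: "set ts = PiE {..j} (\<lambda>_. UNIV :: 'm set)" "distinct ts"
    by (elim exE conjE)
  obtain z0 where z0: "z0 \<in> ball 0 r" "\<And>i. i < n \<Longrightarrow> b i z0 \<noteq> 0"
    using b_dense[of "ball 0 r"] r by auto
  have "jet (map (sigma j) ts) 0 0 z0 (cnj z0) \<noteq> 0"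
    unfolding sigma_jets(1)[OF z0(1) j ts] using M_nonzero[OF z0] j by (auto simp del: fact_Suc)
  then obtain t0 where t0: "t0 \<in> set ts" "sigma j t0 z0 \<noteq> 0"
  proof -
    have "\<exists>t\<in>set ts. sigma j t z0 \<noteq> 0"
    proof (rule ccontr)
      assume "\<not> ?thesis"
      then have "jet (map (sigma j) ts) 0 0 z0 (cnj z0) = 0"
        by (intro jet00_zero) auto
      then show False using \<open>jet _ _ _ _ _ \<noteq> 0\<close> by simp
    qed
    then show ?thesis using that by blast
  qed
  obtain m \<tau> where \<tau>: "\<And>i. i \<in> set ts \<Longrightarrow> \<tau> i holomorphic_on ball 0 r"
    "\<And>i z. i \<in> set ts \<Longrightarrow> z \<in> ball 0 r \<Longrightarrow> sigma j i z = z ^ m * \<tau> i z" "\<exists>i\<in>set ts. \<tau> i 0 \<noteq> 0"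
    by (rule divide_common_zero[where H = "sigma j" and I = "set ts", OF sigma_holomorphic t0(1) z0(1) t0(2)], rule that)
  obtain i0 where i0: "i0 \<in> set ts" "\<tau> i0 0 \<noteq> 0" using \<tau>(3) by blast
  have "eventually (\<lambda>z. \<exists>t\<in>set (map \<tau> ts). t z \<noteq> 0) (nhds 0)"
    by (rule eventually_nonzero_list[OF _ \<tau>(1)[OF i0(1)] r i0(2)]) (use i0 in auto)
  moreover have "eventually (\<lambda>z. z \<in> ball (0::complex) r) (nhds 0)"
    using r by (intro eventually_nhds_in_open) auto
  ultimately have "eventually (\<lambda>z. z \<noteq> 0 \<longrightarrow> ddbar_log (map \<tau> ts) z = of_real (gamma (\<Psi> j) z)) (nhds 0)"
  proof eventually_elim
    case (elim z)
    show ?case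
    proof
      assume z0: "z \<noteq> 0"
      have nz: "\<exists>i\<in>set ts. \<tau> i z \<noteq> 0" using elim(1) by auto
      have "ddbar_log (map (sigma j) ts) z = ddbar_log (map \<tau> ts) z"
        by (rule ddbar_log_divide_common_zero[OF sigma_holomorphic \<tau>(1,2) elim(2) z0 nz])
      moreover have "jet (map (sigma j) ts) 0 0 z (cnj z) \<noteq> 0"
      proof (rule jet00_nonzero)
        obtain i where "i \<in> set ts" "\<tau> i z \<noteq> 0" using nz by blast
        then show "\<exists>t\<in>set (map (sigma j) ts). t z \<noteq> 0"
          using \<tau>(2)[OF _ elim(2)] z0 by (auto intro!: bexI[of _ i])
      qed
      ultimately show "ddbar_log (map \<tau> ts) z = of_real (gamma (\<Psi> j) z)"
        using sigma_jets(2)[OF elim(2) j ts] by simp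
    qed
  qed
  then show ?thesis using \<tau>(1) i0 by (intro exI[of _ "map \<tau> ts"]) auto
qed

text \<open>For \<open>j = 0\<close> the list can be taken to consist of the components of \<open>f\<close> themselves.\<close>

lemma component_list:
  assumes ks: "set ks = (UNIV :: 'm set)" "distinct ks" and z: "z \<in> ball 0 r"
  shows "ddbar_log (map (\<lambda>k z. f z $ k) ks) z = of_real (gamma (\<Psi> 0) z)"
proof -
  define ts where "ts = map (\<lambda>k. (\<lambda>a. if a = 0 then k else undefined) :: nat \<Rightarrow> 'm) ks"
  have "set ts = PiE {..0} (\<lambda>_. UNIV :: 'm set)"
  proof
    show "set ts \<subseteq> PiE {..0} (\<lambda>_. UNIV)" by (auto simp: ts_def PiE_def extensional_def)
    show "PiE {..0} (\<lambda>_. UNIV) \<subseteq> set ts"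
    proof
      fix t :: "nat \<Rightarrow> 'm" assume t: "t \<in> PiE {..0} (\<lambda>_. UNIV)"
      have "t = (\<lambda>a. if a = 0 then t 0 else undefined)"
        using t by (auto simp: PiE_def extensional_def fun_eq_iff)
      then show "t \<in> set ts" using ks(1) by (auto simp: ts_def)
    qed
  qed
  moreover have "distinct ts"
    unfolding ts_def distinct_map using ks(2) by (auto simp: inj_on_def fun_eq_iff)
  moreover have eq: "map (sigma 0) ts = map (\<lambda>k z. f z $ k) ks"
    by (simp add: ts_def o_def sigma_def[abs_def] wedge_0 F_0)
  moreover have "jet (map (\<lambda>k z. f z $ k) ks) 0 0 z (cnj z) \<noteq> 0"
  proof (rule jet00_nonzero)
    obtain k where "f z $ k \<noteq> 0" using f_nz[OF z] by (auto simp: vec_eq_iff)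
    then show "\<exists>t\<in>set (map (\<lambda>k z. f z $ k) ks). t z \<noteq> 0" using ks(1) by auto
  qed
  ultimately show ?thesis using sigma_jets(2)[OF z n] by metis
qed

lemma ddbar_log_isCont:
  assumes hol: "\<And>t. t \<in> set ts \<Longrightarrow> t holomorphic_on ball 0 r" and "jet ts 0 0 0 0 \<noteq> 0"
  shows "isCont (ddbar_log ts) 0"
proof -
  have "isCont (\<lambda>z. jet ts a b z (cnj z)) 0" for a b
    by (rule has_derivative_continuous[OF jet_diag_derivative[where r = r, OF hol]]) (use r in auto)
  then show ?thesis
    unfolding ddbar_log_def[abs_def] levi_def using assms(2) by (intro continuous_intros) auto
qed

text \<open>The induced metric has the potential \<open>log G\<close>, where \<open>G\<close> is the product of the \<open>k j\<close>-th powers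
of the squared norms of the osculating wedge products. As \<open>k 0 > 0\<close>, one factor is the squared
norm of \<open>f\<close>. Dividing out common zeros gives the formula for the metric away from the origin only; so the curvature equation is obtained on a punctured disc, and
at the origin by continuity.\<close>

theorem kernel_factorisation:
  fixes k :: "nat \<Rightarrow> nat" and g :: "complex \<Rightarrow> real^2^2"
  assumes k: "\<And>j. j < n \<Longrightarrow> k j > 0"
  defines "E \<equiv> \<lambda>w. \<Sum>j<n. of_nat (k j) * gamma (\<Psi> j) w"
  assumes pos: "\<And>w. w \<in> ball 0 r \<Longrightarrow> E w > 0"
    and g: "\<And>w. w \<in> ball 0 r \<Longrightarrow> g w = mat (E w)"
    and K: "\<And>w. w \<in> ball 0 r \<Longrightarrow> gauss_curvature g w = K"
  obtains \<rho> v q d where "0 < \<rho>" "\<rho> \<le> r" "v holomorphic_on ball 0 \<rho>" "inj_on v (ball 0 \<rho>)" "v 0 = 0"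
    "q holomorphic_on ball 0 \<rho>" "\<And>z. z \<in> ball 0 \<rho> \<Longrightarrow> q z \<noteq> 0"
    "\<And>z x. z \<in> ball 0 \<rho> \<Longrightarrow> x \<in> ball 0 \<rho> \<Longrightarrow>
       hinner (f z) (f x) = q z * cnj (q x) * (1 + v z * cnj (v x)) ^ d"
proof -
  obtain T' where T': "\<And>j. j < n \<Longrightarrow> (\<forall>t\<in>set (T' j). t holomorphic_on ball 0 r) \<and> (\<exists>t\<in>set (T' j). t 0 \<noteq> 0) \<and>
     eventually (\<lambda>z. z \<noteq> 0 \<longrightarrow> ddbar_log (T' j) z = of_real (gamma (\<Psi> j) z)) (nhds 0)"
    using sigma_list by metis
  obtain ks where ks: "set ks = (UNIV :: 'm set)" "distinct ks" using finite_distinct_list[of "UNIV :: 'm set"] by auto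
  define ms where "ms = map (\<lambda>k z. f z $ k) ks"
  define T where "T = (\<lambda>j. if j = 0 then ms else T' j)"
  have zero: "0 \<in> ball (0::complex) r" using r by simp
  have holT: "t holomorphic_on ball 0 r" if "j < n" "t \<in> set (T j)" for j t
    using that T' f_hol by (auto simp: T_def ms_def split: if_splits)
  have nzT: "\<exists>t\<in>set (T j). t 0 \<noteq> 0" if "j < n" for j
  proof (cases "j = 0")
    case True
    obtain i where "f 0 $ i \<noteq> 0" using f_nz[OF zero] by (auto simp: vec_eq_iff)
    then show ?thesis using True ks(1) by (auto simp: T_def ms_def)
  qed (use T' that in \<open>auto simp: T_def\<close>)
  have evT: "eventually (\<lambda>z. (\<exists>t\<in>set (T j). t z \<noteq> 0) \<and> (z \<noteq> 0 \<longrightarrow> ddbar_log (T j) z = of_real (gamma (\<Psi> j) z))) (nhds 0)"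
    if j: "j < n" for j
  proof (intro eventually_conj)
    obtain t where t: "t \<in> set (T j)" "t 0 \<noteq> 0" using nzT[OF j] by blast
    show "eventually (\<lambda>z. \<exists>t\<in>set (T j). t z \<noteq> 0) (nhds 0)"
      by (rule eventually_nonzero_list[OF t(1) holT[OF j t(1)] r t(2)])
    show "eventually (\<lambda>z. z \<noteq> 0 \<longrightarrow> ddbar_log (T j) z = of_real (gamma (\<Psi> j) z)) (nhds 0)"
    proof (cases "j = 0")
      case True
      have "eventually (\<lambda>z. z \<in> ball (0::complex) r) (nhds 0)"
        using r by (intro eventually_nhds_in_open) auto
      then show ?thesis
        by eventually_elim (use True component_list[OF ks] in \<open>auto simp: T_def ms_def\<close>)
    qed (use T' j in \<open>auto simp: T_def\<close>)
  qed
  have "eventually (\<lambda>z. z \<in> ball 0 r \<and> (\<forall>j\<in>{..<n}. (\<exists>t\<in>set (T j). t z \<noteq> 0) \<and> (z \<noteq> 0 \<longrightarrow> ddbar_log (T j) z = of_real (gamma (\<Psi> j) z)))) (nhds 0)"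
    using evT r by (intro eventually_conj eventually_ball_finite eventually_nhds_in_open) auto
  then obtain \<rho> where \<rho>: "\<rho> > 0" and \<rho>': "\<And>z. z \<in> ball 0 \<rho> \<Longrightarrow> z \<in> ball 0 r \<and> (\<forall>j\<in>{..<n}. (\<exists>t\<in>set (T j). t z \<noteq> 0) \<and> (z \<noteq> 0 \<longrightarrow> ddbar_log (T j) z = of_real (gamma (\<Psi> j) z)))"
    unfolding eventually_nhds_metric by (auto simp: dist_commute)
  have \<rho>r: "ball (0::complex) \<rho> \<subseteq> ball 0 r" using \<rho>' by blast
  then have \<rho>le: "\<rho> \<le> r" using \<rho> by (simp add: ball_subset_ball_iff)
  \<comment> \<open>one factor \<open>ms\<close>, the components of \<open>f\<close>, is kept apart from the rest\<close>
  define k' where "k' = (\<lambda>j. k j - (if j = 0 then 1 else 0))"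
  define tss where "tss = concat (map (\<lambda>j. replicate (k' j) (T j)) [0..<n])"
  have tss: "\<exists>j<n. ts = T j" if "ts \<in> set tss" for ts
    using that by (auto simp: tss_def)
  define rs where "rs = iterated_products tss"
  define ts where "ts = products ms rs"
  have msT: "ms = T 0" by (simp add: T_def)
  have holm: "t holomorphic_on ball 0 r" if "t \<in> set ms" for t
    using holT[of 0 t] n that by (simp add: msT)
  have holr: "t holomorphic_on ball 0 r" if "t \<in> set rs" for t
    by (rule hol_iterated_products[of tss]) (use that tss holT in \<open>auto simp: rs_def\<close>)
  have holt: "t holomorphic_on ball 0 r" if "t \<in> set ts" for t
    using hol_products[OF holm holr] that unfolding ts_def by blast
  have nz_m: "\<exists>t\<in>set ms. t z \<noteq> 0" if "z \<in> ball 0 \<rho>" for z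
    using \<rho>'[OF that] n by (auto simp: msT)
  have nz_r: "\<exists>t\<in>set rs. t z \<noteq> 0" if "z \<in> ball 0 \<rho>" for z
    unfolding rs_def by (rule iterated_products_nonzero) (use tss \<rho>'[OF that] in blast)
  have nz_t: "jet ts 0 0 z (cnj z) \<noteq> 0" if "z \<in> ball 0 \<rho>" for z
    unfolding ts_def jet_products00 using jet00_nonzero[OF nz_m[OF that]] jet00_nonzero[OF nz_r[OF that]] by simp
  have dl: "ddbar_log ts z = of_real (E z)" if z: "z \<in> ball 0 \<rho>" "z \<noteq> 0" for z
  proof -
    have zr: "z \<in> ball 0 r" using z \<rho>r by blast
    have "ddbar_log ts z = ddbar_log ms z + ddbar_log rs z"
      unfolding ts_def
      by (rule ddbar_log_products[OF holm holr zr]) (use jet00_nonzero nz_m nz_r z in blast)+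
    also have "ddbar_log rs z = (\<Sum>ts\<leftarrow>tss. ddbar_log ts z)"
      unfolding rs_def
    proof (rule ddbar_log_iterated_products[OF _ zr])
      show "t holomorphic_on ball 0 r" if "us \<in> set tss" "t \<in> set us" for us t
        using tss[OF that(1)] holT that(2) by blast
      show "\<exists>t\<in>set us. t z \<noteq> 0" if "us \<in> set tss" for us
        using tss[OF that] \<rho>'[OF z(1)] by blast
    qed
    also have "\<dots> = (\<Sum>j\<leftarrow>[0..<n]. of_nat (k' j) * ddbar_log (T j) z)"
      unfolding tss_def by (rule sum_list_concat_replicate)
    also have "\<dots> = (\<Sum>j<n. of_nat (k' j) * ddbar_log (T j) z)"
      by (simp add: sum_set_upt_conv_sum_list_nat[symmetric] atLeast0LessThan interv_sum_list_conv_sum_set_nat)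
    also have "ddbar_log ms z + \<dots> = (\<Sum>j<n. of_nat (k j) * ddbar_log (T j) z)"
    proof -
      have "ddbar_log ms z = (\<Sum>j<n. if j = 0 then ddbar_log (T j) z else 0)" using n by (simp add: msT)
      then have "ddbar_log ms z + (\<Sum>j<n. of_nat (k' j) * ddbar_log (T j) z)
        = (\<Sum>j<n. (if j = 0 then ddbar_log (T j) z else 0) + of_nat (k' j) * ddbar_log (T j) z)"
        by (simp add: sum.distrib)
      also have "\<dots> = (\<Sum>j<n. of_nat (k j) * ddbar_log (T j) z)"
      proof (rule sum.cong[OF refl])
        fix j assume "j \<in> {..<n}"
        then have "k j > 0" using k by simp
        then show "(if j = 0 then ddbar_log (T j) z else 0) + of_nat (k' j) * ddbar_log (T j) z = of_nat (k j) * ddbar_log (T j) z"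
          by (cases "k j") (auto simp: k'_def algebra_simps)
      qed
      finally show ?thesis .
    qed
    also have "\<dots> = of_real (E z)"
      unfolding E_def using \<rho>'[OF z(1)] z(2) by simp
    finally show ?thesis .
  qed
  have contE: "isCont (\<lambda>z. complex_of_real (E z)) 0"
  proof -
    have "continuous_on (ball 0 r) (\<lambda>z. complex_of_real (E z))"
      unfolding E_def using gamma_continuous by (intro continuous_intros) auto
    then show ?thesis using r by (simp add: continuous_on_eq_continuous_at)
  qed
  have zero\<rho>: "0 \<in> ball (0::complex) \<rho>" using \<rho> by simp
  have nz0: "jet ts 0 0 0 0 \<noteq> 0" using nz_t[OF zero\<rho>] by simp
  have "ddbar_log ts 0 = of_real (E 0)"
    by (rule tendsto_punctured_unique[OF ddbar_log_isCont[OF holt nz0] contE \<rho> dl])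
  then have lev0: "levi ts 0 0 = of_real (E 0) * (jet ts 0 0 0 0)\<^sup>2"
    using nz0 by (simp add: ddbar_log_def divide_simps)
  have "jet ts 0 0 0 0 = of_real (\<Sum>t\<leftarrow>ts. (cmod (t 0))\<^sup>2)" using jet_diag_real[of ts 0] by simp
  then obtain G0 where G0: "jet ts 0 0 0 0 = of_real G0" by blast
  have "levi ts 0 0 = of_real (E 0 * G0\<^sup>2)" unfolding lev0 G0 by simp
  moreover have "E 0 * G0\<^sup>2 > 0" using pos[OF zero] nz0 G0 by simp
  ultimately have lev_pos: "Re (levi (products ms rs) 0 0) > 0" by (simp add: ts_def)
  define \<kappa> where "\<kappa> = K / 2"
  define \<Phi> where "\<Phi> = (\<lambda>z y. (levi ts z y * levi_zy ts z y - levi_z ts z y * levi_y ts z y) * (jet ts 0 0 z y)\<^sup>2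
      - (2 - of_real \<kappa>) * levi ts z y ^ 3)"
  have \<Phi>1: "\<Phi> z (cnj z) = 0" if z: "z \<in> ball 0 \<rho>" "z \<noteq> 0" for z
  proof -
    have "(levi ts z (cnj z) * levi_zy ts z (cnj z) - levi_z ts z (cnj z) * levi_y ts z (cnj z)) * (jet ts 0 0 z (cnj z))\<^sup>2
        = (2 - of_real \<kappa>) * levi ts z (cnj z) ^ 3"
    proof (rule curvature_equation[where r = r and S = "ball 0 \<rho> - {0}" and e = E and g = g])
      show "of_real (E x) = levi ts x (cnj x) / (jet ts 0 0 x (cnj x))\<^sup>2" if "x \<in> ball 0 \<rho> - {0}" for x
        using dl[of x] that by (simp add: ddbar_log_def)
      show "gauss_curvature g z = 2 * \<kappa>" using K[of z] z \<rho>r by (auto simp: \<kappa>_def)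
      show "E x > 0" "g x = mat (E x)" if "x \<in> ball 0 \<rho> - {0}" for x
        using that pos g \<rho>r by blast+
      show "jet ts 0 0 x (cnj x) \<noteq> 0" if "x \<in> ball 0 \<rho> - {0}" for x using nz_t that by blast
      show "ball 0 \<rho> - {0} \<subseteq> ball (0::complex) r" using \<rho>r by blast
    qed (use holt z in auto)
    then show ?thesis by (simp add: \<Phi>_def)
  qed
  have "sesqui r \<Phi>"
    unfolding \<Phi>_def levi_def levi_z_def levi_y_def levi_zy_def
    by (intro sesqui_diff sesqui.mult sesqui_power sesqui_jet[OF holt] sesqui_const)
  then have "isCont (\<lambda>z. \<Phi> z (cnj z)) 0"
    using sesqui_derivative[of r \<Phi>] zero has_derivative_continuous by blast
  then have "\<Phi> 0 (cnj 0) = 0"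
    using tendsto_punctured_unique[of "\<lambda>z. \<Phi> z (cnj z)" "\<lambda>z. 0" \<rho>] \<rho> \<Phi>1 by simp
  then have \<Phi>0: "\<Phi> z (cnj z) = 0" if "z \<in> ball 0 \<rho>" for z
    using \<Phi>1[OF that] by (cases "z = 0") auto
  have curv: "(levi (products ms rs) z y * levi_zy (products ms rs) z y - levi_z (products ms rs) z y * levi_y (products ms rs) z y)
         * (jet (products ms rs) 0 0 z y)\<^sup>2 = (2 - of_real \<kappa>) * levi (products ms rs) z y ^ 3"
    if "z \<in> ball 0 \<rho>" "y = cnj z" for z y
    using \<Phi>0[OF that(1)] unfolding \<Phi>_def ts_def that(2) by simp
  obtain m0 where m0: "m0 \<in> set ms" "m0 0 \<noteq> 0" using nz_m[OF zero\<rho>] by blast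
  obtain r0 where r0: "r0 \<in> set rs" "r0 0 \<noteq> 0" using nz_r[OF zero\<rho>] by blast
  have holm\<rho>: "t holomorphic_on ball 0 \<rho>" if "t \<in> set ms" for t
    using holm[OF that] \<rho>r holomorphic_on_subset by blast
  have holr\<rho>: "t holomorphic_on ball 0 \<rho>" if "t \<in> set rs" for t
    using holr[OF that] \<rho>r holomorphic_on_subset by blast
  have hin: "(\<Sum>m\<leftarrow>ms. m z * cnj (m x)) = hinner (f z) (f x)" for z x
    unfolding ms_def hinner_def using ks by (simp add: o_def sum_list_distinct_conv_sum_set)
  obtain \<rho>' v q d where *: "0 < \<rho>'" "\<rho>' \<le> \<rho>" "v holomorphic_on ball 0 \<rho>'" "inj_on v (ball 0 \<rho>')" "v 0 = 0"
    "q holomorphic_on ball 0 \<rho>'" "\<And>z. z \<in> ball 0 \<rho>' \<Longrightarrow> q z \<noteq> 0"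
    "\<And>z x. z \<in> ball 0 \<rho>' \<Longrightarrow> x \<in> ball 0 \<rho>' \<Longrightarrow>
       (\<Sum>m\<leftarrow>ms. m z * cnj (m x)) = q z * cnj (q x) * (1 + v z * cnj (v x)) ^ d"
    by (rule constant_curvature_factor[where ms = ms and rs = rs and \<kappa> = \<kappa>,
          OF \<rho> holm\<rho> holr\<rho> m0 r0 lev_pos curv]) (assumption | rule that)+
  show ?thesis
    by (rule that[of \<rho>' v q d]) (use * \<rho>le in \<open>simp_all add: hin\<close>)
qed

end

section \<open>Rigidity of the Veronese curve\<close>

lemma falling_binomial: "(\<Prod>l<j. d - l) = (d choose j) * fact j"
proof (induction j)
  case (Suc j)
  have "(\<Prod>l<Suc j. d - l) = ((d - j) * (d choose j)) * fact j" by (simp add: Suc)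
  also have "(d - j) * (d choose j) = Suc j * (d choose Suc j)"
    by (simp only: binomial_absorption binomial_absorb_comp)
  also have "Suc j * (d choose Suc j) * fact j = (d choose Suc j) * fact (Suc j)"
    by (simp only: fact_Suc of_nat_id mult_ac)
  finally show ?case .
qed simp

lemma binomial_kernel_jets:
  assumes hol: "\<And>t. t \<in> set ts \<Longrightarrow> t holomorphic_on ball 0 s"
    and ker: "\<And>u x. u \<in> ball 0 s \<Longrightarrow> x \<in> ball 0 s \<Longrightarrow> jet ts 0 0 u x = (1 + u * x) ^ d"
    and u: "u \<in> ball 0 s" and x: "x \<in> ball 0 s"
  shows "jet ts 0 j u x = of_nat (\<Prod>l<j. d - l) * u ^ j * (1 + u * x) ^ (d - j)"
  using x
proof (induction j arbitrary: x)
  case 0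
  then show ?case using ker[OF u 0] by simp
next
  case (Suc j)
  have "((\<lambda>x. of_nat (\<Prod>l<j. d - l) * u ^ j * (1 + u * x) ^ (d - j)) has_field_derivative jet ts 0 (Suc j) u x) (at x)"
    by (rule has_field_derivative_transform_within_open[OF jet_deriv2[OF hol Suc.prems] open_ball Suc.prems])
       (auto simp: Suc.IH)
  moreover have "((\<lambda>x. of_nat (\<Prod>l<j. d - l) * u ^ j * (1 + u * x) ^ (d - j)) has_field_derivative
      of_nat (\<Prod>l<j. d - l) * u ^ j * (of_nat (d - j) * (1 + u * x) ^ (d - j - 1) * u)) (at x)"
    by (auto intro!: derivative_eq_intros)
  ultimately have "jet ts 0 (Suc j) u x = of_nat (\<Prod>l<j. d - l) * u ^ j * (of_nat (d - j) * (1 + u * x) ^ (d - j - 1) * u)"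
    using DERIV_unique by blast
  then show ?case by (simp add: mult_ac)
qed

text \<open>The matrix of inner products of the vectors of derivatives at the origin is read off from the
Taylor expansion of the kernel in both variables.\<close>

lemma binomial_kernel_gram:
  assumes hol: "\<And>t. t \<in> set ts \<Longrightarrow> t holomorphic_on ball 0 s" and s: "s > 0"
    and ker: "\<And>u x. u \<in> ball 0 s \<Longrightarrow> x \<in> ball 0 s \<Longrightarrow> jet ts 0 0 u x = (1 + u * x) ^ d"
  shows "jet ts i j 0 0 = (if i = j then of_nat (d choose j) * fact j * fact j else 0)"
proof -
  have s0: "0 \<in> ball (0::complex) s" using s by simp
  let ?c = "of_nat (\<Prod>l<j. d - l) :: complex"
  have j0: "jet ts 0 j u 0 = ?c * u ^ j" if "u \<in> ball 0 s" for u
    using binomial_kernel_jets[OF hol ker that s0] by simp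
  have hol0: "(\<lambda>u. jet ts 0 j u 0) holomorphic_on ball 0 s"
    using jet_deriv1[OF hol] holomorphic_on_open[OF open_ball] by blast
  have "jet ts i j 0 0 = (deriv ^^ i) (\<lambda>u. jet ts 0 j u 0) 0"
    by (rule jet_higher_deriv[OF hol s0, symmetric])
  also have "\<dots> = (deriv ^^ i) (\<lambda>u. ?c * u ^ j) 0"
    by (rule higher_deriv_transform_within_open[OF hol0 _ open_ball s0])
       (use j0 in \<open>auto intro!: holomorphic_intros\<close>)
  also have "\<dots> = ?c * (deriv ^^ i) (\<lambda>u. u ^ j) 0"
    by (rule higher_deriv_cmult[of _ UNIV]) (auto intro!: holomorphic_intros)
  finally show ?thesis unfolding higher_deriv_power_0 falling_binomial by auto
qed

text \<open>Calabi's rigidity for the Veronese curve. In the coordinate \<open>v\<close> the Taylor coefficients \<open>c j\<close> of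
\<open>f / q\<close> are orthogonal with squared lengths \<open>d choose j\<close>, just as those of the Veronese curve of
degree \<open>d\<close>. There are \<open>d + 1\<close> nonzero ones, so \<open>d \<le> n\<close>; they span the space because \<open>f\<close> is full,
so \<open>n \<le> d\<close>. The normalised coefficients are the columns of the unitary matrix.\<close>

theorem veronese_rigidity:
  fixes f :: "complex \<Rightarrow> complex ^ 'm::finite"
  assumes \<iota>: "bij_betw \<iota> (UNIV :: 'm set) {..n}" and \<rho>: "\<rho> > 0"
    and f: "\<And>k. (\<lambda>z. f z $ k) holomorphic_on ball 0 \<rho>"
    and v: "v holomorphic_on ball 0 \<rho>" "inj_on v (ball 0 \<rho>)" "v 0 = 0"
    and q: "q holomorphic_on ball 0 \<rho>" "\<And>z. z \<in> ball 0 \<rho> \<Longrightarrow> q z \<noteq> 0"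
    and ker: "\<And>z x. z \<in> ball 0 \<rho> \<Longrightarrow> x \<in> ball 0 \<rho> \<Longrightarrow>
       hinner (f z) (f x) = q z * cnj (q x) * (1 + v z * cnj (v x)) ^ d"
    and full: "\<And>\<sigma> u. \<sigma> > 0 \<Longrightarrow> \<sigma> \<le> \<rho> \<Longrightarrow> (\<And>w. w \<in> ball 0 \<sigma> \<Longrightarrow> hinner (f w) u = 0) \<Longrightarrow> u = 0"
  obtains A \<sigma> where "unitary_matrix A" "\<sigma> > 0" "\<sigma> \<le> \<rho>"
    "\<And>w. w \<in> ball 0 \<sigma> \<Longrightarrow> vec.span {f w} = (\<lambda>x. A *v x) ` veronese \<iota> n (v w)"
proof -
  obtain s g \<sigma> where s: "s > 0" and g: "g holomorphic_on ball 0 s" "\<And>u. u \<in> ball 0 s \<Longrightarrow> g u \<in> ball 0 \<rho>"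
    "\<And>u. u \<in> ball 0 s \<Longrightarrow> v (g u) = u" and \<sigma>: "\<sigma> > 0" "\<sigma> \<le> \<rho>"
    "\<And>z. z \<in> ball 0 \<sigma> \<Longrightarrow> v z \<in> ball 0 s \<and> g (v z) = z"
    by (rule local_inverse[OF v \<rho>], rule that)
  define P where "P = (\<lambda>k u. f (g u) $ k / q (g u))"
  have holP: "P k holomorphic_on ball 0 s" for k
  proof -
    have "(\<lambda>u. f (g u) $ k) holomorphic_on ball 0 s" "(\<lambda>u. q (g u)) holomorphic_on ball 0 s"
      using holomorphic_on_compose_gen[OF g(1) f] holomorphic_on_compose_gen[OF g(1) q(1)] g(2)
      by (auto simp: o_def image_subset_iff)
    then show ?thesis unfolding P_def using g(2) q(2) by (intro holomorphic_on_divide) auto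
  qed
  obtain ks where ks: "set ks = (UNIV :: 'm set)" "distinct ks" using finite_distinct_list[of "UNIV :: 'm set"] by auto
  define ts where "ts = map P ks"
  have holt: "t holomorphic_on ball 0 s" if "t \<in> set ts" for t using that holP by (auto simp: ts_def)
  have kert: "jet ts 0 0 u x = (1 + u * x) ^ d" if u: "u \<in> ball 0 s" and x: "x \<in> ball 0 s" for u x
  proof -
    have cx: "cnj x \<in> ball 0 s" using x by simp
    have "jet ts 0 0 u x = (\<Sum>k\<in>UNIV. P k u * cnj (P k (cnj x)))"
      unfolding ts_def jet00 using ks by (simp add: o_def sum_list_distinct_conv_sum_set)
    also have "\<dots> = hinner (f (g u)) (f (g (cnj x))) / (q (g u) * cnj (q (g (cnj x))))"
      unfolding hinner_def P_def by (simp add: sum_divide_distrib)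
    also have "\<dots> = (1 + u * x) ^ d"
      unfolding ker[OF g(2)[OF u] g(2)[OF cx]] using q(2)[OF g(2)[OF u]] q(2)[OF g(2)[OF cx]] g(3)[OF u] g(3)[OF cx]
      by simp
    finally show ?thesis .
  qed
  define c where "c = (\<lambda>i. (\<chi> k. (deriv ^^ i) (P k) 0 / fact i) :: complex ^ 'm)"
  have gram: "hinner (c i) (c j) = (if i = j then of_nat (d choose j) else 0)" for i j
  proof -
    have "jet ts i j 0 0 = (\<Sum>k\<in>UNIV. (deriv ^^ i) (P k) 0 * cnj ((deriv ^^ j) (P k) 0))"
      unfolding ts_def jet_def using ks by (simp add: o_def sum_list_distinct_conv_sum_set)
    also have "\<dots> = fact i * fact j * hinner (c i) (c j)"
      unfolding hinner_def c_def by (simp add: sum_distrib_left)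
    finally show ?thesis using binomial_kernel_gram[OF holt s kert, of i j] by (auto split: if_splits)
  qed
  have c0: "c j = 0" if "j > d" for j
    using gram[of j j] that by (simp add: binomial_eq_0)
  have Psum: "P k u = (\<Sum>j\<le>d. c j $ k * u ^ j)" if u: "u \<in> ball 0 s" for k u
  proof -
    have "(\<lambda>n. (deriv ^^ n) (P k) 0 / fact n * (u - 0) ^ n) sums P k u"
      by (rule holomorphic_power_series[OF holP u])
    then have "(\<lambda>n. c n $ k * u ^ n) sums P k u" by (simp add: c_def)
    moreover have "(\<lambda>n. c n $ k * u ^ n) sums (\<Sum>n\<in>{..d}. c n $ k * u ^ n)"
      by (rule sums_finite) (auto simp: c0)
    ultimately show ?thesis using sums_unique2 by blast
  qed
  have fP: "f w = q w *s (\<Sum>j\<le>d. v w ^ j *s c j)" if w: "w \<in> ball 0 \<sigma>" for w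
  proof -
    have "w \<in> ball 0 \<rho>" using w \<sigma>(2) by auto
    then have "f w $ k = q w * P k (v w)" for k using q(2) \<sigma>(3)[OF w] by (simp add: P_def)
    then show ?thesis using \<sigma>(3)[OF w] by (simp add: vec_eq_iff Psum mult.commute)
  qed
  have card: "CARD('m) = n + 1" using bij_betw_same_card[OF \<iota>] by simp
  have "d \<le> n"
  proof -
    have "card {..d} \<le> CARD('m)"
      by (rule orthogonal_family_card_le[where x = "\<lambda>i k. c i $ k" and \<beta> = "\<lambda>i. real (d choose i)"])
         (use gram in \<open>auto simp: hinner_def\<close>)
    then show ?thesis using card by simp
  qed
  moreover have "n \<le> d"
  proof (rule ccontr)
    assume "\<not> n \<le> d"
    \<comment> \<open>a matrix with a zero row has a nonzero kernel vector, orthogonal to all \<open>c j\<close>\<close>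
    define B :: "complex ^ 'm ^ 'm" where "B = (\<chi> i k. if \<iota> i \<le> d then cnj (c (\<iota> i) $ k) else 0)"
    obtain i0 where i0: "\<iota> i0 = n" using bij_betw_imp_surj_on[OF \<iota>] by (metis atMost_iff imageE order_refl)
    have "\<not> (\<exists>C. C ** B = mat 1)"
    proof
      assume "\<exists>C. C ** B = mat 1"
      then obtain C where "C ** B = mat 1" by blast
      then have "B ** C = mat 1" by (simp add: matrix_left_right_inverse)
      then have "(B ** C) $ i0 $ i0 = 1" by (simp add: mat_def)
      then show False using i0 \<open>\<not> n \<le> d\<close> by (simp add: B_def matrix_matrix_mult_def)
    qed
    then obtain u where u: "B *v u = 0" "u \<noteq> 0" unfolding matrix_left_invertible_ker by blast
    have cu: "hinner (c j) u = 0" if "j \<le> d" for j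
    proof -
      have "j \<in> range \<iota>"
        unfolding bij_betw_imp_surj_on[OF \<iota>] using that \<open>\<not> n \<le> d\<close> by simp
      then obtain i where i: "\<iota> i = j" by blast
      have "(B *v u) $ i = 0" using u(1) by simp
      then have "hinner u (c j) = 0" using i that by (simp add: B_def matrix_vector_mult_def hinner_def mult.commute)
      then show ?thesis by (rule hinner_eq_0_commute)
    qed
    have "u = 0"
      by (rule full[OF \<sigma>(1,2)]) (simp add: fP hinner_scale_left hinner_sum_left cu)
    then show False using u(2) by simp
  qed
  ultimately have dn: "d = n" by simp
  define A :: "complex ^ 'm ^ 'm" where "A = (\<chi> k i. c (\<iota> i) $ k / of_real (sqrt (of_nat (n choose \<iota> i))))"
  have \<iota>n: "\<iota> i \<le> n" for i using bij_betwE[OF \<iota>] by auto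
  have pos: "n choose \<iota> i > 0" for i using \<iota>n by simp
  have sq: "complex_of_real (sqrt (of_nat m)) * of_real (sqrt (of_nat m)) = of_nat m" for m :: nat
    by (simp flip: of_real_mult)
  have "cadjoint A ** A = mat 1"
  proof -
    have "(cadjoint A ** A) $ i $ j = (if i = j then 1 else 0)" for i j
    proof -
      have "(cadjoint A ** A) $ i $ j = hinner (c (\<iota> j)) (c (\<iota> i)) /
          (of_real (sqrt (of_nat (n choose \<iota> i))) * of_real (sqrt (of_nat (n choose \<iota> j))))"
        by (simp add: cadjoint_def A_def matrix_matrix_mult_def hinner_def sum_divide_distrib mult_ac)
      then show ?thesis
        using pos[of i] bij_betw_imp_inj_on[OF \<iota>] by (auto simp: gram dn sq inj_on_def)
    qed
    then show ?thesis by (simp add: mat_def vec_eq_iff)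
  qed
  then have "unitary_matrix A" unfolding unitary_matrix_def by (simp add: matrix_left_right_inverse)
  moreover have "vec.span {f w} = (\<lambda>x. A *v x) ` veronese \<iota> n (v w)" if w: "w \<in> ball 0 \<sigma>" for w
  proof -
    define V :: "complex ^ 'm" where "V = (\<chi> i. of_real (sqrt (of_nat (n choose \<iota> i))) * v w ^ \<iota> i)"
    have AV: "A *v V = (\<Sum>j\<le>d. v w ^ j *s c j)"
    proof -
      have "(A *v V) $ k = (\<Sum>j\<le>d. v w ^ j *s c j) $ k" for k
      proof -
        have "(A *v V) $ k = (\<Sum>i\<in>UNIV. v w ^ \<iota> i * c (\<iota> i) $ k)"
          unfolding matrix_vector_mult_def A_def V_def using \<iota>n by (simp add: mult_ac leD)
        also have "\<dots> = (\<Sum>j\<le>n. v w ^ j * c j $ k)"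
          by (rule sum.reindex_bij_betw[OF \<iota>])
        finally show ?thesis by (simp add: dn)
      qed
      then show ?thesis by (simp add: vec_eq_iff)
    qed
    have qw: "q w \<noteq> 0" using q(2) w \<sigma>(2) by auto
    have fw: "f w = q w *s (A *v V)" using fP[OF w] AV by simp
    have lin: "A *v (a *s x) = a *s (A *v x)" for a x
      by (simp add: matrix_vector_mult_def vec_eq_iff sum_distrib_left mult_ac)
    have "(\<lambda>x. A *v x) ` veronese \<iota> n (v w) = range (\<lambda>a. a *s (A *v V))"
      unfolding veronese_def V_def[symmetric] span_single by (auto simp: lin image_image)
    also have "\<dots> = range (\<lambda>a. a *s f w)"
    proof (intro equalityI subsetI)
      fix x assume "x \<in> range (\<lambda>a. a *s (A *v V))"
      then obtain a where "x = a *s (A *v V)" by blast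
      then have "x = (a / q w) *s f w" using qw by (simp add: fw vec.scale_scale)
      then show "x \<in> range (\<lambda>a. a *s f w)" by blast
    next
      fix x assume "x \<in> range (\<lambda>a. a *s f w)"
      then obtain a where "x = a *s f w" by blast
      then have "x = (a * q w) *s (A *v V)" by (simp add: fw vec.scale_scale)
      then show "x \<in> range (\<lambda>a. a *s (A *v V))" by blast
    qed
    finally show ?thesis by (simp add: span_single)
  qed
  ultimately show ?thesis using that \<sigma>(1,2) by blast
qed

section \<open>Charts and the theorem\<close>

lemma atlas_subset_coordinates:
  "riemann_surface \<A> \<Longrightarrow> \<A> \<subseteq> coordinates \<A>"
  by (auto simp: riemann_surface_def coordinates_def)

lemma chart_facts:
  assumes "(U, z) \<in> coordinates \<A>"
  shows "open U" "open (z ` U)" "inj_on z U" "continuous_on U z"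
    "\<And>p. p \<in> U \<Longrightarrow> inv_into U z (z p) = p" "continuous_on (z ` U) (inv_into U z)"
proof -
  have c: "open U" "open (z ` U)" "homeomorphism U (z ` U) z (inv_into U z)"
    using assms by (auto simp: coordinates_def is_chart_def)
  then show "open U" "open (z ` U)" "continuous_on U z" "continuous_on (z ` U) (inv_into U z)"
    and inv: "\<And>p. p \<in> U \<Longrightarrow> inv_into U z (z p) = p"
    by (auto simp: homeomorphism_def)
  show "inj_on z U" by (rule inj_on_inverseI) (rule inv)
qed

lemma coordinates_compose:
  assumes atlas: "\<forall>c\<in>\<A>. is_chart c" and Uz: "(U, z) \<in> coordinates \<A>" and V: "open V" "V \<subseteq> z ` U"
    and g: "g holomorphic_on V" "inj_on g V"
  shows "(U \<inter> z -` V, g \<circ> z) \<in> coordinates \<A>"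
proof -
  note z = chart_facts[OF Uz]
  define U' where "U' = U \<inter> z -` V"
  have zU': "z ` U' = V" using V(2) by (auto simp: U'_def)
  have opU': "open U'" unfolding U'_def by (rule continuous_open_preimage[OF z(4,1) V(1)])
  have opgV: "open (g ` V)" by (rule open_mapping_thm3[OF g(1) V(1) g(2)])
  have im: "(g \<circ> z) ` U' = g ` V" by (simp only: image_comp[symmetric] zU')
  obtain h where h: "h holomorphic_on g ` V" "\<And>x. x \<in> V \<Longrightarrow> h (g x) = x"
    using holomorphic_has_inverse[OF g(1) V(1) g(2)] by metis
  have inj: "inj_on (g \<circ> z) U'"
    using comp_inj_on[OF inj_on_subset[OF z(3)], of U' g] g(2) zU' by (auto simp: U'_def)
  have inv: "inv_into U' (g \<circ> z) x = inv_into U z (h x)" if x: "x \<in> g ` V" for x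
  proof -
    obtain p where p: "p \<in> U'" "x = g (z p)" using x zU' by (metis imageE)
    have "inv_into U' (g \<circ> z) x = p" using inv_into_f_f[OF inj p(1)] p(2) by simp
    moreover have "h x = z p" using h(2)[of "z p"] p by (auto simp: U'_def)
    moreover have "inv_into U z (z p) = p" using z(5) p(1) by (auto simp: U'_def)
    ultimately show ?thesis by simp
  qed
  have chart: "is_chart (U', g \<circ> z)"
    unfolding is_chart_def split im
  proof (intro conjI opU' opgV)
    have "homeomorphism U' V z (inv_into U z)"
    proof (rule homeomorphism_of_subsets)
      show "homeomorphism U (z ` U) z (inv_into U z)"
        using Uz by (auto simp: coordinates_def is_chart_def)
    qed (use V(2) zU' in \<open>auto simp: U'_def\<close>)
    moreover have "homeomorphism V (g ` V) g h"
      using holomorphic_on_imp_continuous_on[OF g(1)] holomorphic_on_imp_continuous_on[OF h(1)] h(2)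
      by (auto simp: homeomorphism_def image_image)
    ultimately have "homeomorphism U' (g ` V) (g \<circ> z) (inv_into U z \<circ> h)"
      by (rule homeomorphism_compose)
    then show "homeomorphism U' (g ` V) (g \<circ> z) (inv_into U' (g \<circ> z))"
      by (rule homeomorphism_cong) (auto simp: inv)
  qed
  moreover have "compatible_charts (U', g \<circ> z) (Y, y)" if d: "(Y, y) \<in> \<A>" for Y y
    unfolding compatible_charts_def split
  proof
    have comp: "(y \<circ> inv_into U z) holomorphic_on z ` (U \<inter> Y)" "(z \<circ> inv_into Y y) holomorphic_on y ` (U \<inter> Y)"
      using Uz d by (auto simp: coordinates_def compatible_charts_def)
    show "y \<circ> inv_into U' (g \<circ> z) holomorphic_on (g \<circ> z) ` (U' \<inter> Y)"
    proof -
      have sub: "(g \<circ> z) ` (U' \<inter> Y) \<subseteq> g ` V" using zU' by auto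
      have "h ` (g \<circ> z) ` (U' \<inter> Y) \<subseteq> z ` (U \<inter> Y)"
        using h(2) by (auto simp: U'_def)
      then have "(y \<circ> inv_into U z) \<circ> h holomorphic_on (g \<circ> z) ` (U' \<inter> Y)"
        by (rule holomorphic_on_compose_gen[OF holomorphic_on_subset[OF h(1) sub] comp(1)])
      then show ?thesis
        by (rule holomorphic_transform) (use sub inv in auto)
    qed
    show "g \<circ> z \<circ> inv_into Y y holomorphic_on y ` (U' \<inter> Y)"
    proof -
      have invY: "inv_into Y y (y q) = q" if "q \<in> Y" for q
      proof -
        have "is_chart (Y, y)" using atlas d by blast
        then show ?thesis using that by (auto simp: is_chart_def homeomorphism_def)
      qed
      have "(z \<circ> inv_into Y y) holomorphic_on y ` (U' \<inter> Y)"
        by (rule holomorphic_on_subset[OF comp(2)]) (auto simp: U'_def)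
      moreover have "(z \<circ> inv_into Y y) ` y ` (U' \<inter> Y) \<subseteq> V" using invY zU' by auto
      ultimately have "g \<circ> (z \<circ> inv_into Y y) holomorphic_on y ` (U' \<inter> Y)"
        by (intro holomorphic_on_compose_gen[OF _ g(1)])
      then show ?thesis by (simp add: o_assoc)
    qed
  qed
  ultimately show ?thesis unfolding coordinates_def U'_def by auto
qed

lemma Ck_on_subset: "Ck_on k W s \<Longrightarrow> V \<subseteq> W \<Longrightarrow> Ck_on k V s"
  by (induction k arbitrary: s) (auto intro: continuous_on_subset differentiable_on_subset)

lemma smooth_on_subset: "smooth_on W s \<Longrightarrow> V \<subseteq> W \<Longrightarrow> smooth_on V s"
  unfolding smooth_on_def using Ck_on_subset by blast

lemma flag_differential_in_coord:
  "flag_differential (in_coord U z (flag_lift \<psi>)) X w i j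
    = second_fund (in_coord U z (\<psi> i)) (in_coord U z (\<psi> j) w) X w"
  by (simp add: flag_differential_def in_coord_def flag_lift_def o_def)

lemma trace_cadjoint: "trace (A ** cadjoint A) = of_real (\<Sum>i\<in>UNIV. \<Sum>j\<in>UNIV. (cmod (A $ i $ j))\<^sup>2)"
  by (simp add: trace_def matrix_matrix_mult_def cadjoint_def complex_norm_square del: of_real_power)

lemma immersion_metric_pos:
  fixes \<Psi> :: "complex \<Rightarrow> 'm::finite flag"
  assumes lam: "invariant_flag_metric n lam"
    and ne: "i \<le> n" "j \<le> n" "i \<noteq> j" "flag_differential \<Psi> (1, 0) w i j \<noteq> 0"
  shows "pullback_metric n lam \<Psi> w $ 1 $ 1 > 0"
proof -
  define N where "N = (\<lambda>A :: complex ^ 'm ^ 'm. \<Sum>k\<in>UNIV. \<Sum>l\<in>UNIV. (cmod (A $ k $ l))\<^sup>2)"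
  define \<xi> where "\<xi> = flag_differential \<Psi> (1, 0) w"
  have N0: "N A \<ge> 0" for A unfolding N_def by (intro sum_nonneg) auto
  have "\<xi> i j \<noteq> 0" using ne(4) by (simp add: \<xi>_def)
  then obtain k l where "\<xi> i j $ k $ l \<noteq> 0" by (metis vec_eq_iff zero_index)
  then have "0 < (cmod (\<xi> i j $ k $ l))\<^sup>2" by simp
  also have "\<dots> \<le> (\<Sum>l\<in>UNIV. (cmod (\<xi> i j $ k $ l))\<^sup>2)" by (rule member_le_sum) auto
  also have "\<dots> \<le> N (\<xi> i j)" unfolding N_def
    by (rule member_le_sum[of k UNIV "\<lambda>k. \<Sum>l\<in>UNIV. (cmod (\<xi> i j $ k $ l))\<^sup>2"]) (auto intro: sum_nonneg)
  finally have Nij: "N (\<xi> i j) > 0" .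
  have lampos: "lam a b > 0" if "a \<le> n" "b \<in> {..n} - {a}" for a b
    using lam that by (auto simp: invariant_flag_metric_def)
  have lamN: "0 \<le> lam a b * N A" if "a \<le> n" "b \<in> {..n} - {a}" for a b A
    using lampos[OF that] N0 by (simp add: less_imp_le)
  have "pullback_metric n lam \<Psi> w $ 1 $ 1 = (\<Sum>a\<le>n. \<Sum>b\<in>{..n} - {a}. lam a b * N (\<xi> a b))"
    by (simp add: pullback_metric_def flag_metric_def coord_vec_def trace_cadjoint N_def \<xi>_def)
  also have "\<dots> \<ge> (\<Sum>b\<in>{..n} - {i}. lam i b * N (\<xi> i b))"
    by (rule member_le_sum[of i "{..n}" "\<lambda>a. \<Sum>b\<in>{..n} - {a}. lam a b * N (\<xi> a b)"])
       (use ne lamN in \<open>auto intro!: sum_nonneg\<close>)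
  moreover have "(\<Sum>b\<in>{..n} - {i}. lam i b * N (\<xi> i b)) \<ge> lam i j * N (\<xi> i j)"
    by (rule member_le_sum[of j "{..n} - {i}" "\<lambda>b. lam i b * N (\<xi> i b)"])
       (use ne lamN in auto)
  moreover have "lam i j * N (\<xi> i j) > 0" using lampos[of i j] ne Nij by auto
  ultimately show ?thesis by linarith
qed

lemma prod_ballD: "\<forall>(U, z)\<in>S. P U z \<Longrightarrow> (U, z) \<in> S \<Longrightarrow> P U z"
  by auto

text \<open>Locally at each point a coordinate \<open>z\<close> centred there, frames of the bundles and a holomorphic lift
are chosen on a common disc; the coordinate in which the curve is the Veronese curve is \<open>v \<circ> z\<close>,
with \<open>v\<close> from the factorisation of the kernel of the lift.\<close>

theorem theorem5p2:
  fixes \<A> :: "('a::t2_space) chart set"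
    and n :: nat
    and \<iota> :: "'m::finite \<Rightarrow> nat"
    and \<psi> :: "nat \<Rightarrow> 'a \<Rightarrow> (complex ^ 'm) set"
  assumes "riemann_surface \<A>"
    and "simply_connected (UNIV :: 'a set)"
    and "n > 1"
    and "bij_betw \<iota> UNIV {0..n}"
    and "holomorphic_line_map \<A> (\<psi> 0)"
    and "full_map (\<psi> 0)"
    and "harmonic_sequence \<A> n \<psi>"
    and "primitive_map \<A> n (flag_lift \<psi>)"
    and "flag_immersion \<A> n (flag_lift \<psi>)"
    and "\<exists>lam k. invariant_flag_metric n lam \<and> (\<forall>j<n. k j > 0) \<and>
           induces_sum_metric \<A> n lam k \<psi> \<and>
           constant_curvature \<A> n lam (flag_lift \<psi>)"
  shows "locally_congruent_veronese \<A> \<iota> n (\<psi> 0)"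
proof -
  have rs: "riemann_surface \<A>" and \<iota>0: "bij_betw \<iota> UNIV {0..n}"
    and hol: "holomorphic_line_map \<A> (\<psi> 0)" and hs: "harmonic_sequence \<A> n \<psi>"
    and prim: "primitive_map \<A> n (flag_lift \<psi>)" and imm: "flag_immersion \<A> n (flag_lift \<psi>)"
    and n: "n > 0" using assms by auto
  have \<iota>: "bij_betw \<iota> UNIV {..n}" using \<iota>0 by (simp add: atLeast0AtMost)
  have atlas: "\<forall>c\<in>\<A>. is_chart c" and cover: "(\<Union>(U, z)\<in>\<A>. U) = UNIV"
    using rs by (auto simp: riemann_surface_def)
  obtain lam k where lam: "invariant_flag_metric n lam" and k: "\<And>j. j < n \<Longrightarrow> k j > 0"
    and ind: "induces_sum_metric \<A> n lam k \<psi>" and cc: "constant_curvature \<A> n lam (flag_lift \<psi>)"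
    using assms(10) by blast
  obtain K where K: "\<And>U z w. (U, z) \<in> coordinates \<A> \<Longrightarrow> w \<in> z ` U \<Longrightarrow>
      gauss_curvature (pullback_metric n lam (in_coord U z (flag_lift \<psi>))) w = K"
    using cc unfolding constant_curvature_def by fast
  have smooth: "smooth_flag_map \<A> n (flag_lift \<psi>)" using prim by (simp add: primitive_map_def)
  have flag: "full_flag n (flag_lift \<psi> p)" for p using smooth by (simp add: smooth_flag_map_def)
  show ?thesis
    unfolding locally_congruent_veronese_def
  proof
    fix p :: 'a
    have "p \<in> (\<Union>(U, z)\<in>\<A>. U)" unfolding cover by simp
    then obtain U z1 where "(U, z1) \<in> \<A>" and pU: "p \<in> U" by auto
    then have Uz1: "(U, z1) \<in> coordinates \<A>" using atlas_subset_coordinates[OF rs] by blast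
    \<comment> \<open>translate the coordinate so that \<open>p\<close> corresponds to the origin\<close>
    define z where "z = (\<lambda>w. w - z1 p) \<circ> z1"
    have "(U \<inter> z1 -` (z1 ` U), z) \<in> coordinates \<A>"
      unfolding z_def
      by (rule coordinates_compose[OF atlas Uz1 chart_facts(2)[OF Uz1]])
         (auto intro!: holomorphic_intros simp: inj_on_def)
    moreover have "U \<inter> z1 -` (z1 ` U) = U" by auto
    ultimately have Uz: "(U, z) \<in> coordinates \<A>" by simp
    have zp: "z p = 0" by (simp add: z_def)
    note chart = chart_facts[OF Uz]
    have zero: "0 \<in> z ` U" using pU zp by (metis image_eqI)
    obtain W and f :: "complex \<Rightarrow> complex ^ 'm" where W: "open W" "0 \<in> W" and f: "\<And>i. (\<lambda>v. f v $ i) holomorphic_on W"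
      "\<And>v. v \<in> W \<Longrightarrow> f v \<noteq> 0 \<and> in_coord U z (\<psi> 0) v = vec.span {f v}"
    proof -
      have "\<exists>W. \<exists>s :: complex \<Rightarrow> complex ^ 'm. open W \<and> 0 \<in> W \<and> W \<subseteq> z ` U \<and> (\<forall>i. (\<lambda>v. s v $ i) holomorphic_on W) \<and>
          (\<forall>v\<in>W. s v \<noteq> 0 \<and> in_coord U z (\<psi> 0) v = vec.span {s v})"
        by (rule bspec[OF prod_ballD[OF conjunct2[OF hol[unfolded holomorphic_line_map_def]] Uz] zero])
      then show ?thesis using that by (elim exE conjE) blast
    qed
    have "\<exists>V s. open V \<and> 0 \<in> V \<and> V \<subseteq> z ` U \<and> smooth_on V s \<and>
         (\<forall>v\<in>V. s v \<noteq> 0 \<and> in_coord U z (\<psi> j) v = vec.span {s v})" if "j \<le> n" for j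
    proof -
      have sb: "smooth_line_bundle \<A> (\<psi> j)" using hs that by (simp add: harmonic_sequence_def)
      show ?thesis
        by (rule bspec[OF prod_ballD[OF conjunct2[OF sb[unfolded smooth_line_bundle_def]] Uz] zero])
    qed
    then obtain V s where V: "\<And>j. j \<le> n \<Longrightarrow> open (V j) \<and> 0 \<in> V j \<and> V j \<subseteq> z ` U \<and> smooth_on (V j) (s j) \<and>
         (\<forall>v\<in>V j. s j v \<noteq> 0 \<and> in_coord U z (\<psi> j) v = vec.span {s j v})" by metis
    have op: "open (W \<inter> (\<Inter>j\<in>{..n}. V j))" using W V by (intro open_Int open_INT) auto
    have "0 \<in> W \<inter> (\<Inter>j\<in>{..n}. V j)" using W V by auto
    from openE[OF op this] obtain r where r: "r > 0" "ball 0 r \<subseteq> W \<inter> (\<Inter>j\<in>{..n}. V j)" .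
    have rW: "ball 0 r \<subseteq> W" and rV: "\<And>j. j \<le> n \<Longrightarrow> ball 0 r \<subseteq> V j" using r(2) by auto
    have rU: "ball 0 r \<subseteq> z ` U" using rV[of 0] V[of 0] by auto
    define \<Psi> where "\<Psi> = (\<lambda>j. in_coord U z (\<psi> j))"
    have \<Psi>s: "\<Psi> j w = vec.span {s j w}" "s j w \<noteq> 0" if "j \<le> n" "w \<in> ball 0 r" for j w
      using V[OF that(1)] rV[OF that(1)] that(2) by (auto simp: \<Psi>_def)
    interpret orthogonal_frames n "ball 0 r" s \<Psi> \<iota>
    proof
      show "smooth_on (ball 0 r) (s j)" if "j \<le> n" for j
        using smooth_on_subset[of "V j" "s j"] V[OF that] rV[OF that] by blast
      show "hinner (s i w) (s j w) = 0" if "i \<le> n" "j \<le> n" "i \<noteq> j" "w \<in> ball 0 r" for i j w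
      proof -
        have "\<psi> i (inv_into U z w) \<subseteq> horth (\<psi> j (inv_into U z w))"
          using flag[of "inv_into U z w"] that by (auto simp: full_flag_def flag_lift_def)
        then have "\<Psi> i w \<subseteq> horth (\<Psi> j w)" by (simp add: \<Psi>_def in_coord_def)
        moreover have "s i w \<in> \<Psi> i w" "s j w \<in> \<Psi> j w" using \<Psi>s that by (auto intro: vec.span_base)
        ultimately show ?thesis by (auto simp: horth_def)
      qed
    qed (use \<Psi>s \<iota> in auto)
    have fd: "flag_differential (in_coord U z (flag_lift \<psi>)) X w i j = second_fund (\<Psi> i) (\<Psi> j w) X w" for X w i j
      unfolding \<Psi>_def by (rule flag_differential_in_coord)
    interpret primitive_frames n "ball 0 r" s \<Psi> \<iota>
    proof
      fix i j :: nat and w :: complex assume i: "i < n" and j: "j \<le> n" "j \<noteq> i" "j \<noteq> Suc i" and w: "w \<in> ball 0 r"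
      have "\<forall>w\<in>z ` U. \<forall>i\<le>n. \<forall>j\<le>n. i \<noteq> j \<and> j \<noteq> Suc i mod Suc n \<longrightarrow>
          flag_differential (in_coord U z (flag_lift \<psi>)) del_z w i j = 0"
        by (rule prod_ballD[OF conjunct2[OF prim[unfolded primitive_map_def]] Uz])
      then have "flag_differential (in_coord U z (flag_lift \<psi>)) del_z w i j = 0"
        using i j w rU by auto
      then show "hinner (dvec del_z (s i) w) (s j w) = 0"
        unfolding fd by (intro second_fund_zero) (use i j w in auto)
    qed
    interpret holomorphic_frames n "ball 0 r" s \<Psi> \<iota> f
    proof
      show "(\<lambda>z. f z $ k) holomorphic_on ball 0 r" for k using f(1) rW holomorphic_on_subset by blast
      show "f w \<noteq> 0" "f w \<in> \<Psi> 0 w" if "w \<in> ball 0 r" for w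
        using f(2)[of w] rW that vec.span_base[of "f w" "{f w}"] by (auto simp: \<Psi>_def)
    qed
    interpret ball_frames n r s \<Psi> \<iota> f
    proof
      fix Y :: "complex set" assume Y: "open Y" "Y \<subseteq> ball 0 r" "Y \<noteq> {}"
      define N where "N = (\<lambda>j. {w \<in> z ` U. \<Psi> (Suc j) w \<noteq> (\<lambda>v. A' (\<Psi> j) w *v v) ` \<Psi> j w})"
      have "negligible (N j)" if "j < n" for j
      proof -
        have im: "\<forall>(U, z)\<in>coordinates \<A>. negligible {w \<in> z ` U.
            in_coord U z (\<psi> (Suc j)) w \<noteq> (\<lambda>v. A' (in_coord U z (\<psi> j)) w *v v) ` in_coord U z (\<psi> j) w}"
          using hs that unfolding harmonic_sequence_def by blast
        show ?thesis unfolding N_def \<Psi>_def by (rule prod_ballD[OF im Uz])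
      qed
      then have "negligible (\<Union>j\<in>{..<n}. N j)" by (intro negligible_Union) auto
      moreover have "\<not> negligible Y" using open_not_negligible Y by blast
      ultimately have "\<not> Y \<subseteq> (\<Union>j\<in>{..<n}. N j)" using negligible_subset by blast
      then obtain w where w: "w \<in> Y" "\<And>j. j < n \<Longrightarrow> w \<notin> N j" by blast
      have wr: "w \<in> ball 0 r" using w(1) Y(2) by blast
      have "b i w \<noteq> 0" if "i < n" for i
        by (rule b_nonzero[OF that wr]) (use w(2)[OF that] wr rU in \<open>auto simp: N_def\<close>)
      then show "\<exists>w\<in>Y. \<forall>i<n. b i w \<noteq> 0" using w(1) by blast
    qed (use r n in auto)
    define g where "g = pullback_metric n lam (in_coord U z (flag_lift \<psi>))"
    have g: "g w = mat (\<Sum>j<n. of_nat (k j) * gamma (\<Psi> j) w)" if "w \<in> ball 0 r" for w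
    proof -
      have "\<forall>w\<in>z ` U. g w = mat (\<Sum>j<n. of_nat (k j) * gamma (in_coord U z (\<psi> j)) w)"
        unfolding g_def by (rule prod_ballD[OF ind[unfolded induces_sum_metric_def] Uz])
      then show ?thesis using that rU by (auto simp: \<Psi>_def)
    qed
    have pos: "(\<Sum>j<n. of_nat (k j) * gamma (\<Psi> j) w) > 0" if w: "w \<in> ball 0 r" for w
    proof -
      have "\<forall>w\<in>z ` U. \<forall>a b :: real. (a, b) \<noteq> (0, 0) \<longrightarrow> (\<exists>i\<le>n. \<exists>j\<le>n. i \<noteq> j \<and>
           flag_differential (in_coord U z (flag_lift \<psi>)) (of_real a, of_real b) w i j \<noteq> 0)"
        by (rule prod_ballD[OF conjunct2[OF imm[unfolded flag_immersion_def]] Uz])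
      then have "\<exists>i\<le>n. \<exists>j\<le>n. i \<noteq> j \<and>
           flag_differential (in_coord U z (flag_lift \<psi>)) (of_real 1, of_real 0) w i j \<noteq> 0"
        using w rU by (metis Pair_inject subsetD zero_neq_one)
      then obtain i j where ij: "i \<le> n" "j \<le> n" "i \<noteq> j"
        "flag_differential (in_coord U z (flag_lift \<psi>)) (1, 0) w i j \<noteq> 0" by auto
      from immersion_metric_pos[OF lam ij] have "g w $ 1 $ 1 > 0" by (simp add: g_def)
      then show ?thesis unfolding g[OF w] by (simp add: mat_def)
    qed
    have Kg: "gauss_curvature g w = K" if "w \<in> ball 0 r" for w
      unfolding g_def by (rule K[OF Uz]) (use that rU in blast)
    obtain \<rho> v q d where \<rho>: "0 < \<rho>" "\<rho> \<le> r" and v: "v holomorphic_on ball 0 \<rho>" "inj_on v (ball 0 \<rho>)" "v 0 = 0"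
      and q: "q holomorphic_on ball 0 \<rho>" "\<And>z. z \<in> ball 0 \<rho> \<Longrightarrow> q z \<noteq> 0"
      and ker: "\<And>z x. z \<in> ball 0 \<rho> \<Longrightarrow> x \<in> ball 0 \<rho> \<Longrightarrow>
         hinner (f z) (f x) = q z * cnj (q x) * (1 + v z * cnj (v x)) ^ d"
      by (rule kernel_factorisation[of k g K, OF k pos g Kg]) (assumption | rule that)+
    have \<rho>r: "ball (0::complex) \<rho> \<subseteq> ball 0 r" using \<rho>(2) by auto
    have f\<rho>: "(\<lambda>z. f z $ k) holomorphic_on ball 0 \<rho>" for k
      using f_hol \<rho>r holomorphic_on_subset by blast
    have full: "u = 0" if "\<sigma> > 0" "\<sigma> \<le> \<rho>" "\<And>w. w \<in> ball 0 \<sigma> \<Longrightarrow> hinner (f w) u = 0" for \<sigma> u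
      by (rule locally_full[of "ball 0 \<sigma>"]) (use that \<rho>(2) in auto)
    obtain A \<sigma> where A: "unitary_matrix A" and \<sigma>: "\<sigma> > 0" "\<sigma> \<le> \<rho>"
      "\<And>w. w \<in> ball 0 \<sigma> \<Longrightarrow> vec.span {f w} = (\<lambda>x. A *v x) ` veronese \<iota> n (v w)"
      by (rule veronese_rigidity[OF \<iota> \<rho>(1) f\<rho> v q ker full]) (assumption | rule that)+
    have \<sigma>\<rho>: "ball (0::complex) \<sigma> \<subseteq> ball 0 \<rho>" using \<sigma>(2) by auto
    have "(U \<inter> z -` ball 0 \<sigma>, v \<circ> z) \<in> coordinates \<A>"
      by (rule coordinates_compose[OF atlas Uz open_ball])
         (use \<sigma>\<rho> \<rho>r rU holomorphic_on_subset[OF v(1) \<sigma>\<rho>] inj_on_subset[OF v(2) \<sigma>\<rho>] in blast)+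
    moreover have "p \<in> U \<inter> z -` ball 0 \<sigma>" using pU zp \<sigma>(1) by simp
    moreover have "\<psi> 0 x = (\<lambda>y. A *v y) ` veronese \<iota> n ((v \<circ> z) x)" if x: "x \<in> U \<inter> z -` ball 0 \<sigma>" for x
    proof -
      have zx: "z x \<in> ball 0 \<sigma>" "x \<in> U" using x by auto
      have "z x \<in> W" using zx(1) \<sigma>\<rho> \<rho>r rW by blast
      then have "in_coord U z (\<psi> 0) (z x) = vec.span {f (z x)}" using f(2) by blast
      then have "\<psi> 0 x = vec.span {f (z x)}" using chart(5)[OF zx(2)] by (simp add: in_coord_def)
      then show ?thesis using \<sigma>(3)[OF zx(1)] by simp
    qed
    ultimately show "\<exists>U w A. (U, w) \<in> coordinates \<A> \<and> p \<in> U \<and> unitary_matrix A \<and>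
        (\<forall>q\<in>U. \<psi> 0 q = (\<lambda>v. A *v v) ` veronese \<iota> n (w q))"
      using A by blast
  qed
qed

end
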